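(* For every constant $c>0$, unless the Exponential Time Hypothesis fails, there is no function $f$ such that the Directed Steiner Tree problem can be solved in time $f(k)\,n^{o(k/\log k)}$ on $n$-vertex directed graphs of degeneracy at most $c\log n$, where $k$ is the solution size; this holds even when the subdigraph induced by the terminals is acyclic.
   Context: Directed Steiner Tree (DST): the input is a directed graph $D=(V,A)$, a root $r\in V$, a set $T\subseteq V\setminus\{r\}$ of terminals and an integer $k$; the question is whether there is a set $S\subseteq V\setminus(T\cup\{r\})$ with $|S|\le k$ such that $D[S\cup T\cup\{r\}]$ contains a directed path from $r$ to every $t\in T$. Degeneracy of a digraph is the least $d$ such that every subgraph of its underlying undirected graph has a vertex of degree at most $d$. The Exponential Time Hypothesis (ETH) states that 3-SAT on $n$ variables cannot be solved in time $2^{o(n)}$. *)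

theory Defs
  imports Complex_Main "HOL-Library.Landau_Symbols" "Graph_Theory.Graph_Theory"
begin

section \<open>Machine model\<close>

text \<open>
  Time is measured on a deterministic random access machine with read-only random access
  input and unit-cost instructions. Addition and (truncated) subtraction are the only arithmetic
  operations, so that this unit-cost measure is polynomially related to Turing machine time.
  The bounds \<open>2\<^bsup>o(n)\<^esup>\<close> and \<open>f(k) n\<^bsup>o(k / log k)\<^esup>\<close> considered below are
  insensitive to polynomial changes of the running time.
\<close>

datatype instr =
    Const nat nat
  | Add nat nat nat
  | Sub nat nat nat
  | Load nat nat
  | Store nat nat
  | Input nat nat
  | JumpZero nat nat

type_synonym program = "instr list"
type_synonym config = "nat \<times> (nat \<Rightarrow> nat)"  \<comment> \<open>program counter and registers\<close>

fun exec_instr :: "nat list \<Rightarrow> instr \<Rightarrow> config \<Rightarrow> config" where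
  "exec_instr xs (Const i c) (pc, m) = (Suc pc, m(i := c))"
| "exec_instr xs (Add i j l) (pc, m) = (Suc pc, m(i := m j + m l))"
| "exec_instr xs (Sub i j l) (pc, m) = (Suc pc, m(i := m j - m l))"
| "exec_instr xs (Load i j) (pc, m) = (Suc pc, m(i := m (m j)))"
| "exec_instr xs (Store i j) (pc, m) = (Suc pc, m(m i := m j))"
| "exec_instr xs (Input i j) (pc, m) = (Suc pc, m(i := (if m j < length xs then xs ! m j else 0)))"
| "exec_instr xs (JumpZero i l) (pc, m) = ((if m i = 0 then l else Suc pc), m)"

text \<open>A program halts by leaving its code; a halted configuration is a fixed point.\<close>

definition ram_step :: "program \<Rightarrow> nat list \<Rightarrow> config \<Rightarrow> config" where
  "ram_step p xs s = (if fst s < length p then exec_instr xs (p ! fst s) s else s)"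

definition initial_config :: "nat list \<Rightarrow> config" where
  "initial_config xs = (0, (\<lambda>_. 0)(0 := length xs))"

text \<open>On input \<open>xs\<close> the program halts after at most \<open>t\<close> steps, with register 0 holding a
  nonzero value (``yes'') or zero (``no'') according to \<open>b\<close>.\<close>

definition answers_within :: "program \<Rightarrow> nat list \<Rightarrow> real \<Rightarrow> bool \<Rightarrow> bool" where
  "answers_within p xs t b \<longleftrightarrow>
     (\<exists>j pc m. real j \<le> t \<and> (ram_step p xs ^^ j) (initial_config xs) = (pc, m) \<and>
        length p \<le> pc \<and> (m 0 \<noteq> 0 \<longleftrightarrow> b))"

text \<open>Instances outside \<open>X\<close> are not constrained: \<open>X\<close> is a promise on the input.\<close>

definition solves_in_time ::
  "program \<Rightarrow> ('i \<Rightarrow> nat list) \<Rightarrow> 'i set \<Rightarrow> ('i \<Rightarrow> bool) \<Rightarrow> ('i \<Rightarrow> real) \<Rightarrow> bool" where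
  "solves_in_time p encode X yes t \<longleftrightarrow>
     (\<forall>I\<in>X. answers_within p (encode I) (t I) (yes I))"


section \<open>3-SAT and the Exponential Time Hypothesis\<close>

datatype literal = Pos (var: nat) | Neg (var: nat)

fun lit_true :: "(nat \<Rightarrow> bool) \<Rightarrow> literal \<Rightarrow> bool" where
  "lit_true \<alpha> (Pos v) \<longleftrightarrow> \<alpha> v"
| "lit_true \<alpha> (Neg v) \<longleftrightarrow> \<not> \<alpha> v"

text \<open>An instance is a pair of the number \<open>n\<close> of variables and a list of clauses over the
  variables \<open>0, \<dots>, n - 1\<close>. Clauses are not repeated, so the size of an instance is polynomial
  in \<open>n\<close> and a running time of the form \<open>2\<^bsup>o(n)\<^esup>\<close> does not need a separate factor for
  the length of the input.\<close>

type_synonym sat_instance = "nat \<times> literal list list"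

definition three_cnf :: "sat_instance set" where
  "three_cnf = {(n, F). distinct F \<and>
     (\<forall>C\<in>set F. length C \<le> 3 \<and> (\<forall>l\<in>set C. var l < n))}"

definition satisfiable :: "sat_instance \<Rightarrow> bool" where
  "satisfiable I \<longleftrightarrow> (\<exists>\<alpha>. \<forall>C\<in>set (snd I). \<exists>l\<in>set C. lit_true \<alpha> l)"

fun encode_literal :: "literal \<Rightarrow> nat" where
  "encode_literal (Pos v) = 2 * v"
| "encode_literal (Neg v) = 2 * v + 1"

definition encode_sat :: "sat_instance \<Rightarrow> nat list" where
  "encode_sat I = fst I # length (snd I) #
     concat (map (\<lambda>C. length C # map encode_literal C) (snd I))"

definition ETH :: bool where
  "ETH \<longleftrightarrow> \<not> (\<exists>p. \<exists>g :: nat \<Rightarrow> real. g \<in> o(\<lambda>n. real n) \<and>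
     solves_in_time p encode_sat three_cnf satisfiable (\<lambda>I. 2 powr g (fst I)))"


section \<open>Degeneracy and acyclicity\<close>

text \<open>Undirected graphs are symmetric digraphs, in which the degree of a vertex is its
  out-degree.\<close>

definition degeneracy :: "('a, 'b) pre_digraph \<Rightarrow> nat" where
  "degeneracy G = (LEAST d. \<forall>H. subgraph H (with_proj (mk_symmetric G)) \<and> symmetric H \<and>
     verts H \<noteq> {} \<longrightarrow> (\<exists>v\<in>verts H. out_degree H v \<le> d))"

definition acyclic_digraph :: "('a, 'b) pre_digraph \<Rightarrow> bool" where
  "acyclic_digraph G \<longleftrightarrow> \<not> (\<exists>p. pre_digraph.cycle G p)"


section \<open>Directed Steiner Tree\<close>

record 'a dst_instance =
  dst_graph :: "'a pair_pre_digraph"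
  dst_root :: 'a
  dst_terminals :: "'a set"
  dst_budget :: nat

definition dst_yes :: "'a dst_instance \<Rightarrow> bool" where
  "dst_yes I \<longleftrightarrow>
     (\<exists>S \<subseteq> pverts (dst_graph I) - (dst_terminals I \<union> {dst_root I}). card S \<le> dst_budget I \<and>
        (\<forall>t\<in>dst_terminals I. \<exists>p. pre_digraph.apath
           (with_proj (dst_graph I) \<restriction> (S \<union> dst_terminals I \<union> {dst_root I})) (dst_root I) p t))"

definition dst_order :: "'a dst_instance \<Rightarrow> nat" where
  "dst_order I = card (pverts (dst_graph I))"

text \<open>As inputs for a machine, digraphs have the vertices \<open>0, \<dots>, n - 1\<close> and are given by
  their adjacency matrix.\<close>

definition dst_inputs :: "nat dst_instance set" where
  "dst_inputs = {I. pair_digraph (dst_graph I) \<and> pverts (dst_graph I) = {..<dst_order I} \<and>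
     dst_root I \<in> pverts (dst_graph I) \<and>
     dst_terminals I \<subseteq> pverts (dst_graph I) - {dst_root I}}"

definition encode_dst :: "nat dst_instance \<Rightarrow> nat list" where
  "encode_dst I = [dst_order I, dst_budget I, dst_root I] @
     map (\<lambda>v. of_bool (v \<in> dst_terminals I)) [0..<dst_order I] @
     concat (map (\<lambda>u. map (\<lambda>v. of_bool ((u, v) \<in> parcs (dst_graph I))) [0..<dst_order I])
       [0..<dst_order I])"

text \<open>\<open>X\<close> is the class of instances to which the problem is restricted; the parameter \<open>k\<close>
  is the budget.\<close>

definition dst_fast_solvable_on :: "nat dst_instance set \<Rightarrow> bool" where
  "dst_fast_solvable_on X \<longleftrightarrow>
     (\<exists>p. \<exists>f :: nat \<Rightarrow> real. \<exists>h :: nat \<Rightarrow> real. h \<in> o(\<lambda>k. real k / log 2 (real k)) \<and>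
        solves_in_time p encode_dst X dst_yes
          (\<lambda>I. f (dst_budget I) * real (dst_order I) powr h (dst_budget I)))"

end

theory Submission
  imports Defs "HOL-Real_Asymp.Real_Asymp"
begin

text \<open>
  A fast program for Directed Steiner Tree yields a subexponential program for 3-SAT.
  Branching sparsifies a 3-CNF formula on \<open>n\<close> variables: while some heart lies in many clauses,
  add either the heart or all its petals as clauses. Charging 2-clauses to the literals
  that are not yet units bounds the number of leaves by \<open>2\<^bsup>\<epsilon>n\<^esup>\<close>, and in every leaf each literal occurs
  only boundedly often.

  Split the variables of a leaf into \<open>k\<close> groups. The root has arcs to all partial assignments of all
  groups, and a partial assignment has arcs to a terminal for its group and to the terminals of the
  clauses that it satisfies. With budget \<open>k\<close> this is a yes-instance iff the leaf is satisfiable.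
  The degrees of partial assignments are \<open>O(n / k)\<close> and every arc meets a partial assignment, so the
  degeneracy is \<open>O(n / k)\<close>; isolated vertices raise the order to \<open>N = 2\<^bsup>O(n / k)\<^esup>\<close> and the
  degeneracy becomes at most \<open>c log N\<close>. Since \<open>h(k) = o(k)\<close>, the time \<open>f(k) N\<^bsup>h(k)\<^esup>\<close> is
  \<open>2\<^bsup>\<epsilon>n\<^esup>\<close> for a suitable constant \<open>k\<close> and large \<open>n\<close>.

  Neither \<open>f\<close> nor \<open>h\<close> need be computable, so the 3-SAT program tries all sparsification parameters
  and all \<open>k\<close> with increasing fuel, simulating the given program. It is obtained from a calculus of
  functions that are computable by machine programs in time polynomial in the size of their arguments;
  polynomial overheads do not matter for the bound.
\<close>

text \<open>The budget \<open>k\<close> stays constant while \<open>n\<close> grows. Then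
  \<open>f k\<close> is a constant, and with N = 2^(O(n/k)) the other factor is 2^(O(n h(k)/k)), so
  the decisive point is that h(k)/k tends to 0. The constant inside O(n/k) depends on the
  sparsification, which dictates the order of choice: first the target rate, then \<open>E\<close>
  with threshold \<open>D = E * E\<close>, and only then \<open>k\<close>. The degeneracy must fit
  under \<open>c\<close> log N for an arbitrarily small \<open>c\<close>; a factor \<open>M\<close>
  of at least 1/c in the padding exponent achieves this and merely changes that constant.

  The given program may be trusted only inside its promise. Exponentially large objects are
  therefore built with caps, and a leaf is evaluated only if its full padding fits into the fuel, in
  which case no cap has cut anything off. Hence every conclusive attempt is right whatever its
  parameters, and the first one can be returned. A single program thus serves all rates at once, and
  its running time is below the bound obtained from each fixed choice of \<open>E\<close> and
  \<open>k\<close>.\<close>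

section \<open>Polynomial bounds\<close>

text \<open>Natural coefficients make all these polynomials monotone (\<open>polyb_mono\<close>), so
  an upper bound for a size may be inserted in place of the size, and bounds compose.\<close>

inductive polyb :: "(nat \<Rightarrow> nat) \<Rightarrow> bool" where
  polyb_id: "polyb (\<lambda>x. x)"
| polyb_const: "polyb (\<lambda>x. c)"
| polyb_add: "polyb p \<Longrightarrow> polyb q \<Longrightarrow> polyb (\<lambda>x. p x + q x)"
| polyb_mult: "polyb p \<Longrightarrow> polyb q \<Longrightarrow> polyb (\<lambda>x. p x * q x)"

lemma polyb_mono: "polyb p \<Longrightarrow> x \<le> y \<Longrightarrow> p x \<le> p y"
  by (induction rule: polyb.induct) (auto intro: add_mono mult_mono)

lemma polyb_compose: "polyb p \<Longrightarrow> polyb q \<Longrightarrow> polyb (\<lambda>x. p (q x))"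
  by (induction rule: polyb.induct) (auto intro: polyb.intros)

lemma polyb_power: "polyb p \<Longrightarrow> polyb (\<lambda>x. p x ^ k)"
  by (induction k) (auto intro: polyb.intros)

lemma polyb_Suc: "polyb p \<Longrightarrow> polyb (\<lambda>x. Suc (p x))"
  using polyb_add[OF polyb_const[of 1]] by simp

lemmas polyb_intros = polyb_id polyb_const polyb_add polyb_mult polyb_power polyb_Suc

text \<open>The base is at least 2, so a constant is absorbed by \<open>c \<le> 2 ^ c\<close> and a
  sum by one more factor. In this form the overhead of the 3-SAT program enters the final estimate
  as a fixed power \<open>C\<close>.\<close>

lemma polyb_le_power:
  assumes "polyb p" shows "\<exists>C. \<forall>x. p x \<le> (x + 2) ^ C"
  using assms
proof induction
  case polyb_id
  then show ?case by (intro exI[of _ 1]) auto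
next
  case (polyb_const c)
  have "c \<le> (x + 2) ^ c" for x :: nat
  proof -
    have "c \<le> 2 ^ c" by (simp add: less_imp_le)
    also have "\<dots> \<le> (x + 2) ^ c" by (intro power_mono) auto
    finally show ?thesis .
  qed
  then show ?case by blast
next
  case (polyb_add p q)
  then obtain C D where C: "\<forall>x. p x \<le> (x + 2) ^ C" and D: "\<forall>x. q x \<le> (x + 2) ^ D" by blast
  have "p x + q x \<le> (x + 2) ^ Suc (C + D)" for x
  proof -
    have "p x + q x \<le> (x + 2) ^ C + (x + 2) ^ D" using C D by (simp add: add_mono)
    also have "\<dots> \<le> (x + 2) ^ (C + D) + (x + 2) ^ (C + D)"
      by (intro add_mono power_increasing) auto
    also have "\<dots> \<le> (x + 2) ^ Suc (C + D)" by simp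
    finally show ?thesis .
  qed
  then show ?case by blast
next
  case (polyb_mult p q)
  then obtain C D where C: "\<forall>x. p x \<le> (x + 2) ^ C" and D: "\<forall>x. q x \<le> (x + 2) ^ D" by blast
  have "p x * q x \<le> (x + 2) ^ (C + D)" for x
    using mult_mono[OF C[rule_format, of x] D[rule_format, of x]] by (simp add: power_add)
  then show ?case by blast
qed

section \<open>Data in the memory of the machine\<close>

text \<open>\<open>rep m R e v x\<close>: in memory \<open>m\<close>, whose heap occupies the addresses from \<open>R\<close> to \<open>e - 1\<close>,
  the register value \<open>v\<close> represents \<open>x\<close>. The size of a number is its value, because
  numbers serve as loop bounds.\<close>

class pdata =
  fixes rep :: "(nat \<Rightarrow> nat) \<Rightarrow> nat \<Rightarrow> nat \<Rightarrow> nat \<Rightarrow> 'a \<Rightarrow> bool"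
    and psize :: "'a \<Rightarrow> nat"
  assumes rep_mono: "rep m R e v x \<Longrightarrow> (\<And>a. R \<le> a \<Longrightarrow> a < e \<Longrightarrow> m' a = m a) \<Longrightarrow> e \<le> e' \<Longrightarrow>
    rep m' R e' v x"

instantiation nat :: pdata
begin
definition "rep_nat (m :: nat \<Rightarrow> nat) (R :: nat) (e :: nat) (v :: nat) (x :: nat) \<longleftrightarrow> v = x"
definition "psize_nat (x :: nat) = x"
instance by standard (simp add: rep_nat_def)
end

instantiation bool :: pdata
begin
definition "rep_bool (m :: nat \<Rightarrow> nat) (R :: nat) (e :: nat) (v :: nat) (x :: bool) \<longleftrightarrow> (v \<noteq> 0) = x"
definition "psize_bool (x :: bool) = (0 :: nat)"
instance by standard (simp add: rep_bool_def)
end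

text \<open>Numbers of size 0, for registers of a simulated machine, which may hold values exponential
  in the running time.\<close>

datatype big = Big (unbig: nat)

instantiation big :: pdata
begin
definition "rep_big (m :: nat \<Rightarrow> nat) (R :: nat) (e :: nat) (v :: nat) (x :: big) \<longleftrightarrow> Big v = x"
definition "psize_big (x :: big) = (0 :: nat)"
instance by standard (simp add: rep_big_def)
end

instantiation prod :: (pdata, pdata) pdata
begin
definition "rep_prod m R e v x \<longleftrightarrow>
  R \<le> v \<and> v + 1 < e \<and> rep m R e (m v) (fst x) \<and> rep m R e (m (v + 1)) (snd x)"
definition "psize_prod x = psize (fst x) + psize (snd x) + 1"
instance
proof
  fix m m' :: "nat \<Rightarrow> nat" and R e e' v :: nat and x :: "'a \<times> 'b"
  assume a: "rep m R e v x" and b: "\<And>a. R \<le> a \<Longrightarrow> a < e \<Longrightarrow> m' a = m a" and c: "e \<le> e'"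
  from a have v: "R \<le> v" "v + 1 < e" "rep m R e (m v) (fst x)" "rep m R e (m (v + 1)) (snd x)"
    by (auto simp: rep_prod_def)
  have "m' v = m v" "m' (v + 1) = m (v + 1)" using v b by auto
  moreover have "rep m' R e' (m v) (fst x)" "rep m' R e' (m (v + 1)) (snd x)"
    using v(3,4) b c by (auto intro: rep_mono)
  ultimately show "rep m' R e' v x" using v c by (auto simp: rep_prod_def)
qed
end

text \<open>A nonempty list is laid out like the pair of its head and its tail, so turning a pair
  into a list cell and back is a mere rereading of the same address. Address 0 is free to denote the
  empty list, as it lies below every heap.\<close>

instantiation list :: (pdata) pdata
begin
fun rep_list where
  "rep_list m R e v [] \<longleftrightarrow> v = 0"
| "rep_list m R e v (x # xs) \<longleftrightarrow> v \<noteq> 0 \<and> R \<le> v \<and> v + 1 < e \<and> rep m R e (m v) x \<and> rep_list m R e (m (v + 1)) xs"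
fun psize_list where
  "psize_list [] = 0"
| "psize_list (x # xs) = psize x + psize_list xs + 1"
instance
proof
  fix m m' :: "nat \<Rightarrow> nat" and R e e' v :: nat and xs :: "'a list"
  assume a: "rep m R e v xs" and b: "\<And>a. R \<le> a \<Longrightarrow> a < e \<Longrightarrow> m' a = m a" and c: "e \<le> e'"
  from a show "rep m' R e' v xs"
  proof (induction xs arbitrary: v)
    case (Cons x xs)
    then have v: "v \<noteq> 0" "R \<le> v" "v + 1 < e" "rep m R e (m v) x" "rep m R e (m (v + 1)) xs" by auto
    have "m' v = m v" "m' (v + 1) = m (v + 1)" using v b by auto
    moreover have "rep m' R e' (m v) x" using v(4) b c by (auto intro: rep_mono)
    ultimately show ?case using v c Cons.IH[OF v(5)] by auto
  qed simp
qed
end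

lemma psize_Pair: "psize (x, y) = psize x + psize y + 1"
  by (simp add: psize_prod_def)

section \<open>Program fragments\<close>

definition occurs_at :: "program \<Rightarrow> nat \<Rightarrow> instr list \<Rightarrow> bool" where
  "occurs_at P b c \<longleftrightarrow> (\<exists>us vs. P = us @ c @ vs \<and> length us = b)"

lemma occurs_at_append:
  "occurs_at P b (c @ d) \<longleftrightarrow> occurs_at P b c \<and> occurs_at P (b + length c) d"
proof
  assume "occurs_at P b (c @ d)"
  then obtain us vs where P: "P = us @ (c @ d) @ vs" "length us = b" by (auto simp: occurs_at_def)
  have "P = us @ c @ (d @ vs)" "P = (us @ c) @ d @ vs" "length (us @ c) = b + length c"
    using P by auto
  then show "occurs_at P b c \<and> occurs_at P (b + length c) d" using P(2) unfolding occurs_at_def by blast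
next
  assume H: "occurs_at P b c \<and> occurs_at P (b + length c) d"
  obtain us vs where P1: "P = us @ c @ vs" "length us = b" using H unfolding occurs_at_def by blast
  obtain us' vs' where P2: "P = us' @ d @ vs'" "length us' = b + length c"
    using H unfolding occurs_at_def by blast
  note P = P1 P2
  have "us' = take (b + length c) P" using P(3,4) by simp
  also have "\<dots> = us @ c" using P(1,2) by simp
  finally have "P = us @ (c @ d) @ vs'" using P2(1) by simp
  then show "occurs_at P b (c @ d)" using P1(2) unfolding occurs_at_def by blast
qed

lemma occurs_at_Cons:
  "occurs_at P b (i # c) \<longleftrightarrow> occurs_at P b [i] \<and> occurs_at P (Suc b) c"
  using occurs_at_append[of P b "[i]" c] by simp

lemma occurs_at_single: "occurs_at P b [i] \<Longrightarrow> b < length P \<and> P ! b = i"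
  by (auto simp: occurs_at_def)

definition reach :: "program \<Rightarrow> nat list \<Rightarrow> nat \<Rightarrow> config \<Rightarrow> config \<Rightarrow> bool" where
  "reach P xs t s s' \<longleftrightarrow> (\<exists>j\<le>t. (ram_step P xs ^^ j) s = s')"

lemma reach_refl: "reach P xs t s s"
  by (auto simp: reach_def intro: exI[of _ 0])

lemma reach_trans: "reach P xs t s s' \<Longrightarrow> reach P xs u s' s'' \<Longrightarrow> t + u \<le> w \<Longrightarrow> reach P xs w s s''"
proof -
  assume "reach P xs t s s'" "reach P xs u s' s''" "t + u \<le> w"
  then obtain i j where "i \<le> t" "j \<le> u" "(ram_step P xs ^^ i) s = s'" "(ram_step P xs ^^ j) s' = s''"
    by (auto simp: reach_def)
  then have "(ram_step P xs ^^ (j + i)) s = s''" "j + i \<le> w" using \<open>t + u \<le> w\<close> by (auto simp: funpow_add)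
  then show ?thesis unfolding reach_def by blast
qed

lemma reach_mono: "reach P xs t s s' \<Longrightarrow> t \<le> w \<Longrightarrow> reach P xs w s s'"
  by (rule reach_trans[OF _ reach_refl[of _ _ 0]]) auto

lemma reach_step:
  "occurs_at P b [i] \<Longrightarrow> exec_instr xs i (b, m) = s \<Longrightarrow> reach P xs 1 (b, m) s"
  using occurs_at_single[of P b i] unfolding reach_def
  by (intro exI[of _ 1]) (auto simp: ram_step_def)

lemma reach_Cons:
  "occurs_at P b (i # c) \<Longrightarrow> exec_instr xs i (b, m) = (Suc b, m') \<Longrightarrow> reach P xs t (Suc b, m') s \<Longrightarrow>
    reach P xs (Suc t) (b, m) s"
  using reach_trans[OF reach_step] by (metis occurs_at_Cons le_refl plus_1_eq_Suc)

fun straight :: "instr \<Rightarrow> bool" where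
  "straight (JumpZero _ _) = False"
| "straight _ = True"

definition effect :: "nat list \<Rightarrow> instr \<Rightarrow> (nat \<Rightarrow> nat) \<Rightarrow> (nat \<Rightarrow> nat)" where
  "effect xs i m = snd (exec_instr xs i (0, m))"

lemma effect_simps [simp]:
  "effect xs (Const i c) m = m(i := c)"
  "effect xs (Add i j l) m = m(i := m j + m l)"
  "effect xs (Sub i j l) m = m(i := m j - m l)"
  "effect xs (Load i j) m = m(i := m (m j))"
  "effect xs (Store i j) m = m(m i := m j)"
  "effect xs (Input i j) m = m(i := (if m j < length xs then xs ! m j else 0))"
  by (simp_all add: effect_def)

lemma reach_straight:
  "occurs_at P b c \<Longrightarrow> \<forall>i\<in>set c. straight i \<Longrightarrow>
    reach P xs (length c) (b, m) (b + length c, fold (effect xs) c m)"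
proof (induction c arbitrary: b m)
  case Nil
  then show ?case by (simp add: reach_refl)
next
  case (Cons i c)
  have "exec_instr xs i (b, m) = (Suc b, effect xs i m)"
    using Cons.prems(2) by (cases i) auto
  moreover have "reach P xs (length c) (Suc b, effect xs i m) (Suc b + length c, fold (effect xs) c (effect xs i m))"
    using Cons.prems by (intro Cons.IH) (auto simp: occurs_at_Cons[of _ _ i c])
  ultimately show ?case using reach_Cons[OF Cons.prems(1)] by simp
qed

text \<open>Register 0 holds 0, register 1 the end of the heap, register 2 holds 1.\<close>

definition regs_ok :: "nat \<Rightarrow> (nat \<Rightarrow> nat) \<Rightarrow> bool" where
  "regs_ok R m \<longleftrightarrow> m 0 = 0 \<and> m 2 = 1 \<and> R \<le> m 1"

text \<open>The frame condition: the old part of the heap is never overwritten and the heap only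
  grows, so whatever was represented before a fragment ran remains represented
  (\<open>rep_keeps\<close>), and data may be shared. Register 1 is exempt because it is the
  allocation pointer.\<close>

definition keeps :: "nat \<Rightarrow> nat \<Rightarrow> (nat \<Rightarrow> nat) \<Rightarrow> (nat \<Rightarrow> nat) \<Rightarrow> bool" where
  "keeps r R m m' \<longleftrightarrow> m 1 \<le> m' 1 \<and>
     (\<forall>a. a \<noteq> 1 \<longrightarrow> a < r \<or> R \<le> a \<and> a < m 1 \<longrightarrow> m' a = m a)"

lemma keeps_trans: "keeps r R m m' \<Longrightarrow> keeps r' R m' m'' \<Longrightarrow> r \<le> r' \<Longrightarrow> keeps r R m m''"
  by (fastforce simp: keeps_def)

lemma keeps_ok: "keeps r R m m' \<Longrightarrow> 3 \<le> r \<Longrightarrow> regs_ok R m \<Longrightarrow> regs_ok R m'"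
  by (auto simp: keeps_def regs_ok_def)

lemma keeps_reg: "keeps r R m m' \<Longrightarrow> a < r \<Longrightarrow> a \<noteq> 1 \<Longrightarrow> m' a = m a"
  by (auto simp: keeps_def)

lemma rep_keeps: "rep m R (m 1) v x \<Longrightarrow> keeps r R m m' \<Longrightarrow> 3 \<le> R \<Longrightarrow> rep m' R (m' 1) v x"
  by (erule rep_mono) (auto simp: keeps_def)

text \<open>\<open>gen b r\<close> is told its own address \<open>b\<close>, since jumps are
  absolute, and the register \<open>r\<close> for argument and result; scratch registers reach up to
  \<open>r + w\<close>. The length \<open>L\<close> is the same for all \<open>b\<close> and
  \<open>r\<close>, so jump targets are known before the code in between is generated. The start
  \<open>R\<close> of the heap stays open until the scratch space of the whole program is known. One
  \<open>q\<close> bounds the time and the size of the result, because the next fragment runs on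
  that result.\<close>

definition computes ::
  "(nat \<Rightarrow> nat \<Rightarrow> instr list) \<Rightarrow> nat \<Rightarrow> nat \<Rightarrow> ('a::pdata \<Rightarrow> 'b::pdata) \<Rightarrow> (nat \<Rightarrow> nat) \<Rightarrow> bool" where
  "computes gen L w f q \<longleftrightarrow> polyb q \<and> (\<forall>b r. length (gen b r) = L) \<and> (\<forall>x. psize (f x) \<le> q (psize x)) \<and>
    (\<forall>P xs b r R m x. occurs_at P b (gen b r) \<longrightarrow> 3 \<le> r \<longrightarrow> r + w < R \<longrightarrow> regs_ok R m \<longrightarrow>
       rep m R (m 1) (m r) x \<longrightarrow>
       (\<exists>m'. reach P xs (q (psize x)) (b, m) (b + L, m') \<and> keeps r R m m' \<and> rep m' R (m' 1) (m' r) (f x)))"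

definition PT :: "('a::pdata \<Rightarrow> 'b::pdata) \<Rightarrow> bool" where
  "PT f \<longleftrightarrow> (\<exists>gen L w q. computes gen L w f q)"

lemma computesD:
  assumes "computes gen L w f q"
  shows "polyb q" "length (gen b r) = L" "psize (f x) \<le> q (psize x)"
    and "occurs_at P b (gen b r) \<Longrightarrow> 3 \<le> r \<Longrightarrow> r + w < R \<Longrightarrow> regs_ok R m \<Longrightarrow> rep m R (m 1) (m r) x \<Longrightarrow>
       \<exists>m'. reach P xs (q (psize x)) (b, m) (b + L, m') \<and> keeps r R m m' \<and> rep m' R (m' 1) (m' r) (f x)"
  using assms unfolding computes_def by auto

lemma PT_bound:
  assumes "PT f" obtains q where "polyb q" "\<And>x. psize (f x) \<le> q (psize x)"
  using assms computesD(1,3) unfolding PT_def by metis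

lemma PT_straight:
  fixes f :: "'a::pdata \<Rightarrow> 'b::pdata"
  assumes "polyb q" "\<And>x. psize (f x) \<le> q (psize x)" "\<And>r. \<forall>i\<in>set (c r). straight i"
    "\<And>r. length (c r) = L"
    "\<And>xs r R m x. 3 \<le> r \<Longrightarrow> r + w < R \<Longrightarrow> regs_ok R m \<Longrightarrow> rep m R (m 1) (m r) x \<Longrightarrow>
       keeps r R m (fold (effect xs) (c r) m) \<and>
       rep (fold (effect xs) (c r) m) R (fold (effect xs) (c r) m 1) (fold (effect xs) (c r) m r) (f x)"
  shows "PT f"
proof -
  have "computes (\<lambda>b r. c r) L w f (\<lambda>x. q x + L)"
    unfolding computes_def
  proof (intro conjI allI impI)
    show "polyb (\<lambda>x. q x + L)" using assms(1) by (intro polyb_intros)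
    show "psize (f x) \<le> q (psize x) + L" for x using assms(2)[of x] by simp
    fix P xs b r R m and x :: 'a
    assume H: "occurs_at P b (c r)" "3 \<le> r" "r + w < R" "regs_ok R m" "rep m R (m 1) (m r) x"
    show "\<exists>m'. reach P xs (q (psize x) + L) (b, m) (b + L, m') \<and> keeps r R m m' \<and> rep m' R (m' 1) (m' r) (f x)"
    proof (intro exI conjI)
      show "reach P xs (q (psize x) + L) (b, m) (b + L, fold (effect xs) (c r) m)"
        using reach_mono[OF reach_straight[OF H(1) assms(3)]] assms(4) by force
    qed (use assms(5)[OF H(2-5)] in auto)
  qed (use assms(4) in auto)
  then show ?thesis unfolding PT_def by blast
qed

section \<open>Closure under composition, pairing, case distinction and loops\<close>

lemma PT_id [intro!]: "PT (\<lambda>x. x)"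
  by (rule PT_straight[where c = "\<lambda>_. []" and w = 0 and q = "\<lambda>x. x"]) (auto intro: polyb_intros simp: keeps_def)

lemma PT_comp:
  fixes f :: "'a::pdata \<Rightarrow> 'b::pdata" and g :: "'b \<Rightarrow> 'c::pdata"
  assumes "PT g" "PT f" shows "PT (\<lambda>x. g (f x))"
proof -
  from assms obtain gf Lf wf qf gg Lg wg qg where f: "computes gf Lf wf f qf" and g: "computes gg Lg wg g qg"
    unfolding PT_def by blast
  let ?q = "\<lambda>x. qf x + qg (qf x)"
  have pq: "polyb ?q" by (rule polyb_add[OF computesD(1)[OF f] polyb_compose[OF computesD(1)[OF g] computesD(1)[OF f]]])
  have gq: "qg (psize (f x)) \<le> qg (qf (psize x))" for x
    using polyb_mono[OF computesD(1)[OF g] computesD(3)[OF f]] .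
  have "computes (\<lambda>b r. gf b r @ gg (b + Lf) r) (Lf + Lg) (wf + wg) (\<lambda>x. g (f x)) ?q"
    unfolding computes_def
  proof (intro conjI allI impI pq)
    show "psize (g (f x)) \<le> ?q (psize x)" for x using computesD(3)[OF g, of "f x"] gq[of x] by simp
    fix P xs b r R m and x :: 'a
    assume H: "occurs_at P b (gf b r @ gg (b + Lf) r)" "3 \<le> r" "r + (wf + wg) < R" "regs_ok R m" "rep m R (m 1) (m r) x"
    from H(1) have at: "occurs_at P b (gf b r)" "occurs_at P (b + Lf) (gg (b + Lf) r)"
      by (auto simp: occurs_at_append computesD(2)[OF f])
    obtain m1 where m1: "reach P xs (qf (psize x)) (b, m) (b + Lf, m1)" "keeps r R m m1" "rep m1 R (m1 1) (m1 r) (f x)"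
      using computesD(4)[OF f at(1) H(2) _ H(4,5)] H(3) by fastforce
    obtain m2 where m2: "reach P xs (qg (psize (f x))) (b + Lf, m1) (b + Lf + Lg, m2)" "keeps r R m1 m2" "rep m2 R (m2 1) (m2 r) (g (f x))"
      using computesD(4)[OF g at(2) H(2) _ keeps_ok[OF m1(2) H(2,4)] m1(3)] H(3) by fastforce
    show "\<exists>m'. reach P xs (?q (psize x)) (b, m) (b + (Lf + Lg), m') \<and> keeps r R m m' \<and> rep m' R (m' 1) (m' r) (g (f x))"
      using reach_trans[OF m1(1) m2(1), of "?q (psize x)"] gq[of x] keeps_trans[OF m1(2) m2(2)] m2(3) by (auto simp: add.assoc)
  qed (use computesD(2)[OF f] computesD(2)[OF g] in auto)
  then show ?thesis unfolding PT_def by blast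
qed

lemma keeps_copy: "s < R \<Longrightarrow> r \<le> s \<Longrightarrow> 3 \<le> r \<Longrightarrow> keeps r R m (m(s := v))"
  by (auto simp: keeps_def)

lemma PT_pair:
  fixes f :: "'a::pdata \<Rightarrow> 'b::pdata" and g :: "'a \<Rightarrow> 'c::pdata"
  assumes "PT f" "PT g" shows "PT (\<lambda>x. (f x, g x))"
proof -
  from assms obtain gf Lf wf qf gg Lg wg qg where f: "computes gf Lf wf f qf" and g: "computes gg Lg wg g qg"
    unfolding PT_def by blast
  let ?q = "\<lambda>x. qf x + qg x + 7"
  have pq: "polyb ?q" using computesD(1)[OF f] computesD(1)[OF g] by (intro polyb_intros)
  \<comment> \<open>Register 0 holds 0, so \<open>Add\<close> acts as a copy. The argument stays in
    \<open>r\<close> while \<open>f\<close> and \<open>g\<close> run on copies above it; the last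
    block allocates a two-word cell at the heap end.\<close>
  let ?c1 = "\<lambda>r. [Add (r + 1) r 0]" and ?c2 = "\<lambda>r. [Add (r + 2) r 0]"
  let ?c3 = "\<lambda>r. [Add r 1 0, Store 1 (r + 1), Add 1 1 2, Store 1 (r + 2), Add 1 1 2]"
  have "computes (\<lambda>b r. ?c1 r @ gf (b + 1) (r + 1) @ ?c2 r @ gg (b + Lf + 2) (r + 2) @ ?c3 r)
      (Lf + Lg + 7) (wf + wg + 2) (\<lambda>x. (f x, g x)) ?q"
    unfolding computes_def
  proof (intro conjI allI impI pq)
    show "psize (f x, g x) \<le> ?q (psize x)" for x
      using computesD(3)[OF f, of x] computesD(3)[OF g, of x] by (simp add: psize_Pair)
    fix P xs b r R m and x :: 'a
    assume H: "occurs_at P b (?c1 r @ gf (b + 1) (r + 1) @ ?c2 r @ gg (b + Lf + 2) (r + 2) @ ?c3 r)"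
      "3 \<le> r" "r + (wf + wg + 2) < R" "regs_ok R m" "rep m R (m 1) (m r) x"
    from H(1) have at: "occurs_at P b (?c1 r)" "occurs_at P (b + 1) (gf (b + 1) (r + 1))"
      "occurs_at P (b + Lf + 1) (?c2 r)" "occurs_at P (b + Lf + 2) (gg (b + Lf + 2) (r + 2))"
      "occurs_at P (b + Lf + Lg + 2) (?c3 r)"
      unfolding occurs_at_append by (auto simp: computesD(2)[OF f] computesD(2)[OF g] ac_simps eval_nat_numeral)
    have R3: "3 \<le> R" and m0: "m 0 = 0" using H by (auto simp: regs_ok_def)
    let ?m1 = "m(r + 1 := m r)"
    have s1: "reach P xs 1 (b, m) (b + 1, ?m1)" by (rule reach_step[OF at(1)]) (simp add: m0)
    have k1: "keeps (r + 1) R m ?m1" using H by (intro keeps_copy) auto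
    have x1: "rep ?m1 R (?m1 1) (m r) x" by (rule rep_keeps[OF H(5) k1 R3])
    have "\<exists>m2. reach P xs (qf (psize x)) (b + 1, ?m1) (b + 1 + Lf, m2) \<and> keeps (r + 1) R ?m1 m2 \<and> rep m2 R (m2 1) (m2 (r + 1)) (f x)"
      by (rule computesD(4)[OF f at(2)]) (use H x1 keeps_ok[OF k1] in auto)
    then obtain m2 where m2: "reach P xs (qf (psize x)) (b + 1, ?m1) (b + 1 + Lf, m2)" "keeps (r + 1) R ?m1 m2" "rep m2 R (m2 1) (m2 (r + 1)) (f x)"
      by blast
    have k2: "keeps (r + 1) R m m2" by (rule keeps_trans[OF k1 m2(2)]) auto
    have x2: "rep m2 R (m2 1) (m r) x" by (rule rep_keeps[OF H(5) k2 R3])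
    have m2r: "m2 r = m r" "m2 0 = 0" using keeps_reg[OF k2, of r] keeps_reg[OF k2, of 0] H m0 by auto
    let ?m3 = "m2(r + 2 := m r)"
    have s3: "reach P xs 1 (b + 1 + Lf, m2) (b + Lf + 2, ?m3)" by (rule reach_step) (use at(3) m2r in \<open>auto simp: ac_simps\<close>)
    have k3: "keeps (r + 2) R m2 ?m3" using H by (intro keeps_copy) auto
    have x3: "rep ?m3 R (?m3 1) (?m3 (r + 2)) x" using rep_keeps[OF x2 k3 R3] by simp
    have ok3: "regs_ok R ?m3" using keeps_ok[OF k3] keeps_ok[OF k2] H by auto
    have "\<exists>m4. reach P xs (qg (psize x)) (b + Lf + 2, ?m3) (b + Lf + 2 + Lg, m4) \<and> keeps (r + 2) R ?m3 m4 \<and> rep m4 R (m4 1) (m4 (r + 2)) (g x)"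
      by (rule computesD(4)[OF g at(4)]) (use H x3 ok3 in auto)
    then obtain m4 where m4: "reach P xs (qg (psize x)) (b + Lf + 2, ?m3) (b + Lf + 2 + Lg, m4)"
      "keeps (r + 2) R ?m3 m4" "rep m4 R (m4 1) (m4 (r + 2)) (g x)" by blast
    have k34: "keeps (r + 2) R m2 m4" by (rule keeps_trans[OF k3 m4(2)]) auto
    have k4: "keeps (r + 1) R m m4" by (rule keeps_trans[OF k2 k34]) auto
    have f4: "rep m4 R (m4 1) (m4 (r + 1)) (f x)"
      using rep_keeps[OF m2(3) k34 R3] keeps_reg[OF k34, of "r + 1"] H by auto
    have ok4: "regs_ok R m4" using keeps_ok[OF k4] H by auto
    have h: "R \<le> m4 1" "m4 0 = 0" "m4 2 = 1" using ok4 by (auto simp: regs_ok_def)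
    \<comment> \<open>Registers and heap share one memory. The new cell lies at \<open>R\<close> or
      above, so writing it disturbs no register in use.\<close>
    have ne: "m4 (Suc 0) \<noteq> 0" "m4 (Suc 0) \<noteq> Suc 0" "m4 (Suc 0) \<noteq> 2" "m4 (Suc 0) \<noteq> r"
      "m4 (Suc 0) \<noteq> Suc r" "m4 (Suc 0) \<noteq> Suc (Suc r)" "Suc (m4 (Suc 0)) \<noteq> r" "r \<noteq> Suc 0" "r \<noteq> 0" "r \<noteq> 2"
      "Suc r \<noteq> 2" "Suc (m4 (Suc 0)) \<noteq> 2" "Suc (m4 (Suc 0)) \<noteq> Suc r" using h H by auto
    define h0 where "h0 = m4 (Suc 0)"
    note ne = ne[folded h0_def]
    define a1 where "a1 = m4(r := h0)"
    define a2 where "a2 = a1(h0 := m4 (r + 1))"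
    define a3 where "a3 = a2(1 := Suc h0)"
    define a4 where "a4 = a3(Suc h0 := m4 (r + 2))"
    define m5 where "m5 = a4(1 := Suc (Suc h0))"
    have e1: "effect xs (Add r 1 0) m4 = a1" by (simp add: a1_def h h0_def)
    have b1: "a1 1 = h0" "a1 (r + 1) = m4 (r + 1)" by (simp_all add: a1_def h0_def ne ne[symmetric])
    have e2: "effect xs (Store 1 (r + 1)) a1 = a2" by (simp only: effect_simps b1 a2_def)
    have b2: "a2 1 = h0" "a2 2 = 1" "a2 (r + 2) = m4 (r + 2)" by (simp_all add: a2_def a1_def ne ne[symmetric] h h0_def[symmetric])
    have e3: "effect xs (Add 1 1 2) a2 = a3" by (simp only: effect_simps b2 a3_def) simp
    have b3: "a3 1 = Suc h0" "a3 (r + 2) = m4 (r + 2)" "a3 2 = 1" by (simp_all add: a3_def ne ne[symmetric] b2[simplified])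
    have e4: "effect xs (Store 1 (r + 2)) a3 = a4" by (simp only: effect_simps b3 a4_def)
    have b4: "a4 1 = Suc h0" "a4 2 = 1" by (simp_all add: a4_def ne ne[symmetric] b3[simplified])
    have e5': "effect xs (Add 1 1 2) a4 = m5" by (simp only: effect_simps b4 m5_def) simp
    have e5: "fold (effect xs) (?c3 r) m4 = m5"
      by (simp only: fold_simps e1 e2 e3 e4 e5')
    have v5: "m5 r = h0" "m5 h0 = m4 (r + 1)" "m5 (Suc h0) = m4 (r + 2)" "m5 1 = Suc (Suc h0)"
      by (simp_all add: m5_def a4_def a3_def a2_def a1_def ne ne[symmetric])
    have o5: "m5 a = m4 a" if "a \<noteq> 1" "a \<noteq> r" "a \<noteq> h0" "a \<noteq> Suc h0" for a
      using that by (auto simp: m5_def a4_def a3_def a2_def a1_def)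
    have st: "\<forall>i\<in>set (?c3 r). straight i" by simp
    have s5: "reach P xs 5 (b + Lf + 2 + Lg, m4) (b + Lf + Lg + 7, m5)"
      using reach_straight[OF at(5) st, of xs m4] unfolding e5 by (simp add: ac_simps eval_nat_numeral)
    have k45: "keeps r R m4 m5" unfolding keeps_def
    proof (intro conjI allI impI)
      show "m4 1 \<le> m5 1" by (simp only: v5) (simp add: h0_def)
      fix a assume a: "a \<noteq> 1" "a < r \<or> R \<le> a \<and> a < m4 1"
      then show "m5 a = m4 a" using h(1) H(3) by (intro o5) (auto simp: h0_def)
    qed
    have "rep m5 R (m5 1) (m4 (r + 1)) (f x)" "rep m5 R (m5 1) (m4 (r + 2)) (g x)"
      using rep_keeps[OF f4 k45 R3] rep_keeps[OF m4(3) k45 R3] .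
    then have r5: "rep m5 R (m5 1) (m5 r) (f x, g x)"
      unfolding rep_prod_def v5 using h(1) by (auto simp: v5[simplified, unfolded h0_def] h0_def)
    have k0: "keeps r R m m4" using k4 by (auto simp: keeps_def)
    have k5: "keeps r R m m5" by (rule keeps_trans[OF k0 k45]) simp
    note s12 = reach_trans[OF s1 m2(1) le_refl]
    note s123 = reach_trans[OF s12 s3 le_refl]
    note s1234 = reach_trans[OF s123 m4(1) le_refl]
    have "reach P xs (?q (psize x)) (b, m) (b + Lf + Lg + 7, m5)"
      by (rule reach_trans[OF s1234 s5]) simp
    then show "\<exists>m'. reach P xs (?q (psize x)) (b, m) (b + (Lf + Lg + 7), m') \<and> keeps r R m m' \<and> rep m' R (m' 1) (m' r) (f x, g x)"
      using k5 r5 by (intro exI[of _ m5] conjI) (simp_all only: add.assoc)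
  qed (use computesD(2)[OF f] computesD(2)[OF g] in auto)
  then show ?thesis unfolding PT_def by blast
qed

text \<open>Serves conditionals and case distinctions on lists alike. The code tests the second word
  of a pair cell, which in these two applications is 0 exactly for \<open>False\<close> and for
  \<open>[]\<close>. On 0 it continues with the first component, otherwise with the same address,
  which may then be reread as the value \<open>U p\<close> of another type.\<close>

lemma PT_branch:
  fixes h :: "'a::pdata \<times> 't::pdata \<Rightarrow> 'd::pdata" and f :: "'a \<Rightarrow> 'd" and g :: "'b::pdata \<Rightarrow> 'd"
  assumes "PT f" "PT g"
    and hs: "\<And>p. h p = f (fst p) \<or> h p = g (U p) \<and> psize (U p) \<le> psize p"
    and zero: "\<And>m R e v p. rep m R e v p \<Longrightarrow> m (v + 1) = 0 \<Longrightarrow> h p = f (fst p)"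
    and nonzero: "\<And>m R e v p. rep m R e v p \<Longrightarrow> m (v + 1) \<noteq> 0 \<Longrightarrow> h p = g (U p) \<and> rep m R e v (U p) \<and> psize (U p) \<le> psize p"
  shows "PT h"
proof -
  from assms obtain gf Lf wf qf gg Lg wg qg where f: "computes gf Lf wf f qf" and g: "computes gg Lg wg g qg"
    unfolding PT_def by blast
  let ?q = "\<lambda>x. qf x + qg x + 5"
  have pq: "polyb ?q" using computesD(1)[OF f] computesD(1)[OF g] by (intro polyb_intros)
  have qf: "qf (psize (fst p)) \<le> qf (psize p)" for p :: "'a \<times> 't"
    by (rule polyb_mono[OF computesD(1)[OF f]]) (simp add: psize_prod_def)
  have qg: "psize (U p) \<le> psize p \<Longrightarrow> qg (psize (U p)) \<le> qg (psize p)" for p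
    by (rule polyb_mono[OF computesD(1)[OF g]])
  let ?c1 = "\<lambda>r. [Add (r + 1) r 2, Load (r + 1) (r + 1)]"
  let ?c2 = "\<lambda>b r. [JumpZero (r + 1) (b + Lg + 4)]"
  let ?c3 = "\<lambda>b. [JumpZero 0 (b + Lf + Lg + 5)]"
  let ?c4 = "\<lambda>r. [Load r r]"
  have "computes (\<lambda>b r. ?c1 r @ ?c2 b r @ gg (b + 3) r @ ?c3 b @ ?c4 r @ gf (b + Lg + 5) r)
      (Lf + Lg + 5) (wf + wg + 2) h ?q"
    unfolding computes_def
  proof (intro conjI allI impI pq)
    show "psize (h p) \<le> ?q (psize p)" for p
      using hs[of p] computesD(3)[OF f, of "fst p"] computesD(3)[OF g, of "U p"] qf[of p] qg[of p] by auto
    fix P xs b r R m and p :: "'a \<times> 't"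
    assume H: "occurs_at P b (?c1 r @ ?c2 b r @ gg (b + 3) r @ ?c3 b @ ?c4 r @ gf (b + Lg + 5) r)"
      "3 \<le> r" "r + (wf + wg + 2) < R" "regs_ok R m" "rep m R (m 1) (m r) p"
    from H(1) have at: "occurs_at P b (?c1 r)" "occurs_at P (b + 2) (?c2 b r)" "occurs_at P (b + 3) (gg (b + 3) r)"
      "occurs_at P (b + Lg + 3) (?c3 b)" "occurs_at P (b + Lg + 4) (?c4 r)" "occurs_at P (b + Lg + 5) (gf (b + Lg + 5) r)"
      unfolding occurs_at_append by (auto simp: computesD(2)[OF f] computesD(2)[OF g] ac_simps eval_nat_numeral)
    have R3: "3 \<le> R" and m0: "m 0 = 0" "m 2 = 1" using H by (auto simp: regs_ok_def)
    let ?v = "m (m r + 1)"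
    let ?m1 = "m(r + 1 := ?v)"
    have vr: "R \<le> m r" "m r + 1 < m 1" "rep m R (m 1) (m (m r)) (fst p)" using H(5) by (auto simp: rep_prod_def)
    have s1: "reach P xs 2 (b, m) (b + 2, ?m1)"
      using reach_straight[OF at(1), of xs m] vr H m0 by (simp add: eval_nat_numeral)
    have k1: "keeps (r + 1) R m ?m1" using H by (intro keeps_copy) auto
    have k1': "keeps r R m ?m1" using k1 by (auto simp: keeps_def)
    have ok1: "regs_ok R ?m1" using keeps_ok[OF k1'] H by auto
    show "\<exists>m'. reach P xs (?q (psize p)) (b, m) (b + (Lf + Lg + 5), m') \<and> keeps r R m m' \<and> rep m' R (m' 1) (m' r) (h p)"
    proof (cases "?v = 0")
      case True
      have hp: "h p = f (fst p)" by (rule zero[OF H(5) True])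
      have s2: "reach P xs 1 (b + 2, ?m1) (b + Lg + 4, ?m1)"
        by (rule reach_step[OF at(2)]) (use True in simp)
      let ?m2 = "?m1(r := m (m r))"
      have s3: "reach P xs 1 (b + Lg + 4, ?m1) (b + Lg + 5, ?m2)"
        by (rule reach_step[OF at(5)]) (use vr H in auto)
      have k2: "keeps r R ?m1 ?m2" using H by (intro keeps_copy) auto
      have k12: "keeps r R m ?m2" by (rule keeps_trans[OF k1' k2]) simp
      have x2: "rep ?m2 R (?m2 1) (?m2 r) (fst p)" using rep_keeps[OF vr(3) k12 R3] by simp
      have "\<exists>m3. reach P xs (qf (psize (fst p))) (b + Lg + 5, ?m2) (b + Lg + 5 + Lf, m3) \<and> keeps r R ?m2 m3 \<and> rep m3 R (m3 1) (m3 r) (f (fst p))"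
        by (rule computesD(4)[OF f at(6) H(2) _ _ x2]) (use H keeps_ok[OF k12] in auto)
      then obtain m3 where m3: "reach P xs (qf (psize (fst p))) (b + Lg + 5, ?m2) (b + Lg + 5 + Lf, m3)" "keeps r R ?m2 m3" "rep m3 R (m3 1) (m3 r) (f (fst p))"
        by blast
      have "keeps r R m m3" by (rule keeps_trans[OF k12 m3(2)]) simp
      moreover have "reach P xs (?q (psize p)) (b, m) (b + Lg + 5 + Lf, m3)"
        by (rule reach_trans[OF reach_trans[OF reach_trans[OF s1 s2 le_refl] s3 le_refl] m3(1)]) (use qf[of p] in auto)
      ultimately show ?thesis using m3(3) hp by (intro exI[of _ m3]) (auto simp: ac_simps)
    next
      case False
      note hp = nonzero[OF H(5) False]
      have s2: "reach P xs 1 (b + 2, ?m1) (b + 3, ?m1)"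
        by (rule reach_step[OF at(2)]) (use False in \<open>simp add: eval_nat_numeral\<close>)
      have x2: "rep ?m1 R (?m1 1) (?m1 r) (U p)" using rep_keeps[OF _ k1 R3] hp by auto
      have "\<exists>m3. reach P xs (qg (psize (U p))) (b + 3, ?m1) (b + 3 + Lg, m3) \<and> keeps r R ?m1 m3 \<and> rep m3 R (m3 1) (m3 r) (g (U p))"
        by (rule computesD(4)[OF g at(3) H(2) _ ok1 x2]) (use H in auto)
      then obtain m3 where m3: "reach P xs (qg (psize (U p))) (b + 3, ?m1) (b + 3 + Lg, m3)" "keeps r R ?m1 m3" "rep m3 R (m3 1) (m3 r) (g (U p))"
        by blast
      have k: "keeps r R m m3" by (rule keeps_trans[OF k1' m3(2)]) simp
      have s4: "reach P xs 1 (b + 3 + Lg, m3) (b + Lf + Lg + 5, m3)"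
        by (rule reach_step) (use at(4) keeps_reg[OF k, of 0] m0 H in \<open>auto simp: ac_simps\<close>)
      have "reach P xs (?q (psize p)) (b, m) (b + Lf + Lg + 5, m3)"
        by (rule reach_trans[OF reach_trans[OF reach_trans[OF s1 s2 le_refl] m3(1) le_refl] s4]) (use qg[of p] hp in auto)
      then show ?thesis using m3(3) hp k by (intro exI[of _ m3]) (auto simp: ac_simps)
    qed
  qed (use computesD(2)[OF f] computesD(2)[OF g] in auto)
  then show ?thesis unfolding PT_def by blast
qed

text \<open>Besides the number \<open>K x\<close> of rounds, the size of every intermediate state
  has to be bounded in advance: a polynomial-time step may square the size of its argument, and
  iterating such a step leaves the polynomials.\<close>

lemma PT_while:
  fixes init :: "'a::pdata \<Rightarrow> 'b::pdata" and s :: "'b \<Rightarrow> 'b"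
  assumes "PT init" "PT c" "PT s" and pk: "polyb qk" and ps: "polyb qs"
    and K: "\<And>x. K x \<le> qk (psize x)"
    and sz: "\<And>x j. j \<le> K x \<Longrightarrow> psize ((s ^^ j) (init x)) \<le> qs (psize x)"
    and cont: "\<And>x j. j < K x \<Longrightarrow> c ((s ^^ j) (init x))"
    and stop: "\<And>x. \<not> c ((s ^^ K x) (init x))"
  shows "PT (\<lambda>x. (s ^^ K x) (init x))"
proof -
  from assms obtain gi Li wi qi gc Lc wc qc gs Ls ws qss where i: "computes gi Li wi init qi"
    and c: "computes gc Lc wc c qc" and s: "computes gs Ls ws s qss"
    unfolding PT_def by blast
  let ?T = "\<lambda>x. qc (qs x) + qss (qs x) + 3"
  let ?q = "\<lambda>x. qi x + (qk x + 1) * ?T x + qs x"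
  have pq: "polyb ?q"
    using computesD(1)[OF i] polyb_compose[OF computesD(1)[OF c] ps] polyb_compose[OF computesD(1)[OF s] ps] pk ps
    by (intro polyb_intros)
  let ?c1 = "\<lambda>r. [Add (r + 1) r 0]"
  let ?c2 = "\<lambda>b r. [JumpZero (r + 1) (b + Lc + Ls + 3)]"
  let ?c3 = "\<lambda>b. [JumpZero 0 b]"
  let ?loop = "\<lambda>b r. ?c1 r @ gc (b + 1) (r + 1) @ ?c2 b r @ gs (b + Lc + 2) r @ ?c3 b"
  have "computes (\<lambda>b r. gi b r @ ?loop (b + Li) r)
      (Li + Lc + Ls + 3) (wi + wc + ws + 1) (\<lambda>x. (s ^^ K x) (init x)) ?q"
    unfolding computes_def
  proof (intro conjI allI impI pq)
    show "psize ((s ^^ K x) (init x)) \<le> ?q (psize x)" for x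
      using sz[of "K x" x] by simp
    fix P xs b r R m and x :: 'a
    assume H: "occurs_at P b (gi b r @ ?loop (b + Li) r)"
      "3 \<le> r" "r + (wi + wc + ws + 1) < R" "regs_ok R m" "rep m R (m 1) (m r) x"
    let ?b = "b + Li"
    from H(1) have at0: "occurs_at P b (gi b r)" and at: "occurs_at P ?b (?c1 r)" "occurs_at P (?b + 1) (gc (?b + 1) (r + 1))"
      "occurs_at P (?b + Lc + 1) (?c2 ?b r)"
      "occurs_at P (?b + Lc + 2) (gs (?b + Lc + 2) r)" "occurs_at P (?b + Lc + Ls + 2) (?c3 ?b)"
      unfolding occurs_at_append by (auto simp: computesD(2)[OF i] computesD(2)[OF c] computesD(2)[OF s] ac_simps eval_nat_numeral)
    have R3: "3 \<le> R" using H by auto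
    let ?y = "\<lambda>j. (s ^^ j) (init x)"
    let ?Tx = "?T (psize x)"
    \<comment> \<open>Induction on the number \<open>d\<close> of remaining rounds.
      \<open>?T\<close> bounds one round: test, body and three instructions for copying and
      jumping.\<close>
    have loop: "\<exists>m'. reach P xs ((d + 1) * ?Tx) (?b, m1) (?b + Lc + Ls + 3, m') \<and> keeps r R m m' \<and>
        rep m' R (m' 1) (m' r) (?y (K x))"
      if "d \<le> K x" "keeps r R m m1" "rep m1 R (m1 1) (m1 r) (?y (K x - d))" for d m1
      using that
    proof (induction d arbitrary: m1)
      case (0 m1)
      have ok1: "regs_ok R m1" using keeps_ok[OF 0(2)] H by auto
      then have z: "m1 0 = 0" by (auto simp: regs_ok_def)
      let ?m2 = "m1(r + 1 := m1 r)"
      have s1: "reach P xs 1 (?b, m1) (?b + 1, ?m2)" by (rule reach_step[OF at(1)]) (simp add: z)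
      have k2: "keeps (r + 1) R m1 ?m2" using H by (intro keeps_copy) auto
      have x2: "rep ?m2 R (?m2 1) (?m2 (r + 1)) (?y (K x))" using rep_keeps[OF 0(3) k2 R3] by simp
      have "\<exists>m3. reach P xs (qc (psize (?y (K x)))) (?b + 1, ?m2) (?b + 1 + Lc, m3) \<and> keeps (r + 1) R ?m2 m3 \<and>
          rep m3 R (m3 1) (m3 (r + 1)) (c (?y (K x)))"
        by (rule computesD(4)[OF c at(2) _ _ _ x2]) (use H keeps_ok[OF k2 _ ok1] in auto)
      then obtain m3 where m3: "reach P xs (qc (psize (?y (K x)))) (?b + 1, ?m2) (?b + 1 + Lc, m3)"
        "keeps (r + 1) R ?m2 m3" "rep m3 R (m3 1) (m3 (r + 1)) (c (?y (K x)))" by blast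
      have z3: "m3 (r + 1) = 0" using m3(3) stop[of x] by (simp add: rep_bool_def)
      have s4: "reach P xs 1 (?b + 1 + Lc, m3) (?b + Lc + Ls + 3, m3)"
        by (rule reach_step) (use at(3) z3 in \<open>auto simp: ac_simps\<close>)
      have k13: "keeps (r + 1) R m1 m3" by (rule keeps_trans[OF k2 m3(2)]) simp
      have k: "keeps r R m m3" by (rule keeps_trans[OF 0(2) k13]) simp
      have "rep m3 R (m3 1) (m3 r) (?y (K x))" using rep_keeps[OF 0(3) k13 R3] keeps_reg[OF k13, of r] H by auto
      moreover have "reach P xs ((0 + 1) * ?Tx) (?b, m1) (?b + Lc + Ls + 3, m3)"
        by (rule reach_trans[OF reach_trans[OF s1 m3(1) le_refl] s4])
          (use polyb_mono[OF computesD(1)[OF c] sz[of "K x" x]] in auto)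
      ultimately show ?case using k by blast
    next
      case (Suc d m1)
      let ?j = "K x - Suc d"
      have j: "?j < K x" "Suc ?j = K x - d" using Suc.prems(1) by auto
      have ok1: "regs_ok R m1" using keeps_ok[OF Suc.prems(2)] H by auto
      then have z: "m1 0 = 0" by (auto simp: regs_ok_def)
      let ?m2 = "m1(r + 1 := m1 r)"
      have s1: "reach P xs 1 (?b, m1) (?b + 1, ?m2)" by (rule reach_step[OF at(1)]) (simp add: z)
      have k2: "keeps (r + 1) R m1 ?m2" using H by (intro keeps_copy) auto
      have x2: "rep ?m2 R (?m2 1) (?m2 (r + 1)) (?y ?j)" using rep_keeps[OF Suc.prems(3) k2 R3] by simp
      have "\<exists>m3. reach P xs (qc (psize (?y ?j))) (?b + 1, ?m2) (?b + 1 + Lc, m3) \<and> keeps (r + 1) R ?m2 m3 \<and>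
          rep m3 R (m3 1) (m3 (r + 1)) (c (?y ?j))"
        by (rule computesD(4)[OF c at(2) _ _ _ x2]) (use H keeps_ok[OF k2 _ ok1] in auto)
      then obtain m3 where m3: "reach P xs (qc (psize (?y ?j))) (?b + 1, ?m2) (?b + 1 + Lc, m3)"
        "keeps (r + 1) R ?m2 m3" "rep m3 R (m3 1) (m3 (r + 1)) (c (?y ?j))" by blast
      have z3: "m3 (r + 1) \<noteq> 0" using m3(3) cont[OF j(1)] by (simp add: rep_bool_def)
      have s4: "reach P xs 1 (?b + 1 + Lc, m3) (?b + Lc + 2, m3)"
        by (rule reach_step) (use at(3) z3 in \<open>auto simp: ac_simps\<close>)
      have k13: "keeps (r + 1) R m1 m3" by (rule keeps_trans[OF k2 m3(2)]) simp
      have k: "keeps r R m m3" by (rule keeps_trans[OF Suc.prems(2) k13]) simp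
      have x3: "rep m3 R (m3 1) (m3 r) (?y ?j)" using rep_keeps[OF Suc.prems(3) k13 R3] keeps_reg[OF k13, of r] H by auto
      have "\<exists>m4. reach P xs (qss (psize (?y ?j))) (?b + Lc + 2, m3) (?b + Lc + 2 + Ls, m4) \<and> keeps r R m3 m4 \<and>
          rep m4 R (m4 1) (m4 r) (s (?y ?j))"
        by (rule computesD(4)[OF s at(4) _ _ _ x3]) (use H keeps_ok[OF k] in auto)
      then obtain m4 where m4: "reach P xs (qss (psize (?y ?j))) (?b + Lc + 2, m3) (?b + Lc + 2 + Ls, m4)"
        "keeps r R m3 m4" "rep m4 R (m4 1) (m4 r) (s (?y ?j))" by blast
      have k4: "keeps r R m m4" by (rule keeps_trans[OF k m4(2)]) simp
      have z4: "m4 0 = 0" using keeps_ok[OF k4] H by (auto simp: regs_ok_def)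
      have s5: "reach P xs 1 (?b + Lc + 2 + Ls, m4) (?b, m4)"
        by (rule reach_step) (use at(5) z4 in \<open>auto simp: ac_simps\<close>)
      have x4: "rep m4 R (m4 1) (m4 r) (?y (K x - d))" using m4(3) unfolding j(2)[symmetric] by simp
      obtain m' where m': "reach P xs ((d + 1) * ?Tx) (?b, m4) (?b + Lc + Ls + 3, m')" "keeps r R m m'"
        "rep m' R (m' 1) (m' r) (?y (K x))"
        using Suc.IH[OF _ k4 x4] Suc.prems(1) by auto
      note r1 = reach_trans[OF s1 m3(1) le_refl]
      note r2 = reach_trans[OF r1 s4 le_refl]
      note r3 = reach_trans[OF r2 m4(1) le_refl]
      have b1: "qc (psize (?y ?j)) \<le> qc (qs (psize x))" "qss (psize (?y ?j)) \<le> qss (qs (psize x))"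
        using polyb_mono[OF computesD(1)[OF c] sz[of ?j x]] polyb_mono[OF computesD(1)[OF s] sz[of ?j x]] by auto
      have r4: "reach P xs ?Tx (?b, m1) (?b, m4)"
        by (rule reach_trans[OF r3 s5]) (use b1 in auto)
      have "reach P xs ((Suc d + 1) * ?Tx) (?b, m1) (?b + Lc + Ls + 3, m')"
        by (rule reach_trans[OF r4 m'(1)]) simp
      then show ?case using m'(2,3) by blast
    qed
    obtain m1 where m1: "reach P xs (qi (psize x)) (b, m) (b + Li, m1)" "keeps r R m m1" "rep m1 R (m1 1) (m1 r) (init x)"
      using computesD(4)[OF i at0 H(2) _ H(4,5)] H(3) by fastforce
    obtain m' where m': "reach P xs ((K x + 1) * ?Tx) (?b, m1) (?b + Lc + Ls + 3, m')" "keeps r R m m'"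
        "rep m' R (m' 1) (m' r) (?y (K x))"
      using loop[OF le_refl m1(2)] m1(3) by auto
    have "(K x + 1) * ?Tx \<le> (qk (psize x) + 1) * ?Tx" using K[of x] by (intro mult_right_mono) auto
    then have "reach P xs (?q (psize x)) (b, m) (?b + Lc + Ls + 3, m')"
      by (intro reach_trans[OF m1(1) m'(1)]) linarith
    then show "\<exists>m'. reach P xs (?q (psize x)) (b, m) (b + (Li + Lc + Ls + 3), m') \<and> keeps r R m m' \<and> rep m' R (m' 1) (m' r) (?y (K x))"
      using m'(2,3) by (intro exI[of _ m']) (simp add: ac_simps)
  qed (use computesD(2)[OF i] computesD(2)[OF c] computesD(2)[OF s] in auto)
  then show ?thesis unfolding PT_def by blast
qed

section \<open>Primitive operations on pairs, lists, numbers and truth values\<close>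

lemma PT_fst0: "PT (fst :: 'a::pdata \<times> 'b::pdata \<Rightarrow> 'a)"
proof (rule PT_straight[where c = "\<lambda>r. [Load r r]" and w = 0 and q = "\<lambda>x. x"])
  fix xs r R m and x :: "'a \<times> 'b"
  assume H: "3 \<le> r" "r + 0 < R" "regs_ok R m" "rep m R (m 1) (m r) x"
  have k: "keeps r R m (m(r := m (m r)))" using H by (intro keeps_copy) auto
  have "rep m R (m 1) (m (m r)) (fst x)" using H(4) by (simp add: rep_prod_def)
  from rep_keeps[OF this k] show "keeps r R m (fold (effect xs) [Load r r] m) \<and>
       rep (fold (effect xs) [Load r r] m) R (fold (effect xs) [Load r r] m 1) (fold (effect xs) [Load r r] m r) (fst x)"
    using k H by simp
qed (auto intro: polyb_intros simp: psize_prod_def)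

lemma PT_snd0: "PT (snd :: 'a::pdata \<times> 'b::pdata \<Rightarrow> 'b)"
proof (rule PT_straight[where c = "\<lambda>r. [Add r r 2, Load r r]" and w = 0 and q = "\<lambda>x. x"])
  fix xs r R m and x :: "'a \<times> 'b"
  assume H: "3 \<le> r" "r + 0 < R" "regs_ok R m" "rep m R (m 1) (m r) x"
  have k: "keeps r R m (m(r := m (Suc (m r))))" using H by (intro keeps_copy) auto
  have "rep m R (m 1) (m (Suc (m r))) (snd x)" using H(4) by (simp add: rep_prod_def)
  from rep_keeps[OF this k] show "keeps r R m (fold (effect xs) [Add r r 2, Load r r] m) \<and>
       rep (fold (effect xs) [Add r r 2, Load r r] m) R (fold (effect xs) [Add r r 2, Load r r] m 1) (fold (effect xs) [Add r r 2, Load r r] m r) (snd x)"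
    using k H by (auto simp: regs_ok_def rep_prod_def)
qed (auto intro: polyb_intros simp: psize_prod_def)

lemmas PT_fst = PT_comp[OF PT_fst0] and PT_snd = PT_comp[OF PT_snd0]

lemma PT_imm:
  assumes "\<And>m R e. rep m R e v c"
  shows "PT (\<lambda>x :: 'a::pdata. c :: 'b::pdata)"
  by (rule PT_straight[where c = "\<lambda>r. [Const r v]" and w = 0 and q = "\<lambda>x. psize c"])
    (auto intro: polyb_intros keeps_copy simp: assms)

lemma PT_nat: "PT (\<lambda>x. n :: nat)" and PT_Big: "PT (\<lambda>x. Big n)"
  by (rule PT_imm[where v = n], simp add: rep_nat_def rep_big_def)+

lemma PT_Nil: "PT (\<lambda>x. [])"
  by (rule PT_imm[where v = 0]) simp

lemma PT_bool: "PT (\<lambda>x. b :: bool)"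
  by (rule PT_imm[where v = "of_bool b"]) (simp add: rep_bool_def)

text \<open>For functions whose value is represented by the very word that represents the argument:
  the empty code computes them.\<close>

lemma PT_retype:
  fixes f :: "'a::pdata \<Rightarrow> 'b::pdata"
  assumes "polyb q" "\<And>x. psize (f x) \<le> q (psize x)" "\<And>m R e v x. 3 \<le> R \<Longrightarrow> rep m R e v x \<Longrightarrow> rep m R e v (f x)"
  shows "PT f"
  by (rule PT_straight[where c = "\<lambda>_. []" and w = 0 and q = q]) (use assms in \<open>auto simp: keeps_def\<close>)

lemma PT_Cons0: "PT (\<lambda>p. fst p # snd p)"
  by (rule PT_retype[where q = "\<lambda>x. x"]) (auto intro: polyb_intros simp: psize_prod_def rep_prod_def)

lemma PT_not_Nil0: "PT (\<lambda>xs. xs \<noteq> [])"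
proof (rule PT_retype[where q = "\<lambda>x. x"])
  show "rep m R e v (xs \<noteq> [])" if "rep m R e v xs" for m R e v and xs :: "'a list"
    using that by (cases xs) (auto simp: rep_bool_def)
qed (auto intro: polyb_intros simp: psize_bool_def)

lemma PT_not_zero0: "PT (\<lambda>n :: nat. n \<noteq> 0)"
  by (rule PT_retype[where q = "\<lambda>x. x"]) (auto intro: polyb_intros simp: psize_bool_def rep_bool_def rep_nat_def)

lemma PT_big_not_zero0: "PT (\<lambda>n. unbig n \<noteq> 0)"
  by (rule PT_retype[where q = "\<lambda>x. x"]) (auto intro: polyb_intros simp: psize_bool_def rep_bool_def rep_big_def)

text \<open>There is no converse: a \<open>big\<close> has size 0, so no polynomial bounds the size
  of its \<open>unbig\<close>. Numbers that grew by repeated doubling can therefore never become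
  loop bounds.\<close>

lemma PT_to_big0: "PT Big"
  by (rule PT_retype[where q = "\<lambda>x. x"]) (auto intro: polyb_intros simp: psize_big_def rep_nat_def rep_big_def)

definition big_op :: "(nat \<Rightarrow> nat \<Rightarrow> nat) \<Rightarrow> big \<Rightarrow> big \<Rightarrow> big" where
  "big_op h a b = Big (h (unbig a) (unbig b))"

lemma PT_arith0:
  fixes f :: "'a::pdata \<times> 'a \<Rightarrow> 'a"
  assumes I: "\<And>i j l xs m. effect xs (I i j l) m = m(i := h (m j) (m l))" "\<And>i j l. straight (I i j l)"
    and "polyb q" "\<And>p. psize (f p) \<le> q (psize p)"
    and f: "\<And>m R e m' R' e' v w p. rep m R e v (fst p) \<Longrightarrow> rep m R e w (snd p) \<Longrightarrow> rep m' R' e' (h v w) (f p)"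
  shows "PT f"
proof (rule PT_straight[where c = "\<lambda>r. [Load (r + 1) r, Add r r 2, Load r r, I r (r + 1) r]" and w = 1 and q = q])
  fix xs r R m and p :: "'a \<times> 'a"
  assume H: "3 \<le> r" "r + 1 < R" "regs_ok R m" "rep m R (m 1) (m r) p"
  let ?c = "[Load (r + 1) r, Add r r 2, Load r r, I r (r + 1) r]"
  have v: "R \<le> m r" "rep m R (m 1) (m (m r)) (fst p)" "rep m R (m 1) (m (Suc (m r))) (snd p)" "m 2 = 1"
    using H by (auto simp: rep_prod_def regs_ok_def)
  have ne: "Suc (m r) \<noteq> r" "Suc (m r) \<noteq> Suc r" "r \<noteq> 2" "Suc r \<noteq> 2" "r \<noteq> Suc 0" "m r \<noteq> r" "m r \<noteq> Suc r" using H v by auto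
  have e: "fold (effect xs) ?c m = m(Suc r := m (m r), r := h (m (m r)) (m (Suc (m r))))"
    by (rule ext) (simp add: I ne ne[symmetric] v)
  have "keeps r R m (fold (effect xs) ?c m)" unfolding e using H by (auto simp: keeps_def)
  then show "keeps r R m (fold (effect xs) ?c m) \<and>
       rep (fold (effect xs) ?c m) R (fold (effect xs) ?c m 1) (fold (effect xs) ?c m r) (f p)"
    using f[OF v(2,3)] unfolding e by auto
qed (use assms in auto)

lemma PT_add0: "PT (\<lambda>p. fst p + snd p :: nat)"
  by (rule PT_arith0[where I = Add and h = "(+)" and q = "\<lambda>x. x"]) (auto intro: polyb_intros simp: psize_prod_def psize_nat_def rep_nat_def)
lemma PT_sub0: "PT (\<lambda>p. fst p - snd p :: nat)"
  by (rule PT_arith0[where I = Sub and h = "(-)" and q = "\<lambda>x. x"]) (auto intro: polyb_intros simp: psize_prod_def psize_nat_def rep_nat_def)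
lemma PT_big_add0: "PT (\<lambda>p. big_op (+) (fst p) (snd p))"
  by (rule PT_arith0[where I = Add and h = "(+)" and q = "\<lambda>x. x"]) (auto intro: polyb_intros simp: psize_prod_def psize_big_def rep_big_def big_op_def)
lemma PT_big_sub0: "PT (\<lambda>p. big_op (-) (fst p) (snd p))"
  by (rule PT_arith0[where I = Sub and h = "(-)" and q = "\<lambda>x. x"]) (auto intro: polyb_intros simp: psize_prod_def psize_big_def rep_big_def big_op_def)

lemma PT_comp2:
  assumes "PT (\<lambda>p. h (fst p) (snd p))" "PT f" "PT g" shows "PT (\<lambda>x. h (f x) (g x))"
  using PT_comp[OF assms(1) PT_pair[OF assms(2,3)]] by simp

lemmas PT_add = PT_comp2[OF PT_add0] and PT_sub = PT_comp2[OF PT_sub0]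
  and PT_big_add = PT_comp2[OF PT_big_add0] and PT_big_sub = PT_comp2[OF PT_big_sub0]
  and PT_Cons = PT_comp2[OF PT_Cons0] and PT_not_Nil = PT_comp[OF PT_not_Nil0]
  and PT_not_zero = PT_comp[OF PT_not_zero0] and PT_big_not_zero = PT_comp[OF PT_big_not_zero0]
  and PT_to_big = PT_comp[OF PT_to_big0]

lemma PT_if:
  assumes "PT b" "PT f" "PT g" shows "PT (\<lambda>x. if b x then f x else g x)"
proof -
  have "PT (\<lambda>p. if snd p then f (fst p) else g (fst p))"
    by (rule PT_branch[where f = g and g = "\<lambda>p. f (fst p)" and U = "\<lambda>p. p"])
      (use assms in \<open>auto intro: PT_fst PT_comp[OF _ PT_fst0] simp: rep_prod_def rep_bool_def\<close>)
  from PT_comp[OF this PT_pair[OF PT_id assms(1)]] show ?thesis unfolding fst_conv snd_conv .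
qed

lemma PT_case_list:
  assumes "PT l" "PT f" "PT (\<lambda>p. g (fst p) (fst (snd p)) (snd (snd p)))"
  shows "PT (\<lambda>x. case l x of [] \<Rightarrow> f x | y # ys \<Rightarrow> g x y ys)"
proof -
  have "PT (\<lambda>p. case snd p of [] \<Rightarrow> f (fst p) | y # ys \<Rightarrow> g (fst p) y ys)"
    apply (rule PT_branch[where f = f and g = "\<lambda>p. g (fst p) (fst (snd p)) (snd (snd p))"
       and U = "\<lambda>p. (fst p, (hd (snd p), tl (snd p)))"])
        apply (use assms in simp)
       apply (use assms in simp)
      apply (auto simp: rep_prod_def psize_prod_def split: list.splits)
    done
  from PT_comp[OF this PT_pair[OF PT_id assms(1)]] show ?thesis unfolding fst_conv snd_conv .
qed

lemma PT_cong: "PT f \<Longrightarrow> (\<And>x. f x = g x) \<Longrightarrow> PT g"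
  by (metis ext)

lemma PT_not: "PT b \<Longrightarrow> PT (\<lambda>x. \<not> b x)"
  by (rule PT_cong[OF PT_if[OF _ PT_bool[of False] PT_bool[of True]]]) auto

lemma PT_conj: "PT a \<Longrightarrow> PT b \<Longrightarrow> PT (\<lambda>x. a x \<and> b x)"
  by (rule PT_cong[OF PT_if[OF _ _ PT_bool[of False], of a b]]) auto

lemma PT_disj: "PT a \<Longrightarrow> PT b \<Longrightarrow> PT (\<lambda>x. a x \<or> b x)"
  using PT_not[OF PT_conj[OF PT_not PT_not], of a b] by simp

lemma PT_le: "PT a \<Longrightarrow> PT b \<Longrightarrow> PT (\<lambda>x. a x \<le> (b x :: nat))"
  using PT_not[OF PT_not_zero[OF PT_sub, of a b]] by simp

lemma PT_less: "PT a \<Longrightarrow> PT b \<Longrightarrow> PT (\<lambda>x. a x < (b x :: nat))"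
  by (rule PT_cong[OF PT_not_zero[OF PT_sub, of b a]]) auto

lemma PT_eq: "PT a \<Longrightarrow> PT b \<Longrightarrow> PT (\<lambda>x. a x = (b x :: nat))"
  using PT_conj[OF PT_le[of a b] PT_le[of b a]] by (simp add: eq_iff)

lemma PT_big_eq: assumes "PT a" "PT b" shows "PT (\<lambda>x. a x = (b x :: big))"
proof -
  have "PT (\<lambda>x. \<not> unbig (big_op (-) (a x) (b x)) \<noteq> 0 \<and> \<not> unbig (big_op (-) (b x) (a x)) \<noteq> 0)"
    by (intro PT_conj PT_not PT_big_not_zero PT_big_sub assms)
  moreover have "(\<not> unbig (big_op (-) a b) \<noteq> 0 \<and> \<not> unbig (big_op (-) b a) \<noteq> 0) = (a = b)" for a b
    by (cases a; cases b) (auto simp: big_op_def)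
  ultimately show ?thesis by simp
qed

lemma PT_Suc: "PT f \<Longrightarrow> PT (\<lambda>x. Suc (f x))"
  using PT_add[OF _ PT_nat[of 1], of f] by simp

section \<open>Searching programs\<close>

text \<open>Lists grow at the front, so the input is copied from its last entry to its first, with
  register 4 counting down. The jump targets are absolute; a prologue of four instructions precedes
  the loop.\<close>

definition read_loop :: "instr list" where
  "read_loop = [JumpZero 4 13, Sub 4 4 2, Input 5 4, Store 1 5, Add 6 1 2, Store 6 3, Add 3 1 0, Add 1 6 2, JumpZero 0 4]"

lemma cell_effect:
  assumes "m 0 = 0" "m 2 = 1" "6 < m 1" "a \<in> {4, 5}" "d \<in> {3, 5}"
  shows "fold (effect xs) [Store 1 a, Add 6 1 2, Store 6 3, Add d 1 0, Add 1 6 2] m =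
    m(m 1 := m a, Suc (m 1) := m 3, 6 := Suc (m 1), d := m 1, 1 := Suc (Suc (m 1)))"
  using assms by (intro ext) auto

lemma prologue_effect:
  "fold (effect xs) [Const 1 R, Const 2 1, Sub 4 0 5, Const 0 0] ((\<lambda>_. 0)(0 := length xs)) =
    (\<lambda>_. 0)(1 := R, 2 := 1, 4 := length xs)"
  by (rule ext, simp only: fold_simps effect_simps fun_upd_apply, simp)

lemma read_loop_reach:
  assumes at: "occurs_at P 4 read_loop" and "6 < R" "j \<le> length xs"
    "m 0 = 0" "m 2 = 1" "R \<le> m 1" "m 4 = j" "rep m R (m 1) (m 3) (drop j xs)"
  shows "\<exists>m'. reach P xs (9 * j + 1) (4, m) (13, m') \<and> m' 0 = 0 \<and> m' 2 = 1 \<and> R \<le> m' 1 \<and> m' 4 = 0 \<and>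
    rep m' R (m' 1) (m' 3) xs"
  using assms(3-)
proof (induction j arbitrary: m)
  case 0
  have "occurs_at P 4 [JumpZero 4 13]"
    using at unfolding read_loop_def by (subst (asm) occurs_at_Cons) simp
  then have "reach P xs 1 (4, m) (13, m)" by (rule reach_step) (use 0 in simp)
  then show ?case using 0 by auto
next
  case (Suc j)
  let ?cell = "[Store 1 5, Add 6 1 2, Store 6 3, Add 3 1 0, Add 1 6 2]"
  have eq: "read_loop = [JumpZero 4 13] @ ([Sub 4 4 2, Input 5 4] @ ?cell) @ [JumpZero 0 4]" by (simp add: read_loop_def)
  have at': "occurs_at P 4 [JumpZero 4 13]" "occurs_at P 5 ([Sub 4 4 2, Input 5 4] @ ?cell)" "occurs_at P 12 [JumpZero 0 4]"
    using at unfolding eq occurs_at_append by (auto simp: eval_nat_numeral)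
  have s1: "reach P xs 1 (4, m) (5, m)" by (rule reach_step[OF at'(1)]) (use Suc.prems in simp)
  let ?m1 = "m(4 := j, 5 := xs ! j)"
  have m1: "fold (effect xs) [Sub 4 4 2, Input 5 4] m = ?m1" using Suc.prems by (auto simp: fun_eq_iff)
  let ?h = "m 1"
  define m2 where "m2 = ?m1(?m1 1 := ?m1 5, Suc (?m1 1) := ?m1 3, 6 := Suc (?m1 1), 3 := ?m1 1, 1 := Suc (Suc (?m1 1)))"
  have F: "fold (effect xs) ([Sub 4 4 2, Input 5 4] @ ?cell) m = m2"
    unfolding fold_append o_apply m1 m2_def by (rule cell_effect) (use Suc.prems assms(2) in auto)
  have s2: "reach P xs 7 (5, m) (12, m2)"
    using reach_straight[OF at'(2), of xs m] unfolding F by (simp add: eval_nat_numeral)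
  have v: "m2 0 = 0" "m2 2 = 1" "m2 1 = Suc (Suc ?h)" "m2 4 = j" "m2 3 = ?h" "m2 ?h = xs ! j" "m2 (Suc ?h) = m 3"
    unfolding m2_def using Suc.prems assms(2) by auto
  have old: "m2 a = m a" if "R \<le> a" "a < m 1" for a unfolding m2_def using that assms(2) by auto
  have s3: "reach P xs 1 (12, m2) (4, m2)" by (rule reach_step[OF at'(3)]) (use v in simp)
  have "rep m2 R (m2 1) (m 3) (drop (Suc j) xs)"
    by (rule rep_mono[OF Suc.prems(6)]) (use old v in auto)
  moreover have "drop j xs = xs ! j # drop (Suc j) xs" using Suc.prems(1) by (simp add: Cons_nth_drop_Suc)
  ultimately have r2: "rep m2 R (m2 1) (m2 3) (drop j xs)"
    using v Suc.prems assms(2) by (simp add: rep_nat_def)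
  obtain m' where m': "reach P xs (9 * j + 1) (4, m2) (13, m')" "m' 0 = 0 \<and> m' 2 = 1 \<and> R \<le> m' 1 \<and> m' 4 = 0 \<and> rep m' R (m' 1) (m' 3) xs"
    using Suc.IH[OF _ v(1,2) _ v(4) r2] Suc.prems v by auto
  have "reach P xs (9 * Suc j + 1) (4, m) (13, m')"
    by (rule reach_trans[OF reach_trans[OF reach_trans[OF s1 s2 le_refl] s3 le_refl] m'(1)]) simp
  then show ?case using m' by blast
qed

text \<open>Turns a test with a fuel parameter into a program that runs it with fuel 0, 1, 2, ...
  until the value is nonzero. The time depends on the first successful fuel only, which need not be
  known in advance. The values 1 and 2 will stand for no and yes.\<close>

theorem PT_search:
  fixes body :: "nat \<times> nat list \<Rightarrow> nat"
  assumes "PT body"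
  shows "\<exists>p q. polyb q \<and> (\<forall>xs i. body (i, xs) \<noteq> 0 \<longrightarrow> (\<forall>j<i. body (j, xs) = 0) \<longrightarrow>
    answers_within p xs (real (q (i + psize xs))) (body (i, xs) > 1))"
proof -
  from assms obtain gen L w q where c: "computes gen L w body q" unfolding PT_def by blast
  \<comment> \<open>Registers 3 and 4 carry the input list and the fuel from round to round, 5 is
    argument and result of the body, and 6 helps to build cells. The scratch space from 5 to
    \<open>5 + w\<close> ends below \<open>?R\<close>.\<close>
  let ?R = "w + 8"
  \<comment> \<open>\<open>Sub 4 0 5\<close> saves the input length from register 0 before that
    register is cleared; register 5 still holds 0 at this point.\<close>
  let ?pro = "[Const 1 ?R, Const 2 1, Sub 4 0 5, Const 0 0]"
  let ?cell = "[Store 1 4, Add 6 1 2, Store 6 3, Add 5 1 0, Add 1 6 2]"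
  \<comment> \<open>Value 0 leads to the increment of the fuel and back to address 13. Any other
    value, diminished by 1, becomes the answer in register 0, so 1 rejects and 2 accepts.\<close>
  let ?end = "[JumpZero 5 (20 + L), JumpZero 0 (22 + L), Add 4 4 2, JumpZero 0 13, Sub 0 5 2]"
  define P where "P = ?pro @ read_loop @ ?cell @ gen 18 5 @ ?end"
  have lenP: "length P = 23 + L" by (simp add: P_def read_loop_def computesD(2)[OF c])
  have "occurs_at P 0 (?pro @ read_loop @ ?cell @ gen 18 5 @ ?end)" by (simp add: P_def occurs_at_def)
  then have at: "occurs_at P 0 ?pro" "occurs_at P 4 read_loop" "occurs_at P 13 ?cell" "occurs_at P 18 (gen 18 5)" "occurs_at P (18 + L) ?end"
    unfolding occurs_at_append by (auto simp: read_loop_def computesD(2)[OF c] eval_nat_numeral)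
  have "?end = [JumpZero 5 (20 + L)] @ [JumpZero 0 (22 + L)] @ [Add 4 4 2] @ [JumpZero 0 13] @ [Sub 0 5 2]" by simp
  from at(5)[unfolded this occurs_at_append]
  have ate: "occurs_at P (18 + L) [JumpZero 5 (20 + L)]" "occurs_at P (19 + L) [JumpZero 0 (22 + L)]" "occurs_at P (20 + L) [Add 4 4 2]"
    "occurs_at P (21 + L) [JumpZero 0 13]" "occurs_at P (22 + L) [Sub 0 5 2]"
    by (auto simp: eval_nat_numeral)
  let ?ok = "\<lambda>xs i m. m 0 = 0 \<and> m 2 = 1 \<and> ?R \<le> m 1 \<and> m 4 = i \<and> rep m ?R (m 1) (m 3) xs"
  have start: "\<exists>m. reach P xs (9 * length xs + 5) (initial_config xs) (13, m) \<and> ?ok xs 0 m" for xs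
  proof -
    let ?mi = "(\<lambda>_. 0)(0 := length xs)"
    let ?m = "(\<lambda>_. 0)(1 := ?R, 2 := 1, 4 := length xs)"
    have F: "fold (effect xs) ?pro ?mi = ?m" by (rule prologue_effect)
    have s0: "reach P xs 4 (0, ?mi) (4, ?m)" using reach_straight[OF at(1), of xs ?mi] unfolding F by (simp add: eval_nat_numeral)
    have "\<exists>m'. reach P xs (9 * length xs + 1) (4, ?m) (13, m') \<and> m' 0 = 0 \<and> m' 2 = 1 \<and> ?R \<le> m' 1 \<and> m' 4 = 0 \<and> rep m' ?R (m' 1) (m' 3) xs"
      by (rule read_loop_reach[OF at(2), where j = "length xs"]) auto
    then obtain m' where m': "reach P xs (9 * length xs + 1) (4, ?m) (13, m')" "?ok xs 0 m'" by blast
    have "reach P xs (9 * length xs + 5) (initial_config xs) (13, m')"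
      unfolding initial_config_def by (rule reach_trans[OF s0 m'(1)]) simp
    then show ?thesis using m'(2) by blast
  qed
  have round: "\<exists>m'. reach P xs (q (psize (i, xs)) + 5) (13, m) (18 + L, m') \<and> ?ok xs i m' \<and> m' 5 = body (i, xs)"
    if ok: "?ok xs i m" for xs i m
  proof -
    let ?h = "m 1"
    define m1 where "m1 = m(m 1 := m 4, Suc (m 1) := m 3, 6 := Suc (m 1), 5 := m 1, 1 := Suc (Suc (m 1)))"
    have F: "fold (effect xs) ?cell m = m1" unfolding m1_def by (rule cell_effect) (use ok in auto)
    have s1: "reach P xs 5 (13, m) (18, m1)" using reach_straight[OF at(3), of xs m] unfolding F by (simp add: eval_nat_numeral)
    have v: "m1 0 = 0" "m1 2 = 1" "m1 1 = Suc (Suc ?h)" "m1 4 = i" "m1 5 = ?h" "m1 3 = m 3" "m1 ?h = i" "m1 (Suc ?h) = m 3"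
      unfolding m1_def using ok by auto
    have r1: "rep m1 ?R (m1 1) (m 3) xs"
      by (rule rep_mono[of m ?R "m 1"]) (use ok v in \<open>auto simp: m1_def\<close>)
    have r2: "rep m1 ?R (m1 1) (m1 5) (i, xs)" using r1 v ok by (simp add: rep_prod_def rep_nat_def)
    have "\<exists>m'. reach P xs (q (psize (i, xs))) (18, m1) (18 + L, m') \<and> keeps 5 ?R m1 m' \<and> rep m' ?R (m' 1) (m' 5) (body (i, xs))"
      by (rule computesD(4)[OF c at(4) _ _ _ r2]) (use v ok in \<open>auto simp: regs_ok_def\<close>)
    then obtain m' where m': "reach P xs (q (psize (i, xs))) (18, m1) (18 + L, m')" "keeps 5 ?R m1 m'"
      "rep m' ?R (m' 1) (m' 5) (body (i, xs))" by blast
    have "rep m' ?R (m' 1) (m 3) xs" by (rule rep_keeps[OF r1 m'(2)]) simp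
    then have "?ok xs i m'" using v ok keeps_reg[OF m'(2)] m'(2) by (auto simp: keeps_def)
    moreover have "reach P xs (q (psize (i, xs)) + 5) (13, m) (18 + L, m')" by (rule reach_trans[OF s1 m'(1)]) simp
    ultimately show ?thesis using m'(3) by (auto simp: rep_nat_def)
  qed
  have main: "\<exists>m'. reach P xs (d * (q (psize (i, xs)) + 8) + q (psize (i, xs)) + 8) (13, m) (23 + L, m') \<and> m' 0 = body (i, xs) - 1"
    if "d \<le> i" "?ok xs (i - d) m" "body (i, xs) \<noteq> 0" "\<forall>j<i. body (j, xs) = 0" for xs i d m
    using that(1,2)
  proof (induction d arbitrary: m)
    case 0
    then have "?ok xs i m" by simp
    from round[OF this] obtain m' where m': "reach P xs (q (psize (i, xs)) + 5) (13, m) (18 + L, m')" "?ok xs i m'" "m' 5 = body (i, xs)"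
      by blast
    have s1: "reach P xs 1 (18 + L, m') (19 + L, m')" by (rule reach_step[OF ate(1)]) (use m' that in simp)
    have s2: "reach P xs 1 (19 + L, m') (22 + L, m')" by (rule reach_step[OF ate(2)]) (use m' in simp)
    let ?m = "m'(0 := body (i, xs) - 1)"
    have s3: "reach P xs 1 (22 + L, m') (23 + L, ?m)" by (rule reach_step[OF ate(5)]) (use m' in simp)
    have "reach P xs (q (psize (i, xs)) + 8) (13, m) (23 + L, ?m)"
      by (rule reach_trans[OF reach_trans[OF reach_trans[OF m'(1) s1 le_refl] s2 le_refl] s3]) simp
    then have "reach P xs (0 * (q (psize (i, xs)) + 8) + q (psize (i, xs)) + 8) (13, m) (23 + L, ?m) \<and> ?m 0 = body (i, xs) - 1"
      by simp
    then show ?case by blast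
  next
    case (Suc d)
    let ?j = "i - Suc d"
    obtain m' where m': "reach P xs (q (psize (?j, xs)) + 5) (13, m) (18 + L, m')" "?ok xs ?j m'" "m' 5 = body (?j, xs)"
      using round[OF Suc.prems(2)] by blast
    have z: "m' 5 = 0" using m' that Suc.prems(1) by simp
    have s1: "reach P xs 1 (18 + L, m') (20 + L, m')" by (rule reach_step[OF ate(1)]) (use z in simp)
    let ?m = "m'(4 := i - d)"
    have s2: "reach P xs 1 (20 + L, m') (21 + L, ?m)" by (rule reach_step[OF ate(3)]) (use m' Suc.prems in \<open>auto simp: Suc_diff_Suc\<close>)
    have s3: "reach P xs 1 (21 + L, ?m) (13, ?m)" by (rule reach_step[OF ate(4)]) (use m' in simp)
    have "rep ?m ?R (?m 1) (m' 3) xs" by (rule rep_mono[of m' ?R "m' 1"]) (use m' in auto)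
    then have ok: "?ok xs (i - d) ?m" using m' by simp
    have "d \<le> i" using Suc.prems(1) by simp
    from Suc.IH[OF this ok] obtain m'' where m'': "reach P xs (d * (q (psize (i, xs)) + 8) + q (psize (i, xs)) + 8) (13, ?m) (23 + L, m'')"
      "m'' 0 = body (i, xs) - 1" by blast
    have "psize (?j, xs) \<le> psize (i, xs)" by (simp add: psize_Pair psize_nat_def)
    then have "q (psize (?j, xs)) \<le> q (psize (i, xs))" by (rule polyb_mono[OF computesD(1)[OF c]])
    then have "reach P xs (Suc d * (q (psize (i, xs)) + 8) + q (psize (i, xs)) + 8) (13, m) (23 + L, m'')"
      by (intro reach_trans[OF reach_trans[OF reach_trans[OF reach_trans[OF m'(1) s1 le_refl] s2 le_refl] s3 le_refl] m''(1)]) simp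
    then show ?case using m'' by blast
  qed
  let ?q = "\<lambda>x. 9 * x + 5 + (x * (q (x + 1) + 8) + q (x + 1) + 8)"
  have "polyb (\<lambda>x. q (x + 1))" by (rule polyb_compose[OF computesD(1)[OF c]]) (intro polyb_intros)
  then have pq: "polyb ?q" by (intro polyb_intros)
  have len: "length xs \<le> psize xs" for xs :: "nat list" by (induction xs) auto
  show ?thesis
  proof (intro exI[of _ P] exI[of _ ?q] conjI pq allI impI)
    fix xs i assume b: "body (i, xs) \<noteq> 0" "\<forall>j<i. body (j, xs) = 0"
    obtain m where m: "reach P xs (9 * length xs + 5) (initial_config xs) (13, m)" "?ok xs (i - i) m" using start by auto
    obtain m' where m': "reach P xs (i * (q (psize (i, xs)) + 8) + q (psize (i, xs)) + 8) (13, m) (23 + L, m')"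
      "m' 0 = body (i, xs) - 1" using main[OF le_refl m(2) b] by blast
    let ?x = "i + psize xs"
    have e: "psize (i, xs) = ?x + 1" by (simp add: psize_Pair psize_nat_def)
    have "i * (q (?x + 1) + 8) \<le> ?x * (q (?x + 1) + 8)" by (intro mult_right_mono) auto
    then have "reach P xs (?q ?x) (initial_config xs) (23 + L, m')"
      by (intro reach_trans[OF m(1) m'(1)]) (use len[of xs] in \<open>simp add: e algebra_simps\<close>)
    then obtain j where "j \<le> ?q ?x" "(ram_step P xs ^^ j) (initial_config xs) = (23 + L, m')" by (auto simp: reach_def)
    then show "answers_within P xs (real (?q ?x)) (body (i, xs) > 1)"
      unfolding answers_within_def using lenP m'(2)
      by (intro exI[of _ j] exI[of _ "23 + L"] exI[of _ m'] conjI) (auto simp del: of_nat_add of_nat_mult)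
  qed
qed

section \<open>Polynomial-time list functions\<close>

lemma psize_mem: "y \<in> set l \<Longrightarrow> psize y \<le> psize l"
  by (induction l) auto

lemma length_le_psize: "length l \<le> psize l"
  by (induction l) auto

lemma psize_append: "psize (xs @ ys) = psize xs + psize ys"
  by (induction xs) auto

lemma psize_rev: "psize (rev xs) = psize xs"
  by (induction xs) (auto simp: psize_append)

lemma psize_take: "psize (take j xs) \<le> psize xs"
  by (metis append_take_drop_id le_add1 psize_append)

lemma psize_drop: "psize (drop j xs) \<le> psize xs"
  by (metis append_take_drop_id le_add2 psize_append)

lemma psize_filter: "psize (filter P xs) \<le> psize xs"
  by (induction xs) auto

lemma psize_list_le: "(\<And>y. y \<in> set l \<Longrightarrow> psize y \<le> B) \<Longrightarrow> psize l \<le> length l * (B + 1)"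
proof (induction l)
  case (Cons a l)
  have "psize a \<le> B" "psize l \<le> length l * (B + 1)" using Cons by auto
  then show ?case by simp
qed simp

text \<open>The bound is demanded for all prefixes, since an accumulator might be large in between
  and small at the end.\<close>

lemma PT_foldl:
  fixes l :: "'a::pdata \<Rightarrow> 'b::pdata list" and a :: "'a \<Rightarrow> 'c::pdata"
  assumes a: "PT a" and l: "PT l" and f: "PT (\<lambda>p. f (fst p) (fst (snd p)) (snd (snd p)))"
    and q: "polyb q" "\<And>x j. j \<le> length (l x) \<Longrightarrow> psize (foldl (f x) (a x) (take j (l x))) \<le> q (psize x)"
  shows "PT (\<lambda>x. foldl (f x) (a x) (l x))"
proof -
  let ?s = "\<lambda>st :: 'a \<times> 'c \<times> 'b list. case snd (snd st) of [] \<Rightarrow> st | y # ys \<Rightarrow> (fst st, f (fst st) (fst (snd st)) y, ys)"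
  let ?init = "\<lambda>x. (x, a x, l x)"
  have it: "(?s ^^ j) (?init x) = (x, foldl (f x) (a x) (take j (l x)), drop j (l x))" if "j \<le> length (l x)" for j x
    using that
  proof (induction j)
    case (Suc j)
    then have d: "drop j (l x) = l x ! j # drop (Suc j) (l x)" by (simp add: Cons_nth_drop_Suc)
    from Suc show ?case by (simp add: d take_Suc_conv_app_nth)
  qed simp
  obtain ql where ql: "polyb ql" "\<And>x. psize (l x) \<le> ql (psize x)" using PT_bound[OF l] by blast
  have "PT (\<lambda>x. (?s ^^ length (l x)) (?init x))"
  proof (rule PT_while[where c = "\<lambda>st. snd (snd st) \<noteq> []" and qk = ql and qs = "\<lambda>x. x + q x + ql x + 2"])
    show "PT ?init" by (intro PT_pair PT_id a l)
    show "PT (\<lambda>st :: 'a \<times> 'c \<times> 'b list. snd (snd st) \<noteq> [])" by (intro PT_not_Nil PT_snd PT_id)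
    have "PT (\<lambda>p :: ('a \<times> 'c \<times> 'b list) \<times> 'b \<times> 'b list. f (fst (fst p)) (fst (snd (fst p))) (fst (snd p)))"
      using PT_comp[OF f, of "\<lambda>p :: ('a \<times> 'c \<times> 'b list) \<times> 'b \<times> 'b list. (fst (fst p), fst (snd (fst p)), fst (snd p))"]
      by (simp add: PT_pair PT_fst PT_snd PT_id)
    then show "PT ?s" by (intro PT_case_list PT_pair PT_snd PT_fst PT_id)
    show "length (l x) \<le> ql (psize x)" for x using length_le_psize[of "l x"] ql(2)[of x] by simp
    show "polyb (\<lambda>x. x + q x + ql x + 2)" using q ql by (intro polyb_intros)
    show "psize ((?s ^^ j) (?init x)) \<le> psize x + q (psize x) + ql (psize x) + 2" if "j \<le> length (l x)" for j x
      unfolding it[OF that] using q(2)[OF that] psize_drop[of j "l x"] ql(2)[of x] by (simp add: psize_Pair)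
    show "snd (snd ((?s ^^ j) (?init x))) \<noteq> []" if "j < length (l x)" for j x
      using it[of j x] that by simp
    show "\<not> snd (snd ((?s ^^ length (l x)) (?init x))) \<noteq> []" for x using it[of "length (l x)" x] by simp
  qed (rule ql)
  then have "PT (\<lambda>x. fst (snd ((?s ^^ length (l x)) (?init x))))" by (intro PT_fst PT_snd)
  then show ?thesis using it by simp
qed

lemma PT_iter:
  fixes a :: "'a::pdata \<Rightarrow> 'c::pdata" and f :: "'a \<Rightarrow> 'c \<Rightarrow> 'c"
  assumes n: "PT n" and a: "PT a" and f: "PT (\<lambda>p. f (fst p) (snd p))"
    and q: "polyb q" "\<And>x j. j \<le> n x \<Longrightarrow> psize ((f x ^^ j) (a x)) \<le> q (psize x)"
  shows "PT (\<lambda>x. (f x ^^ n x) (a x))"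
proof -
  let ?s = "\<lambda>st :: 'a \<times> 'c \<times> nat. (fst st, f (fst st) (fst (snd st)), snd (snd st) - 1)"
  let ?init = "\<lambda>x. (x, a x, n x)"
  have it: "(?s ^^ j) (?init x) = (x, (f x ^^ j) (a x), n x - j)" for j x
    by (induction j) auto
  obtain ql where ql: "polyb ql" "\<And>x. psize (n x) \<le> ql (psize x)" using PT_bound[OF n] by blast
  have "PT (\<lambda>x. (?s ^^ n x) (?init x))"
  proof (rule PT_while[where c = "\<lambda>st. snd (snd st) \<noteq> 0" and qk = ql and qs = "\<lambda>x. x + q x + ql x + 2"])
    show "PT ?init" by (intro PT_pair PT_id a n)
    show "PT (\<lambda>st :: 'a \<times> 'c \<times> nat. snd (snd st) \<noteq> 0)" by (intro PT_not_zero PT_snd PT_id)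
    have "PT (\<lambda>p :: 'a \<times> 'c \<times> nat. f (fst p) (fst (snd p)))"
      using PT_comp[OF f, of "\<lambda>p :: 'a \<times> 'c \<times> nat. (fst p, fst (snd p))"]
      by (simp add: PT_pair PT_fst PT_snd PT_id)
    then show "PT ?s" by (intro PT_pair PT_sub PT_snd PT_fst PT_id PT_nat)
    show "n x \<le> ql (psize x)" for x using ql(2)[of x] by (simp add: psize_nat_def)
    show "polyb (\<lambda>x. x + q x + ql x + 2)" using q ql by (intro polyb_intros)
    show "psize ((?s ^^ j) (?init x)) \<le> psize x + q (psize x) + ql (psize x) + 2" if "j \<le> n x" for j x
      unfolding it using q(2)[OF that] ql(2)[of x] by (simp add: psize_Pair psize_nat_def)
  qed (use ql it in auto)
  then have "PT (\<lambda>x. fst (snd ((?s ^^ n x) (?init x))))" by (intro PT_fst PT_snd)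
  then show ?thesis unfolding it by simp
qed

lemma PT_rev0: "PT (rev :: 'a::pdata list \<Rightarrow> 'a list)"
proof -
  have e: "foldl (\<lambda>acc y. y # acc) a xs = rev xs @ a" for a and xs :: "'a list"
    by (induction xs arbitrary: a) auto
  have "PT (\<lambda>x :: 'a list. foldl (\<lambda>acc y. y # acc) [] x)"
    by (rule PT_foldl[where q = "\<lambda>x. x"])
      (simp_all add: e psize_rev psize_take, (intro PT_id PT_Nil PT_Cons PT_snd PT_fst polyb_intros)+)
  then show ?thesis by (simp add: e)
qed

lemmas PT_rev = PT_comp[OF PT_rev0]

lemma PT_foldr:
  fixes l :: "'a::pdata \<Rightarrow> 'b::pdata list" and a :: "'a \<Rightarrow> 'c::pdata"
  assumes a: "PT a" and l: "PT l" and f: "PT (\<lambda>p. f (fst p) (fst (snd p)) (snd (snd p)))"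
    and q: "polyb q" "\<And>x j. j \<le> length (l x) \<Longrightarrow> psize (foldr (f x) (drop j (l x)) (a x)) \<le> q (psize x)"
  shows "PT (\<lambda>x. foldr (f x) (l x) (a x))"
proof -
  have e: "foldr (f x) (l x) (a x) = foldl (\<lambda>acc y. f x y acc) (a x) (rev (l x))" for x
    by (simp add: foldl_conv_foldr)
  show ?thesis unfolding e
  proof (rule PT_foldl[where q = q])
    show "PT (\<lambda>p. f (fst p) (snd (snd p)) (fst (snd p)))"
      using PT_comp[OF f, of "\<lambda>p. (fst p, snd (snd p), fst (snd p))"] by (simp add: PT_pair PT_fst PT_snd PT_id)
    show "psize (foldl (\<lambda>acc y. f x y acc) (a x) (take j (rev (l x)))) \<le> q (psize x)" if "j \<le> length (rev (l x))" for x j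
      using q(2)[of "length (l x) - j" x] that by (simp add: take_rev foldl_conv_foldr)
  qed (use a l q in \<open>auto intro: PT_rev\<close>)
qed

lemma PT_append:
  assumes "PT f" "PT g" shows "PT (\<lambda>x. f x @ g x)"
proof -
  have e: "foldr (#) l a = l @ a" for l a :: "'x list" by (induction l) auto
  obtain qf qg where q: "polyb qf" "\<And>x. psize (f x) \<le> qf (psize x)" "polyb qg" "\<And>x. psize (g x) \<le> qg (psize x)"
    using PT_bound[OF assms(1)] PT_bound[OF assms(2)] by metis
  have "PT (\<lambda>x. foldr (#) (f x) (g x))"
  proof (rule PT_foldr[where q = "\<lambda>x. qf x + qg x"])
    show "psize (foldr (#) (drop j (f x)) (g x)) \<le> qf (psize x) + qg (psize x)" for x j
      unfolding e psize_append using q(2,4)[of x] psize_drop[of j "f x"] by simp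
  qed (use assms q in \<open>auto intro!: PT_Cons PT_fst PT_snd polyb_intros\<close>)
  then show ?thesis by (simp add: e)
qed

lemma PT_map:
  fixes l :: "'a::pdata \<Rightarrow> 'b::pdata list"
  assumes g: "PT (\<lambda>p. g (fst p) (snd p))" and l: "PT l" shows "PT (\<lambda>x. map (g x) (l x))"
proof -
  have e: "foldr (\<lambda>y acc. g x y # acc) l [] = map (g x) l" for x l by (induction l) auto
  obtain ql where ql: "polyb ql" "\<And>x. psize (l x) \<le> ql (psize x)" using PT_bound[OF l] by blast
  obtain qg where qg: "polyb qg" "\<And>p. psize (g (fst p) (snd p)) \<le> qg (psize p)" using PT_bound[OF g] by blast
  have p: "polyb (\<lambda>x. qg (x + ql x + 1))" by (rule polyb_compose[OF qg(1)]) (intro polyb_intros ql)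
  have "PT (\<lambda>x. foldr (\<lambda>y acc. g x y # acc) (l x) [])"
  proof (rule PT_foldr[where q = "\<lambda>x. ql x * (qg (x + ql x + 1) + 1)"])
    show "PT (\<lambda>p :: 'a \<times> 'b \<times> _. g (fst p) (fst (snd p)) # snd (snd p))"
      using PT_comp[OF g PT_pair[OF PT_fst[OF PT_id] PT_fst[OF PT_snd[OF PT_id]]]]
      by (intro PT_Cons PT_fst PT_snd PT_id) simp
    show "polyb (\<lambda>x. ql x * (qg (x + ql x + 1) + 1))" by (intro polyb_intros ql p)
    show "psize (foldr (\<lambda>y acc. g x y # acc) (drop j (l x)) []) \<le> ql (psize x) * (qg (psize x + ql (psize x) + 1) + 1)" for x j
      unfolding e
    proof (rule order_trans[OF psize_list_le mult_mono])
      fix z assume "z \<in> set (map (g x) (drop j (l x)))"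
      then obtain y where y: "y \<in> set (l x)" "z = g x y" by (auto dest: in_set_dropD)
      have "psize z \<le> qg (psize (x, y))" using qg(2)[of "(x, y)"] y by simp
      also have "\<dots> \<le> qg (psize x + ql (psize x) + 1)"
        by (rule polyb_mono[OF qg(1)]) (use psize_mem[OF y(1)] ql(2)[of x] in \<open>simp add: psize_Pair\<close>)
      finally show "psize z \<le> qg (psize x + ql (psize x) + 1)" .
    next
      show "length (map (g x) (drop j (l x))) \<le> ql (psize x)" using length_le_psize[of "l x"] ql(2)[of x] by simp
    qed auto
  qed (use l in \<open>auto intro: PT_Nil\<close>)
  then show ?thesis by (simp add: e)
qed

lemma PT_filter:
  fixes l :: "'a::pdata \<Rightarrow> 'b::pdata list"
  assumes g: "PT (\<lambda>p. P (fst p) (snd p))" and l: "PT l" shows "PT (\<lambda>x. filter (P x) (l x))"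
proof -
  have e: "foldr (\<lambda>y acc. if P x y then y # acc else acc) l [] = filter (P x) l" for x l by (induction l) auto
  obtain ql where ql: "polyb ql" "\<And>x. psize (l x) \<le> ql (psize x)" using PT_bound[OF l] by blast
  have "PT (\<lambda>x. foldr (\<lambda>y acc. if P x y then y # acc else acc) (l x) [])"
  proof (rule PT_foldr[where q = ql])
    show "PT (\<lambda>p :: 'a \<times> 'b \<times> 'b list. if P (fst p) (fst (snd p)) then fst (snd p) # snd (snd p) else snd (snd p))"
      using PT_comp[OF g PT_pair[OF PT_fst[OF PT_id] PT_fst[OF PT_snd[OF PT_id]]]]
      by (intro PT_if PT_Cons PT_fst PT_snd PT_id) simp
    show "psize (foldr (\<lambda>y acc. if P x y then y # acc else acc) (drop j (l x)) []) \<le> ql (psize x)" for x j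
      unfolding e using psize_filter[of "P x" "drop j (l x)"] psize_drop[of j "l x"] ql(2)[of x] by linarith
  qed (use l ql in \<open>auto intro: PT_Nil\<close>)
  then show ?thesis by (simp add: e)
qed

lemma PT_ex:
  assumes "PT (\<lambda>p. P (fst p) (snd p))" "PT l" shows "PT (\<lambda>x. \<exists>y\<in>set (l x). P x y)"
  by (rule PT_cong[OF PT_not_Nil[OF PT_filter[OF assms]]]) (simp add: filter_empty_conv)

lemma PT_all:
  assumes "PT (\<lambda>p. P (fst p) (snd p))" "PT l" shows "PT (\<lambda>x. \<forall>y\<in>set (l x). P x y)"
  by (rule PT_cong[OF PT_not[OF PT_ex[OF PT_not[OF assms(1)] assms(2)]]]) simp

lemma PT_length:
  fixes l :: "'a::pdata \<Rightarrow> 'b::pdata list"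
  assumes "PT l" shows "PT (\<lambda>x. length (l x))"
proof -
  have e: "foldr (\<lambda>y :: 'b. Suc) l 0 = length l" for l by (induction l) auto
  have "PT (\<lambda>l :: 'b list. foldr (\<lambda>y. Suc) l 0)"
  proof (rule PT_foldr[where q = "\<lambda>x. x"])
    show "psize (foldr (\<lambda>y :: 'b. Suc) (drop j l) 0) \<le> psize l" for l j
      unfolding e psize_nat_def using length_le_psize[of l] by simp
  qed (intro PT_id PT_nat PT_Suc PT_snd polyb_intros)+
  from PT_comp[OF this assms] show ?thesis by (simp add: e)
qed

text \<open>By repeated addition, which is polynomial because the size of a number is its
  value.\<close>

lemma PT_mult:
  assumes "PT f" "PT g" shows "PT (\<lambda>x. f x * g x :: nat)"
proof -
  have e: "((+) b ^^ a) 0 = a * b" for a b :: nat by (induction a) auto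
  have "PT (\<lambda>p :: nat \<times> nat. ((+) (snd p) ^^ fst p) 0)"
  proof (rule PT_iter[where q = "\<lambda>x. x * x"])
    show "psize (((+) (snd p) ^^ j) 0) \<le> psize p * psize p" if "j \<le> fst p" for p :: "nat \<times> nat" and j
      unfolding e psize_nat_def psize_prod_def using that by (intro mult_mono) auto
  qed (intro PT_id PT_nat PT_add PT_snd PT_fst polyb_intros)+
  from PT_comp[OF this PT_pair[OF assms]] show ?thesis by (simp add: e)
qed

lemma PT_upt: assumes "PT n" shows "PT (\<lambda>x. [0..<n x])"
proof -
  let ?f = "\<lambda>st :: nat \<times> nat list. (fst st - 1, (fst st - 1) # snd st)"
  have e: "(?f ^^ j) (n, []) = (n - j, [n - j..<n])" if "j \<le> n" for n j
    using that
  proof (induction j)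
    case (Suc j)
    then have "[n - Suc j..<n] = (n - Suc j) # [n - j..<n]" by (simp add: upt_conv_Cons Suc_diff_Suc)
    with Suc show ?case by simp
  qed simp
  have "PT (\<lambda>n :: nat. (?f ^^ n) (n, []))"
  proof (rule PT_iter[where q = "\<lambda>x. x + x * (x + 1) + 1"])
    fix n j :: nat assume j: "j \<le> n"
    have "psize [n - j..<n] \<le> length [n - j..<n] * (n + 1)" by (rule psize_list_le) (simp add: psize_nat_def)
    also have "\<dots> \<le> n * (n + 1)" using j by (intro mult_right_mono) auto
    finally show "psize ((?f ^^ j) (n, [])) \<le> psize n + psize n * (psize n + 1) + 1"
      unfolding e[OF j] by (simp add: psize_Pair psize_nat_def)
  qed (intro PT_id PT_pair PT_nat PT_Nil PT_Cons PT_sub PT_fst PT_snd polyb_intros)+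
  from PT_comp[OF PT_snd[OF this] assms] show ?thesis unfolding e[OF le_refl] by simp
qed

lemma PT_concat:
  fixes l :: "'a::pdata \<Rightarrow> 'b::pdata list list"
  assumes "PT l" shows "PT (\<lambda>x. concat (l x))"
proof -
  have e: "foldr (@) l [] = concat l" for l :: "'b list list" by (induction l) auto
  have s: "psize (concat l) \<le> psize l" for l :: "'b list list" by (induction l) (auto simp: psize_append)
  have "PT (\<lambda>l :: 'b list list. foldr (@) l [])"
  proof (rule PT_foldr[where q = "\<lambda>x. x"])
    show "psize (foldr (@) (drop j l) []) \<le> psize l" for l :: "'b list list" and j
      unfolding e using s[of "drop j l"] psize_drop[of j l] by linarith
  qed (intro PT_id PT_Nil PT_append PT_fst PT_snd polyb_intros)+
  from PT_comp[OF this assms] show ?thesis by (simp add: e)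
qed

lemma PT_mem: "PT a \<Longrightarrow> PT l \<Longrightarrow> PT (\<lambda>x. (a x :: nat) \<in> set (l x))"
  by (rule PT_cong[OF PT_ex[where P = "\<lambda>x y. y = a x"]]) (auto intro: PT_eq PT_snd PT_comp[OF _ PT_fst0])

lemma PT_list_eq: assumes "PT a" "PT b" shows "PT (\<lambda>x. (a x :: nat list) = b x)"
proof -
  let ?f = "\<lambda>acc y. case snd acc of [] \<Rightarrow> (False, []) | z # zs \<Rightarrow> (fst acc \<and> y = z, zs)"
  have e: "fst (foldl ?f (t, ys) xs) \<and> snd (foldl ?f (t, ys) xs) = [] \<longleftrightarrow> t \<and> xs = ys" for t and xs ys :: "nat list"
  proof (induction xs arbitrary: t ys)
    case (Cons x xs)
    show ?case
    proof (cases ys)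
      case Nil
      show ?thesis unfolding Nil using Cons.IH[of False "[]"] by simp
    next
      case (Cons z zs)
      then show ?thesis using Cons.IH by auto
    qed
  qed auto
  have s: "psize (foldl ?f (t, ys) xs) \<le> psize ys + 1" for t and xs ys :: "nat list"
  proof (induction xs arbitrary: t ys)
    case (Cons x xs)
    show ?case
    proof (cases ys)
      case Nil
      show ?thesis unfolding Nil using Cons.IH[of False "[]"] by simp
    next
      case (Cons z zs)
      then show ?thesis using Cons.IH[of "t \<and> x = z" zs] by auto
    qed
  qed (auto simp: psize_Pair psize_bool_def)
  have F: "PT (\<lambda>p :: nat list \<times> nat list. foldl ?f (True, snd p) (fst p))"
  proof (rule PT_foldl[where q = "\<lambda>x. x + 1"])
    show "psize (foldl ?f (True, snd p) (take j (fst p))) \<le> psize p + 1" for p :: "nat list \<times> nat list" and j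
      using s[of True "snd p" "take j (fst p)"] by (simp add: psize_prod_def)
  qed (intro PT_pair PT_bool PT_snd PT_fst PT_id PT_case_list PT_Nil PT_conj PT_eq polyb_intros)+
  have "PT (\<lambda>p :: nat list \<times> nat list. fst (foldl ?f (True, snd p) (fst p)) \<and> \<not> snd (foldl ?f (True, snd p) (fst p)) \<noteq> [])"
    by (intro PT_conj PT_not PT_not_Nil PT_fst PT_snd F)
  then have "PT (\<lambda>p :: nat list \<times> nat list. fst p = snd p)" by (simp add: e)
  from PT_comp[OF this PT_pair[OF assms]] show ?thesis by simp
qed

lemma PT_list_mem: "PT a \<Longrightarrow> PT l \<Longrightarrow> PT (\<lambda>x. (a x :: nat list) \<in> set (l x))"
  by (rule PT_cong[OF PT_ex[where P = "\<lambda>x y. y = a x"]]) (auto intro: PT_list_eq PT_snd PT_comp[OF _ PT_fst0])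

lemma PT_remdups: assumes "PT l" shows "PT (\<lambda>x. remdups (l x :: nat list list))"
proof -
  have e: "foldr (\<lambda>y acc. if y \<in> set acc then acc else y # acc) l [] = remdups l" for l :: "nat list list"
    by (induction l) auto
  have s: "psize (remdups l) \<le> psize l" for l :: "nat list list" by (induction l) auto
  have "PT (\<lambda>l :: nat list list. foldr (\<lambda>y acc. if y \<in> set acc then acc else y # acc) l [])"
  proof (rule PT_foldr[where q = "\<lambda>x. x"])
    show "psize (foldr (\<lambda>y acc. if y \<in> set acc then acc else y # acc) (drop j l) []) \<le> psize l" for l :: "nat list list" and j
      unfolding e using s[of "drop j l"] psize_drop[of j l] by linarith
  qed (intro PT_Nil PT_id PT_if PT_list_mem PT_Cons PT_snd PT_fst polyb_intros)+
  from PT_comp[OF this assms] show ?thesis by (simp add: e)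
qed

lemma PT_min: "PT f \<Longrightarrow> PT g \<Longrightarrow> PT (\<lambda>x. min (f x) (g x) :: nat)"
  unfolding min_def by (intro PT_if PT_le)

section \<open>Simulating a program with bounded fuel\<close>

type_synonym sim_state = "big \<times> (big \<times> big) list"

text \<open>The simulated memory is the log of all writes, newest first, with default value 0. A
  simulated step adds at most one entry, of size 2, so the state grows linearly with the number of
  steps however large the numbers become.\<close>

definition mem_lookup :: "(big \<times> big) list \<Rightarrow> big \<Rightarrow> big" where
  "mem_lookup mem a = foldr (\<lambda>e r. if fst e = a then snd e else r) mem (Big 0)"

lemma mem_lookup_simps [simp]:
  "mem_lookup [] a = Big 0" "mem_lookup (e # mem) a = (if fst e = a then snd e else mem_lookup mem a)"
  by (simp_all add: mem_lookup_def)

text \<open>The address is a \<open>big\<close> and cannot bound a loop. The whole input is scanned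
  instead, while a \<open>big\<close> counter is compared with the address.\<close>

definition input_lookup :: "nat list \<Rightarrow> big \<Rightarrow> big" where
  "input_lookup ys a =
    snd (foldl (\<lambda>acc y. (big_op (+) (fst acc) (Big 1), if fst acc = a then Big y else snd acc)) (Big 0, Big 0) ys)"

lemma input_lookup: "input_lookup ys (Big j) = Big (if j < length ys then ys ! j else 0)"
proof -
  let ?f = "\<lambda>acc y. (big_op (+) (fst acc) (Big 1), if fst acc = Big j then Big y else snd acc)"
  have "foldl ?f (Big 0, Big 0) ys = (Big (length ys), Big (if j < length ys then ys ! j else 0))"
    by (induction ys rule: rev_induct) (auto simp: big_op_def nth_append)
  then show ?thesis by (simp add: input_lookup_def)
qed

fun sim_instr :: "instr \<Rightarrow> nat list \<Rightarrow> sim_state \<Rightarrow> sim_state" where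
  "sim_instr (Const i c) ys (pc, mem) = (big_op (+) pc (Big 1), (Big i, Big c) # mem)"
| "sim_instr (Add i j l) ys (pc, mem) =
    (big_op (+) pc (Big 1), (Big i, big_op (+) (mem_lookup mem (Big j)) (mem_lookup mem (Big l))) # mem)"
| "sim_instr (Sub i j l) ys (pc, mem) =
    (big_op (+) pc (Big 1), (Big i, big_op (-) (mem_lookup mem (Big j)) (mem_lookup mem (Big l))) # mem)"
| "sim_instr (Load i j) ys (pc, mem) =
    (big_op (+) pc (Big 1), (Big i, mem_lookup mem (mem_lookup mem (Big j))) # mem)"
| "sim_instr (Store i j) ys (pc, mem) =
    (big_op (+) pc (Big 1), (mem_lookup mem (Big i), mem_lookup mem (Big j)) # mem)"
| "sim_instr (Input i j) ys (pc, mem) =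
    (big_op (+) pc (Big 1), (Big i, input_lookup ys (mem_lookup mem (Big j))) # mem)"
| "sim_instr (JumpZero i l) ys (pc, mem) =
    (if mem_lookup mem (Big i) = Big 0 then Big l else big_op (+) pc (Big 1), mem)"

text \<open>The simulated program is fixed, so fetching an instruction is a finite cascade of
  comparisons with the program counter, unrolled by recursion on the program.\<close>

fun sim_step :: "program \<Rightarrow> nat \<Rightarrow> nat list \<Rightarrow> sim_state \<Rightarrow> sim_state" where
  "sim_step [] b ys st = st"
| "sim_step (i # p) b ys st = (if fst st = Big b then sim_instr i ys st else sim_step p (Suc b) ys st)"

definition sim_config :: "sim_state \<Rightarrow> config" where
  "sim_config st = (unbig (fst st), \<lambda>a. unbig (mem_lookup (snd st) (Big a)))"

lemma sim_config_instr: "sim_config (sim_instr i ys st) = exec_instr ys i (sim_config st)"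
proof (cases st)
  case (Pair pc mem)
  have eq: "(Big (unbig x) = x)" for x by simp
  have z: "(unbig x = 0) = (x = Big 0)" for x by (cases x) auto
  show ?thesis unfolding Pair
    by (cases i) (auto simp: sim_config_def big_op_def fun_eq_iff input_lookup[of ys "unbig _", simplified eq] z)
qed

lemma sim_config_step_aux:
  "sim_config (sim_step p b ys st) =
    (if b \<le> unbig (fst st) \<and> unbig (fst st) < b + length p then exec_instr ys (p ! (unbig (fst st) - b)) (sim_config st)
     else sim_config st)"
proof (induction p arbitrary: b)
  case (Cons i p)
  have "(fst st = Big b) = (unbig (fst st) = b)" by (cases "fst st") auto
  then show ?case using Cons.IH[of "Suc b"] sim_config_instr[of i ys st]
    by (auto simp: nth_Cons' Suc_le_eq not_less_eq_eq)
qed auto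

lemma sim_config_step: "sim_config (sim_step p 0 ys st) = ram_step p ys (sim_config st)"
  unfolding sim_config_step_aux ram_step_def by (simp add: sim_config_def)

definition sim_run :: "program \<Rightarrow> nat \<Rightarrow> nat list \<Rightarrow> sim_state" where
  "sim_run p i ys = (sim_step p 0 ys ^^ i) (Big 0, [(Big 0, Big (length ys))])"

lemma sim_config_run: "sim_config (sim_run p i ys) = (ram_step p ys ^^ i) (initial_config ys)"
proof -
  have "sim_config ((sim_step p 0 ys ^^ i) st) = (ram_step p ys ^^ i) (sim_config st)" for st
    by (induction i) (auto simp: sim_config_step)
  moreover have "sim_config (Big 0, [(Big 0, Big (length ys))]) = initial_config ys"
    by (auto simp: sim_config_def initial_config_def fun_eq_iff)
  ultimately show ?thesis by (simp add: sim_run_def)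
qed

text \<open>The result is 0 if the fuel does not suffice, 1 for ``no'' and 2 for ``yes''.\<close>

definition sim_result :: "program \<Rightarrow> nat \<Rightarrow> nat list \<Rightarrow> nat" where
  "sim_result p i ys = (if unbig (big_op (-) (Big (length p)) (fst (sim_run p i ys))) \<noteq> 0 then 0
     else if unbig (mem_lookup (snd (sim_run p i ys)) (Big 0)) \<noteq> 0 then 2 else 1)"

lemma sim_result_halted:
  "sim_result p i ys = (case (ram_step p ys ^^ i) (initial_config ys) of (pc, m) \<Rightarrow>
     if pc < length p then 0 else if m 0 \<noteq> 0 then 2 else 1)"
  unfolding sim_config_run[symmetric] sim_result_def
  by (auto simp: sim_config_def big_op_def)

lemma ram_step_halted: "length p \<le> fst s \<Longrightarrow> (ram_step p ys ^^ i) s = s"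
  by (induction i) (auto simp: ram_step_def)

text \<open>Halted configurations are fixed points, so a simulation that has halted shows the answer
  even if the fuel is below \<open>t\<close>. The first claim permits the use of answers without
  knowledge of \<open>t\<close>; the second provides one as soon as the fuel is large
  enough.\<close>

lemma sim_result_answers:
  assumes "answers_within p ys t b"
  shows "sim_result p i ys \<noteq> 0 \<Longrightarrow> sim_result p i ys = (if b then 2 else 1)"
    and "t \<le> real i \<Longrightarrow> sim_result p i ys = (if b then 2 else 1)"
proof -
  obtain j pc m where j: "real j \<le> t" "(ram_step p ys ^^ j) (initial_config ys) = (pc, m)"
    "length p \<le> pc" "(m 0 \<noteq> 0) = b" using assms unfolding answers_within_def by blast
  have late: "(ram_step p ys ^^ i) (initial_config ys) = (pc, m)" if "j \<le> i" for i
  proof -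
    have "(ram_step p ys ^^ ((i - j) + j)) (initial_config ys) = (pc, m)"
      unfolding funpow_add using ram_step_halted[of p "(pc, m)" "i - j" ys] j by simp
    then show ?thesis using that by simp
  qed
  show "sim_result p i ys = (if b then 2 else 1)" if "t \<le> real i"
    using late[of i] that j by (auto simp: sim_result_halted)
  show "sim_result p i ys = (if b then 2 else 1)" if "sim_result p i ys \<noteq> 0"
  proof (cases "j \<le> i")
    case True
    then show ?thesis using late[of i] j by (auto simp: sim_result_halted)
  next
    case False
    obtain pc' m' where s: "(ram_step p ys ^^ i) (initial_config ys) = (pc', m')" by force
    then have "length p \<le> pc'" using that by (auto simp: sim_result_halted split: if_splits)
    then have "(ram_step p ys ^^ ((j - i) + i)) (initial_config ys) = (pc', m')"
      unfolding funpow_add using s ram_step_halted[of p "(pc', m')" "j - i" ys] by simp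
    then show ?thesis using False j s by (auto simp: sim_result_halted)
  qed
qed

lemma PT_mem_lookup: assumes "PT m" "PT a" shows "PT (\<lambda>x. mem_lookup (m x) (a x))"
proof (rule PT_comp2[OF _ assms])
  show "PT (\<lambda>p :: (big \<times> big) list \<times> big. mem_lookup (fst p) (snd p))"
    unfolding mem_lookup_def
    by (rule PT_foldr[where q = "\<lambda>x. 0"]) ((intro PT_if PT_big_eq PT_fst PT_snd PT_Big PT_id polyb_intros)+, simp add: psize_big_def)
qed

lemma PT_input_lookup: assumes "PT m" "PT a" shows "PT (\<lambda>x. input_lookup (m x) (a x))"
proof (rule PT_comp2[OF _ assms])
  show "PT (\<lambda>p :: nat list \<times> big. input_lookup (fst p) (snd p))"
    unfolding input_lookup_def
    by (intro PT_snd, rule PT_foldl[where q = "\<lambda>x. 1"])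
      ((intro PT_if PT_big_add PT_to_big PT_pair PT_big_eq PT_fst PT_snd PT_Big PT_id polyb_intros)+, simp add: psize_big_def psize_prod_def)
qed

lemma PT_sim_instr: "PT (\<lambda>x. sim_instr i (fst x) (snd x))"
proof -
  have e: "sim_instr i (fst x) (snd x) = sim_instr i (fst x) (fst (snd x), snd (snd x))" for x by simp
  show ?thesis unfolding e
    by (cases i; simp only: sim_instr.simps)
      (intro PT_pair PT_Cons PT_if PT_big_eq PT_big_add PT_big_sub PT_mem_lookup PT_input_lookup PT_Big PT_fst PT_snd PT_id)+
qed

lemma PT_sim_step: "PT (\<lambda>x. sim_step p b (fst x) (snd x))"
  by (induction p arbitrary: b; simp only: sim_step.simps)
    (intro PT_if PT_big_eq PT_Big PT_fst PT_snd PT_id PT_sim_instr | assumption)+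

lemma psize_sim_step: "psize (sim_step p b ys st) \<le> psize st + 2"
proof -
  have "psize (sim_instr i ys st) \<le> psize st + 2" for i ys st
    by (cases st; cases i) (auto simp: psize_Pair psize_big_def)
  then show ?thesis by (induction p arbitrary: b) auto
qed

lemma PT_sim_result: assumes "PT n" "PT l" shows "PT (\<lambda>x. sim_result p (n x) (l x))"
proof -
  have "PT (\<lambda>x :: nat \<times> nat list. sim_run p (fst x) (snd x))"
    unfolding sim_run_def
  proof (rule PT_iter[where q = "\<lambda>x. 2 * x + 3"])
    show "PT (\<lambda>q :: (nat \<times> nat list) \<times> sim_state. sim_step p 0 (snd (fst q)) (snd q))"
      using PT_comp[OF PT_sim_step PT_pair[OF PT_snd[OF PT_fst[OF PT_id]] PT_snd[OF PT_id]]] by simp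
    fix x :: "nat \<times> nat list" and j assume j: "j \<le> fst x"
    have "psize ((sim_step p 0 (snd x) ^^ j) st) \<le> psize st + 2 * j" for st
      by (induction j) (auto intro: order_trans[OF psize_sim_step])
    from this[of "(Big 0, [(Big 0, Big (length (snd x)))])"] j
    show "psize ((sim_step p 0 (snd x) ^^ j) (Big 0, [(Big 0, Big (length (snd x)))])) \<le> 2 * psize x + 3"
      by (simp add: psize_prod_def psize_big_def psize_nat_def)
  qed (intro PT_pair PT_Cons PT_Nil PT_Big PT_to_big PT_length PT_fst PT_snd PT_id polyb_intros)+
  then have r: "PT (\<lambda>x. sim_run p (n x) (l x))" using PT_comp2[of "sim_run p"] assms by blast
  show ?thesis unfolding sim_result_def
    by (intro PT_if PT_big_not_zero PT_big_sub PT_mem_lookup PT_nat PT_Big PT_fst PT_snd r)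
qed

section \<open>Sparsification\<close>

definition lit_holds :: "(nat \<Rightarrow> bool) \<Rightarrow> nat \<Rightarrow> bool" where
  "lit_holds \<alpha> l \<longleftrightarrow> (even l \<longleftrightarrow> \<alpha> (l div 2))"

definition models :: "(nat \<Rightarrow> bool) \<Rightarrow> nat set set \<Rightarrow> bool" where
  "models \<alpha> F \<longleftrightarrow> (\<forall>C\<in>F. \<exists>l\<in>C. lit_holds \<alpha> l)"

definition minimal :: "nat set set \<Rightarrow> nat set set" where
  "minimal F = {C\<in>F. \<forall>C'\<in>F. \<not> C' \<subset> C}"

definition petalset :: "nat \<Rightarrow> nat set \<Rightarrow> nat set set \<Rightarrow> nat set set" where
  "petalset c H F = (\<lambda>C. C - H) ` {C\<in>F. card C = c \<and> H \<subseteq> C}"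

lemma models_minimal:
  assumes "finite F" "\<forall>C\<in>F. finite C" shows "models \<alpha> (minimal F) \<longleftrightarrow> models \<alpha> F"
proof
  assume L: "models \<alpha> (minimal F)"
  show "models \<alpha> F" unfolding models_def
  proof
    fix C assume C: "C \<in> F"
    have "\<exists>C'\<in>minimal F. C' \<subseteq> C"
    proof -
      let ?S = "{C'\<in>F. C' \<subseteq> C}"
      have S: "finite ?S" "C \<in> ?S" using assms C by auto
      from finite_has_minimal2[OF S] obtain C' where C': "C' \<in> ?S" "\<forall>b\<in>?S. b \<subseteq> C' \<longrightarrow> C' = b"
        by (elim bexE conjE)
      have "\<not> X \<subset> C'" if "X \<in> F" for X
      proof
        assume X: "X \<subset> C'"
        then have "X \<in> ?S" using C'(1) that by blast
        then show False using C'(2) X by blast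
      qed
      then have "C' \<in> minimal F" using C'(1) unfolding minimal_def by blast
      then show ?thesis using C' by auto
    qed
    then show "\<exists>l\<in>C. lit_holds \<alpha> l" using L by (auto simp: models_def)
  qed
qed (auto simp: models_def minimal_def)

text \<open>If no literal of \<open>H\<close> holds, every clause containing \<open>H\<close> must
  be satisfied by its petal. Conversely, both alternatives only add clauses to
  \<open>F\<close>.\<close>

lemma models_branch: "models \<alpha> F \<longleftrightarrow> models \<alpha> (insert H F) \<or> models \<alpha> (petalset c H F \<union> F)"
proof
  assume L: "models \<alpha> F"
  show "models \<alpha> (insert H F) \<or> models \<alpha> (petalset c H F \<union> F)"
  proof (cases "\<exists>l\<in>H. lit_holds \<alpha> l")
    case True
    then show ?thesis using L by (auto simp: models_def)
  next
    case False
    have "\<exists>l\<in>C - H. lit_holds \<alpha> l" if "C \<in> F" for C using that False L unfolding models_def by blast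
    then have "models \<alpha> (petalset c H F)" by (auto simp: models_def petalset_def)
    then show ?thesis using L by (auto simp: models_def)
  qed
qed (auto simp: models_def)

section \<open>The potential and its decrease under the branching rules\<close>

definition units :: "nat set set \<Rightarrow> nat set" where
  "units F = {l. {l} \<in> F}"

definition pairs :: "nat set set \<Rightarrow> nat set set" where
  "pairs F = {C\<in>F. card C = 2}"

definition deg :: "nat set set \<Rightarrow> nat \<Rightarrow> nat" where
  "deg E l = card {C\<in>E. l \<in> C}"

definition clauses_below :: "nat \<Rightarrow> nat set set \<Rightarrow> bool" where
  "clauses_below N F \<longleftrightarrow> (\<forall>C\<in>F. C \<subseteq> {..<N} \<and> card C \<le> 3)"

definition antichain :: "nat set set \<Rightarrow> bool" where
  "antichain F \<longleftrightarrow> {} \<notin> F \<and> (\<forall>C\<in>F. \<forall>C'\<in>F. \<not> C' \<subset> C)"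

text \<open>A literal outside of \<open>units F\<close> pays for the 2-clauses that contain it. The correction is
  dropped while some literal lies in too many 2-clauses: then only rules that add units apply.\<close>

definition potential :: "nat \<Rightarrow> nat \<Rightarrow> nat set set \<Rightarrow> nat" where
  "potential D N F = 4 * D * card ({..<N} - units F) -
     (if \<forall>l. deg (pairs F) l < 2 * D then card (pairs F) else 0)"

lemma finite_clauses: "clauses_below N F \<Longrightarrow> finite F" "clauses_below N F \<Longrightarrow> C \<in> F \<Longrightarrow> finite C"
  "clauses_below N F \<Longrightarrow> finite (pairs F)"
proof -
  assume a: "clauses_below N F"
  have "F \<subseteq> Pow {..<N}" using a by (auto simp: clauses_below_def)
  then show "finite F" by (rule finite_subset) simp
  then show "finite (pairs F)" by (simp add: pairs_def)
  show "finite C" if "C \<in> F" using that a by (auto simp: clauses_below_def intro: finite_subset[of _ "{..<N}"])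
qed

lemma pair_not_unit: "antichain F \<Longrightarrow> C \<in> F \<Longrightarrow> card C \<ge> 2 \<Longrightarrow> l \<in> C \<Longrightarrow> l \<notin> units F"
proof
  assume a: "antichain F" "C \<in> F" "card C \<ge> 2" "l \<in> C" "l \<in> units F"
  then have "{l} \<in> F" "{l} \<subset> C" by (auto simp: units_def)
  then show False using a by (auto simp: antichain_def)
qed

text \<open>Each 2-clause is counted at one of its literals, none of which is a unit because
  \<open>F\<close> is an antichain. Compared with the factor \<open>4 * D\<close> in the potential,
  the factor \<open>2 * D\<close> leaves room, so the subtraction there does not truncate.\<close>

lemma card_pairs_le:
  assumes "clauses_below N F" "antichain F" "\<forall>l. deg (pairs F) l < 2 * D"
  shows "card (pairs F) \<le> 2 * D * card ({..<N} - units F)"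
proof -
  let ?V = "{..<N} - units F"
  have "pairs F \<subseteq> (\<Union>l\<in>?V. {C\<in>pairs F. l \<in> C})"
  proof
    fix C assume C: "C \<in> pairs F"
    then have "C \<noteq> {}" by (auto simp: pairs_def)
    then obtain l where l: "l \<in> C" by blast
    have "l \<notin> units F" using pair_not_unit[OF assms(2), of C l] C l by (auto simp: pairs_def)
    moreover have "l < N" using assms(1) C l by (auto simp: clauses_below_def pairs_def)
    ultimately show "C \<in> (\<Union>l\<in>?V. {C\<in>pairs F. l \<in> C})" using C l by blast
  qed
  then have "card (pairs F) \<le> card (\<Union>l\<in>?V. {C\<in>pairs F. l \<in> C})"
    using finite_clauses(3)[OF assms(1)] by (intro card_mono) auto
  also have "\<dots> \<le> (\<Sum>l\<in>?V. card {C\<in>pairs F. l \<in> C})" by (rule card_UN_le) simp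
  also have "\<dots> \<le> (\<Sum>l\<in>?V. 2 * D)" using assms(3) by (intro sum_mono) (auto simp: deg_def less_imp_le)
  finally show ?thesis by (simp add: mult.commute)
qed

text \<open>New units take \<open>4 * D * card A\<close> from the main term. While all degrees are
  below \<open>2 * D\<close>, the 2-clauses that they subsume give back at most \<open>2 * D\<close>
  per unit. If some degree is larger, the potential of \<open>F\<close> contains no correction and
  nothing is given back.\<close>

lemma potential_add_units:
  assumes F: "clauses_below N F" "antichain F" and A: "A \<subseteq> {..<N} - units F"
    and G: "G = minimal (F \<union> (\<lambda>a. {a}) ` A)"
  shows "potential D N G + 2 * D * card A \<le> potential D N F"
proof -
  have finA: "finite A" using A finite_subset by blast
  have ne: "{} \<notin> F \<union> (\<lambda>a. {a}) ` A" using F(2) by (auto simp: antichain_def)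
  have U: "units G = units F \<union> A"
    unfolding G units_def minimal_def using ne by (auto simp: psubset_eq subset_singleton_iff)
  have P: "pairs G = {C\<in>pairs F. C \<inter> A = {}}"
  proof (intro set_eqI iffI)
    fix C assume "C \<in> pairs G"
    then have C: "C \<in> F \<union> (\<lambda>a. {a}) ` A" "card C = 2" "\<forall>C'\<in>F \<union> (\<lambda>a. {a}) ` A. \<not> C' \<subset> C"
      by (auto simp: pairs_def G minimal_def)
    have "a \<notin> C" if "a \<in> A" for a
    proof
      assume "a \<in> C"
      then have "{a} \<subset> C" using C(2) by auto
      then show False using C(3) that by auto
    qed
    then show "C \<in> {C\<in>pairs F. C \<inter> A = {}}" using C by (auto simp: pairs_def)
  next
    fix C assume C: "C \<in> {C\<in>pairs F. C \<inter> A = {}}"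
    then have "\<not> C' \<subset> C" if "C' \<in> F \<union> (\<lambda>a. {a}) ` A" for C' using that F(2) by (auto simp: antichain_def pairs_def)
    then show "C \<in> pairs G" using C by (auto simp: pairs_def G minimal_def)
  qed
  let ?u = "card ({..<N} - units F)" and ?u' = "card ({..<N} - units G)"
  have "{..<N} - units G = ({..<N} - units F) - A" using U by auto
  then have u: "?u' = ?u - card A" "card A \<le> ?u"
    using A finA by (auto simp: card_Diff_subset intro: card_mono)
  have fp: "finite (pairs F)" by (rule finite_clauses(3)[OF F(1)])
  have "pairs F \<subseteq> pairs G \<union> (\<Union>a\<in>A. {C\<in>pairs F. a \<in> C})" unfolding P by auto
  then have "card (pairs F) \<le> card (pairs G \<union> (\<Union>a\<in>A. {C\<in>pairs F. a \<in> C}))"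
    using fp finA by (intro card_mono) (auto simp: P)
  also have "\<dots> \<le> card (pairs G) + card (\<Union>a\<in>A. {C\<in>pairs F. a \<in> C})" by (rule card_Un_le)
  also have "card (\<Union>a\<in>A. {C\<in>pairs F. a \<in> C}) \<le> (\<Sum>a\<in>A. deg (pairs F) a)"
    unfolding deg_def by (rule card_UN_le[OF finA])
  finally have pp: "card (pairs F) \<le> card (pairs G) + (\<Sum>a\<in>A. deg (pairs F) a)" by simp
  have d: "deg (pairs G) l \<le> deg (pairs F) l" for l unfolding deg_def using fp by (intro card_mono) (auto simp: P)
  have Du: "4 * D * ?u = 4 * D * ?u' + 4 * D * card A" using u by (metis add.commute add_mult_distrib2 le_add_diff_inverse)
  show ?thesis
  proof (cases "\<forall>l. deg (pairs F) l < 2 * D")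
    case True
    then have g: "\<forall>l. deg (pairs G) l < 2 * D" using d le_less_trans by blast
    have "(\<Sum>a\<in>A. deg (pairs F) a) \<le> (\<Sum>a\<in>A. 2 * D)" using True by (intro sum_mono) (auto intro: less_imp_le)
    then have "(\<Sum>a\<in>A. deg (pairs F) a) \<le> 2 * D * card A" by (simp add: mult.commute)
    moreover have "card (pairs F) \<le> 2 * D * ?u" by (rule card_pairs_le[OF F True])
    moreover have "2 * D * card A \<le> 2 * D * ?u" using u(2) by simp
    ultimately show ?thesis unfolding potential_def using True g pp Du by simp
  next
    case False
    then have "potential D N F = 4 * D * ?u" unfolding potential_def by (simp only: if_False)
    moreover have "potential D N G \<le> 4 * D * ?u'" unfolding potential_def by simp
    ultimately show ?thesis using Du by simp
  qed
qed

text \<open>No literal of a new pair is a unit, so the new pairs are not subsumed, and the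
  correction grows by \<open>card X\<close>. Degrees below \<open>D\<close> in \<open>F\<close> and
  at most \<open>D\<close> in \<open>X\<close> add up to less than \<open>2 * D\<close>, so the
  correction stays in force. This is the reason for the gap between the threshold \<open>D\<close>
  of the rules and \<open>2 * D\<close> in the potential.\<close>

lemma potential_add_pairs:
  assumes F: "clauses_below N F" "antichain F" and X: "\<forall>C\<in>X. card C = 2 \<and> C \<subseteq> {..<N} - units F \<and> C \<notin> F"
    and G: "G = minimal (F \<union> X)" and D: "\<forall>l. deg (pairs F) l < D" "\<forall>l. deg X l \<le> D"
  shows "potential D N G + card X \<le> potential D N F"
proof -
  have "X \<subseteq> Pow {..<N}" using X by auto
  then have finX: "finite X" by (rule finite_subset) simp
  have ne: "{} \<notin> F \<union> X" using F(2) X by (force simp: antichain_def)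
  have nox: "{l} \<notin> X" for l using X by force
  have U: "units G = units F"
    unfolding G units_def minimal_def using ne nox by (auto simp: psubset_eq subset_singleton_iff)
  have P: "pairs G = pairs F \<union> X"
  proof (intro set_eqI iffI)
    fix C assume C: "C \<in> pairs F \<union> X"
    have c2: "card C = 2" using C X by (auto simp: pairs_def)
    have nu: "l \<notin> units F" if "l \<in> C" for l
    proof (cases "C \<in> X")
      case True
      then show ?thesis using X that by auto
    next
      case False
      then show ?thesis using pair_not_unit[OF F(2), of C l] C that by (auto simp: pairs_def)
    qed
    have "\<not> C' \<subset> C" if C': "C' \<in> F \<union> X" for C'
    proof
      assume s: "C' \<subset> C"
      have fC: "finite C" using c2 by (metis card.infinite zero_neq_numeral)
      have "card C' < 2" using psubset_card_mono[OF fC s] c2 by simp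
      moreover have "C' \<noteq> {}" using ne C' by auto
      moreover have "finite C'" using s fC by (meson finite_subset psubset_imp_subset)
      ultimately have "card C' = 1" by (metis One_nat_def card_eq_0_iff less_2_cases)
      then obtain l where l: "C' = {l}" by (rule card_1_singletonE)
      then show False using nu[of l] s C' nox by (auto simp: units_def)
    qed
    then show "C \<in> pairs G" using C c2 by (auto simp: pairs_def G minimal_def)
  qed (auto simp: pairs_def G minimal_def)
  have fp: "finite (pairs F)" by (rule finite_clauses(3)[OF F(1)])
  have disj: "pairs F \<inter> X = {}" using X by (auto simp: pairs_def)
  have cP: "card (pairs G) = card (pairs F) + card X" unfolding P by (rule card_Un_disjoint[OF fp finX disj])
  have dG: "deg (pairs G) l < 2 * D" for l
  proof -
    have "{C\<in>pairs G. l \<in> C} = {C\<in>pairs F. l \<in> C} \<union> {C\<in>X. l \<in> C}" unfolding P by auto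
    then have "deg (pairs G) l \<le> deg (pairs F) l + deg X l" unfolding deg_def by (metis card_Un_le)
    then show ?thesis using D(1)[rule_format, of l] D(2)[rule_format, of l] by simp
  qed
  have dF: "deg (pairs F) l < 2 * D" for l using D(1)[rule_format, of l] by simp
  have GG: "clauses_below N G" "antichain G"
    using F X ne unfolding G by (auto simp: clauses_below_def minimal_def antichain_def)
  have "card (pairs G) \<le> 2 * D * card ({..<N} - units G)" using card_pairs_le[OF GG] dG by blast
  then show ?thesis unfolding potential_def using dG dF cP U by simp
qed

lemma petal_members:
  assumes F: "clauses_below N F" "antichain F" and C: "C \<in> F" "card C = c" "H \<subseteq> C" "H \<noteq> {}" "card H < c"
  shows "C - H \<notin> F" "H \<notin> F" "c \<ge> 2 \<Longrightarrow> C \<subseteq> {..<N} - units F"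
proof -
  have "C - H \<subset> C" using C by auto
  then show "C - H \<notin> F" using C(1) F(2) unfolding antichain_def by blast
  have "H \<subset> C" using C by auto
  then show "H \<notin> F" using C(1) F(2) unfolding antichain_def by blast
  show "C \<subseteq> {..<N} - units F" if "c \<ge> 2"
    using pair_not_unit[OF F(2) C(1)] C(2) that F(1) C(1) by (auto simp: clauses_below_def)
qed

lemma petalset_units:
  assumes F: "clauses_below N F" "antichain F" and H: "H \<noteq> {}" "finite H" and c: "c = Suc (card H)"
  obtains A where "A \<subseteq> {..<N} - units F" "petalset c H F = (\<lambda>a. {a}) ` A" "card A = card (petalset c H F)"
proof -
  let ?A = "\<Union>(petalset c H F)"
  have one: "\<exists>a. P = {a} \<and> a \<in> {..<N} - units F" if P: "P \<in> petalset c H F" for P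
  proof -
    obtain C where C: "C \<in> F" "card C = c" "H \<subseteq> C" "P = C - H" using P by (auto simp: petalset_def)
    have "card P = 1" using C c H by (simp add: card_Diff_subset)
    then obtain a where a: "P = {a}" by (rule card_1_singletonE)
    have "card H \<noteq> 0" using H by simp
    then have "c \<ge> 2" using c by simp
    then have "a \<in> {..<N} - units F" using petal_members(3)[OF F C(1,2,3) H(1)] c C a by auto
    then show ?thesis using a by blast
  qed
  have "petalset c H F = (\<lambda>a. {a}) ` ?A"
  proof (intro set_eqI iffI)
    fix P assume P: "P \<in> petalset c H F"
    then obtain a where "P = {a}" using one by blast
    then show "P \<in> (\<lambda>a. {a}) ` ?A" using P by blast
  next
    fix P assume "P \<in> (\<lambda>a. {a}) ` ?A"
    then obtain a Q where "P = {a}" "a \<in> Q" "Q \<in> petalset c H F" by blast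
    then show "P \<in> petalset c H F" using one by fastforce
  qed
  moreover have "card ((\<lambda>a. {a}) ` ?A) = card ?A" by (rule card_image) (simp add: inj_on_def)
  moreover have "?A \<subseteq> {..<N} - units F" using one by fastforce
  ultimately show ?thesis using that[of ?A] by metis
qed

lemma card_petalset: "card (petalset c H F) = card {C\<in>F. card C = c \<and> H \<subseteq> C}"
  unfolding petalset_def by (rule card_image) (auto simp: inj_on_def)

lemma deg_pairs: "deg (pairs F) l = card (petalset 2 {l} F)"
  unfolding card_petalset deg_def pairs_def by (rule arg_cong[where f = card]) auto

text \<open>A branching rule of the sparsification: for a heart \<open>H\<close> contained in at least \<open>\<theta>\<close>
  clauses of size \<open>c\<close>, either \<open>H\<close> holds or all the petals \<open>C - H\<close> hold. The rules that
  produce 2-clauses may only be used if the earlier ones do not apply.\<close>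

definition rule_ok :: "nat \<Rightarrow> nat set set \<Rightarrow> nat \<Rightarrow> nat set \<Rightarrow> bool" where
  "rule_ok D F c H \<longleftrightarrow>
     c = 2 \<and> card H = 1 \<and> D \<le> card (petalset c H F) \<or>
     c = 3 \<and> card H = 2 \<and> D \<le> card (petalset c H F) \<and> (\<forall>x. card (petalset 2 {x} F) < D) \<or>
     c = 3 \<and> card H = 1 \<and> 2 * D * D \<le> card (petalset c H F) \<and> (\<forall>x. card (petalset 2 {x} F) < D) \<and>
       (\<forall>x y. x \<noteq> y \<longrightarrow> card (petalset 3 {x, y} F) < D)"

text \<open>The petals always earn \<open>2 * D * D\<close>: there are at least \<open>D\<close>
  singleton petals worth \<open>2 * D\<close> each, whereas a petal of two literals is worth only 1,
  which is why the last rule asks for \<open>2 * D * D\<close> of them. The heart is worth at least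
  1, as a unit or as one pair.\<close>

lemma potential_branch:
  assumes F: "clauses_below N F" "antichain F" and D: "D > 0" and r: "rule_ok D F c H"
  shows "potential D N (minimal (insert H F)) + 1 \<le> potential D N F"
    and "potential D N (minimal (petalset c H F \<union> F)) + 2 * D * D \<le> potential D N F"
proof -
  have cH: "c = 2 \<and> card H = 1 \<or> c = 3 \<and> card H = 2 \<or> c = 3 \<and> card H = 1" using r by (auto simp: rule_ok_def)
  then have H: "H \<noteq> {}" "finite H" "card H < c" "c \<ge> 2" by (auto intro: card_ge_0_finite)
  have "0 < 2 * D * D" using D by simp
  then have "card (petalset c H F) > 0" using r D unfolding rule_ok_def by linarith
  then have "petalset c H F \<noteq> {}" by auto
  then obtain C where C: "C \<in> F" "card C = c" "H \<subseteq> C" by (auto simp: petalset_def)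
  note pm = petal_members[OF F C H(1,3)]
  have HV: "H \<subseteq> {..<N} - units F" using pm(3) H(4) C(3) by blast
  have unit_heart: "potential D N (minimal (insert H F)) + 1 \<le> potential D N F" if h1: "card H = 1"
  proof -
    obtain x where x: "H = {x}" using h1 by (rule card_1_singletonE)
    have "potential D N (minimal (insert H F)) + 2 * D * card {x} \<le> potential D N F"
      by (rule potential_add_units[OF F]) (use HV x in auto)
    then show ?thesis using D by simp
  qed
  show "potential D N (minimal (insert H F)) + 1 \<le> potential D N F"
  proof (cases "card H = 1")
    case False
    then have c: "c = 3" "card H = 2" "\<forall>x. card (petalset 2 {x} F) < D" using r by (auto simp: rule_ok_def)
    have "deg {H} l \<le> D" for l
    proof -
      have "deg {H} l \<le> card {H}" unfolding deg_def by (rule card_mono) auto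
      then show ?thesis using D by simp
    qed
    then have "potential D N (minimal (insert H F)) + card {H} \<le> potential D N F"
      by (intro potential_add_pairs[OF F]) (use HV c pm in \<open>auto simp: deg_pairs\<close>)
    then show ?thesis by simp
  qed (rule unit_heart)
  show "potential D N (minimal (petalset c H F \<union> F)) + 2 * D * D \<le> potential D N F"
  proof (cases "c = Suc (card H)")
    case True
    obtain A where A: "A \<subseteq> {..<N} - units F" "petalset c H F = (\<lambda>a. {a}) ` A" "card A = card (petalset c H F)"
      using petalset_units[OF F H(1,2) True] .
    have "D \<le> card A" using r True A(3) by (auto simp: rule_ok_def)
    then have "2 * D * D \<le> 2 * D * card A" by simp
    moreover have "potential D N (minimal (petalset c H F \<union> F)) + 2 * D * card A \<le> potential D N F"
      by (rule potential_add_units[OF F A(1)]) (use A(2) in \<open>auto simp: Un_commute\<close>)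
    ultimately show ?thesis by linarith
  next
    case False
    then have c: "c = 3" "card H = 1" "2 * D * D \<le> card (petalset c H F)" "\<forall>x. card (petalset 2 {x} F) < D"
       "\<forall>x y. x \<noteq> y \<longrightarrow> card (petalset 3 {x, y} F) < D"
      using r by (auto simp: rule_ok_def)
    obtain x where x: "H = {x}" using c(2) by (rule card_1_singletonE)
    have X: "\<forall>P\<in>petalset c H F. card P = 2 \<and> P \<subseteq> {..<N} - units F \<and> P \<notin> F"
    proof
      fix P assume "P \<in> petalset c H F"
      then obtain C' where C': "C' \<in> F" "card C' = c" "H \<subseteq> C'" "P = C' - H" by (auto simp: petalset_def)
      note pm' = petal_members[OF F C'(1-3) H(1,3)]
      have "card P = 2" using C' c H by (simp add: card_Diff_subset)
      then show "card P = 2 \<and> P \<subseteq> {..<N} - units F \<and> P \<notin> F" using pm'(1) pm'(3)[OF H(4)] C'(4) by auto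
    qed
    have dX: "deg (petalset c H F) l \<le> D" for l
    proof (cases "l = x")
      case True
      then have "{P \<in> petalset c H F. l \<in> P} = {}" by (auto simp: petalset_def x)
      then have "deg (petalset c H F) l = 0" unfolding deg_def by (simp only: card.empty)
      then show ?thesis by simp
    next
      case False
      \<comment> \<open>A petal containing \<open>l\<close> stems from a 3-clause containing
        \<open>{x, l}\<close>. Fewer than \<open>D\<close> of these exist, since the rule for hearts
        of two literals does not apply.\<close>
      have "{P \<in> petalset c H F. l \<in> P} \<subseteq> (\<lambda>C. C - H) ` {C\<in>F. card C = 3 \<and> {x, l} \<subseteq> C}"
        by (auto simp: petalset_def x c)
      moreover have "finite {C\<in>F. card C = 3 \<and> {x, l} \<subseteq> C}" using finite_clauses(1)[OF F(1)] by simp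
      ultimately have "deg (petalset c H F) l \<le> card {C\<in>F. card C = 3 \<and> {x, l} \<subseteq> C}"
        unfolding deg_def by (meson surj_card_le)
      also have "\<dots> < D" using c(5) False unfolding card_petalset by metis
      finally show ?thesis by simp
    qed
    have "potential D N (minimal (petalset c H F \<union> F)) + card (petalset c H F) \<le> potential D N F"
      by (rule potential_add_pairs[OF F X]) (use c dX in \<open>auto simp: deg_pairs Un_commute\<close>)
    then show ?thesis using c(3) by linarith
  qed
qed

section \<open>Sparsification on lists of clauses\<close>

type_synonym formula = "nat list list"

definition family :: "formula \<Rightarrow> nat set set" where
  "family F = set ` set F"

definition reduce :: "formula \<Rightarrow> formula" where
  "reduce F = remdups (filter (\<lambda>C. \<not> (\<exists>C'\<in>set F. (\<forall>l\<in>set C'. l \<in> set C) \<and> \<not> (\<forall>l\<in>set C. l \<in> set C'))) F)"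

text \<open>Strictly increasing lists represent clauses uniquely. Distinct lists are then distinct
  clauses, and cardinalities of clauses and families become lengths of lists.\<close>

definition sorted_clauses :: "nat \<Rightarrow> formula \<Rightarrow> bool" where
  "sorted_clauses N F \<longleftrightarrow> (\<forall>C\<in>set F. sorted_wrt (<) C \<and> set C \<subseteq> {..<N} \<and> length C \<le> 3)"

definition reduced :: "nat \<Rightarrow> formula \<Rightarrow> bool" where
  "reduced N F \<longleftrightarrow> sorted_clauses N F \<and> distinct F \<and> minimal (family F) = family F"

definition petals :: "nat \<Rightarrow> nat list \<Rightarrow> formula \<Rightarrow> formula" where
  "petals c H F = map (filter (\<lambda>l. l \<notin> set H)) (filter (\<lambda>C. length C = c \<and> (\<forall>l\<in>set H. l \<in> set C)) F)"

text \<open>The order of the list carries the side conditions of \<open>rule_ok\<close>: filtering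
  preserves it, so the head of \<open>applicable\<close> belongs to a later group only if no rule of
  an earlier group applies. The last component is the threshold for the number of petals.\<close>

definition candidates :: "nat \<Rightarrow> nat \<Rightarrow> (nat \<times> nat list \<times> nat) list" where
  "candidates D N = map (\<lambda>x. (2, [x], D)) [0..<N] @
     concat (map (\<lambda>x. map (\<lambda>y. (3, [x, y], D)) (filter (\<lambda>y. x < y) [0..<N])) [0..<N]) @
     map (\<lambda>x. (3, [x], 2 * D * D)) [0..<N]"

definition applicable :: "nat \<Rightarrow> nat \<Rightarrow> formula \<Rightarrow> (nat \<times> nat list \<times> nat) list" where
  "applicable D N F = filter (\<lambda>r. snd (snd r) \<le> length (petals (fst r) (fst (snd r)) F)) (candidates D N)"

text \<open>Filtering \<open>[0..<N]\<close> sorts a clause and removes repetitions. A 3-CNF formula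
  loses nothing by the length filter; its purpose is to make the result reduced for every
  \<open>G\<close>, because the size bounds behind \<open>PT_work\<close> concern arbitrary
  arguments.\<close>

definition normal_form :: "nat \<Rightarrow> formula \<Rightarrow> formula" where
  "normal_form N G = reduce (filter (\<lambda>C. length C \<le> 3) (map (\<lambda>C. filter (\<lambda>l. l \<in> set C) [0..<N]) G))"

lemma family_reduce: "family (reduce F) = minimal (family F)"
proof -
  have e: "((\<forall>l\<in>set C'. l \<in> set C) \<and> \<not> (\<forall>l\<in>set C. l \<in> set C')) = (set C' \<subset> set C)" for C C' :: "nat list"
    by auto
  show ?thesis unfolding family_def reduce_def minimal_def e by auto
qed

lemma minimal_idem: "minimal (minimal F) = minimal F"
  by (auto simp: minimal_def)

lemma reduced_reduce: "sorted_clauses N F \<Longrightarrow> reduced N (reduce F)"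
  unfolding reduced_def family_reduce minimal_idem by (auto simp: sorted_clauses_def reduce_def)

lemma sorted_clauses_below: "sorted_clauses N F \<Longrightarrow> clauses_below N (family F)"
  unfolding sorted_clauses_def clauses_below_def family_def by (auto intro: order_trans[OF card_length])

lemma sorted_card: "sorted_clauses N F \<Longrightarrow> C \<in> set F \<Longrightarrow> card (set C) = length C"
  unfolding sorted_clauses_def by (simp add: distinct_card strict_sorted_iff)

lemma inj_on_set: "sorted_clauses N F \<Longrightarrow> inj_on set (set F)"
  unfolding sorted_clauses_def by (auto simp: inj_on_def intro: strict_sorted_equal)

lemma models_reduce: "sorted_clauses N F \<Longrightarrow> models \<alpha> (family (reduce F)) \<longleftrightarrow> models \<alpha> (family F)"
  unfolding family_reduce using finite_clauses[OF sorted_clauses_below, of N F] by (intro models_minimal) auto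

lemma family_petals:
  assumes "sorted_clauses N F"
  shows "family (petals c H F) = petalset c (set H) (family F)"
  unfolding family_def petals_def petalset_def using sorted_card[OF assms]
  by (auto simp: set_diff_eq image_image intro!: image_eqI)

lemma length_petals:
  assumes "reduced N F"
  shows "length (petals c H F) = card (petalset c (set H) (family F))"
proof -
  have s: "sorted_clauses N F" and d: "distinct F" using assms by (auto simp: reduced_def)
  let ?S = "{C\<in>set F. length C = c \<and> (\<forall>l\<in>set H. l \<in> set C)}"
  have "length (petals c H F) = card ?S"
    unfolding petals_def using d by (simp add: distinct_card[symmetric])
  also have "\<dots> = card (set ` ?S)"
    by (rule card_image[symmetric]) (rule inj_on_subset[OF inj_on_set[OF s]], auto)
  also have "set ` ?S = {C\<in>family F. card C = c \<and> set H \<subseteq> C}"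
    unfolding family_def using sorted_card[OF s] by auto
  finally show ?thesis by (simp add: card_petalset)
qed

lemma sorted_clauses_petals: "sorted_clauses N F \<Longrightarrow> sorted_clauses N (petals c H F)"
  unfolding sorted_clauses_def petals_def
  by (auto simp: sorted_wrt_filter intro: order_trans[OF length_filter_le])

lemma reduced_normal_form: "reduced N (normal_form N G)"
proof -
  have "sorted_clauses N (filter (\<lambda>C. length C \<le> 3) (map (\<lambda>C. filter (\<lambda>l. l \<in> set C) [0..<N]) G))"
    unfolding sorted_clauses_def by (auto intro!: sorted_wrt_filter)
  then show ?thesis unfolding normal_form_def by (rule reduced_reduce)
qed

lemma models_normal_form:
  assumes "\<forall>C\<in>set G. length C \<le> 3 \<and> set C \<subseteq> {..<N}"
  shows "models \<alpha> (family (normal_form N G)) \<longleftrightarrow> models \<alpha> (family G)"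
proof -
  let ?n = "\<lambda>C. filter (\<lambda>l. l \<in> set C) [0..<N]"
  have e: "set (?n C) = set C" "length (?n C) \<le> 3" if "C \<in> set G" for C
  proof -
    show s: "set (?n C) = set C" using that assms by auto
    have "length (?n C) = card (set (?n C))" by (rule distinct_card[symmetric]) simp
    also have "\<dots> \<le> length C" unfolding s by (rule card_length)
    finally show "length (?n C) \<le> 3" using that assms by fastforce
  qed
  have "filter (\<lambda>C. length C \<le> 3) (map ?n G) = map ?n G" using e by (auto simp: filter_id_conv)
  then have n: "normal_form N G = reduce (map ?n G)" by (simp add: normal_form_def)
  have "sorted_clauses N (map ?n G)"
    using e(2) unfolding sorted_clauses_def by (auto intro!: sorted_wrt_filter)
  then have "models \<alpha> (family (normal_form N G)) \<longleftrightarrow> models \<alpha> (family (map ?n G))"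
    unfolding n by (rule models_reduce)
  also have "family (map ?n G) = family G" unfolding family_def using e(1) by (auto simp: image_image intro!: image_eqI)
  finally show ?thesis .
qed

lemma candidate_shape:
  "(c, H, t) \<in> set (candidates D N) \<Longrightarrow> sorted_wrt (<) H \<and> set H \<subseteq> {..<N} \<and> length H \<le> 3 \<and> H \<noteq> []"
  by (auto simp: candidates_def)

lemma petalset_out: "clauses_below N F \<Longrightarrow> x \<in> H \<Longrightarrow> \<not> x < N \<Longrightarrow> petalset c H F = {}"
  by (auto simp: petalset_def clauses_below_def)

lemma applicable_rule_ok:
  assumes r: "reduced N F" and D: "D > 0" and a: "applicable D N F = (c, H, t) # rs"
  shows "rule_ok D (family F) c (set H)"
proof -
  let ?P = "\<lambda>r. snd (snd r) \<le> length (petals (fst r) (fst (snd r)) F)"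
  let ?A = "map (\<lambda>x. (2 :: nat, [x], D)) [0..<N]"
  let ?B = "concat (map (\<lambda>x. map (\<lambda>y. (3 :: nat, [x, y], D)) (filter (\<lambda>y. x < y) [0..<N])) [0..<N])"
  let ?C = "map (\<lambda>x. (3 :: nat, [x], 2 * D * D)) [0..<N]"
  have a': "filter ?P ?A @ filter ?P ?B @ filter ?P ?C = (c, H, t) # rs"
    using a by (simp add: applicable_def candidates_def)
  have below: "clauses_below N (family F)" using r by (auto simp: reduced_def intro: sorted_clauses_below)
  have noA: "\<forall>x. card (petalset 2 {x} (family F)) < D" if "filter ?P ?A = []"
  proof
    fix x show "card (petalset 2 {x} (family F)) < D"
    proof (cases "x < N")
      case True
      then have "\<not> ?P (2, [x], D)" using that by (auto simp: filter_empty_conv)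
      then show ?thesis using length_petals[OF r, of 2 "[x]"] by simp
    next
      case False
      then show ?thesis using petalset_out[OF below, of x "{x}" 2] D by simp
    qed
  qed
  have noB: "\<forall>x y. x \<noteq> y \<longrightarrow> card (petalset 3 {x, y} (family F)) < D" if "filter ?P ?B = []"
  proof (intro allI impI)
    fix x y :: nat assume ne: "x \<noteq> y"
    show "card (petalset 3 {x, y} (family F)) < D"
    proof (cases "x < N \<and> y < N")
      case True
      define u v where "u = min x y" and "v = max x y"
      have uv: "u < v" "v < N" "{u, v} = {x, y}" using ne True by (auto simp: u_def v_def min_def max_def)
      then have "\<not> ?P (3, [u, v], D)" using that by (auto simp: filter_empty_conv)
      then show ?thesis using length_petals[OF r, of 3 "[u, v]"] uv(3) by simp
    next
      case False
      then show ?thesis using petalset_out[OF below, of x "{x, y}" 3] petalset_out[OF below, of y "{x, y}" 3] D by auto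
    qed
  qed
  consider (A) "(c, H, t) \<in> set (filter ?P ?A)" | (B) "filter ?P ?A = []" "(c, H, t) \<in> set (filter ?P ?B)"
    | (C) "filter ?P ?A = []" "filter ?P ?B = []" "(c, H, t) \<in> set (filter ?P ?C)"
    using a' by (cases "filter ?P ?A"; cases "filter ?P ?B"; cases "filter ?P ?C") auto
  then show ?thesis
  proof cases
    case A
    then show ?thesis using length_petals[OF r, of c H] by (auto simp: rule_ok_def)
  next
    case B
    then obtain x y where "c = 3" "H = [x, y]" "t = D" "x < y" "t \<le> length (petals c H F)" by auto
    then show ?thesis using length_petals[OF r, of c H] noA[OF B(1)] by (auto simp: rule_ok_def)
  next
    case C
    then obtain x where "c = 3" "H = [x]" "t = 2 * D * D" "t \<le> length (petals c H F)" by auto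
    then show ?thesis using length_petals[OF r, of c H] noA[OF C(1)] noB[OF C(2)] by (auto simp: rule_ok_def)
  qed
qed

text \<open>The empty clause subsumes all others, so a reduced formula containing it consists of it
  alone, and then there are no petals at all.\<close>

lemma applicable_antichain:
  assumes r: "reduced N F" and D: "D > 0" and a: "applicable D N F \<noteq> []"
  shows "antichain (family F)"
proof -
  have m: "minimal (family F) = family F" using r by (simp add: reduced_def)
  have "{} \<notin> family F"
  proof
    assume e: "{} \<in> family F"
    have "family F = {{}}"
    proof (rule ccontr)
      assume "family F \<noteq> {{}}"
      then obtain C where "C \<in> family F" "C \<noteq> {}" using e by blast
      then have "C \<in> minimal (family F)" "{} \<subset> C" using m by auto
      then show False using e by (auto simp: minimal_def)
    qed
    then have p: "petalset c H (family F) = {}" if "c > 0" for c H using that by (auto simp: petalset_def)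
    obtain c H t rs where "applicable D N F = (c, H, t) # rs" using a by (cases "applicable D N F") auto
    from applicable_rule_ok[OF r D this] show False using p D by (auto simp: rule_ok_def)
  qed
  then show ?thesis using m unfolding antichain_def minimal_def by blast
qed

text \<open>The summands count the clauses of size 1, 2 and 3 that contain \<open>l\<close>; the
  last two are the thresholds of the rules for the heart \<open>{l}\<close>.\<close>

lemma leaf_occurrences:
  assumes r: "reduced N F" and a: "applicable D N F = []"
  shows "length (filter (\<lambda>C. l \<in> set C) F) \<le> 1 + D + 2 * D * D"
proof (cases "l < N")
  case True
  let ?f = "\<lambda>c. {C\<in>family F. card C = c \<and> {l} \<subseteq> C}"
  have s: "sorted_clauses N F" and d: "distinct F" using r by (auto simp: reduced_def)
  have np: "t > length (petals c H F)" if "(c, H, t) \<in> set (candidates D N)" for c H t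
    using a that by (fastforce simp: applicable_def filter_empty_conv)
  have "(2, [l], D) \<in> set (candidates D N)" "(3, [l], 2 * D * D) \<in> set (candidates D N)"
    using True by (auto simp: candidates_def)
  from np[OF this(1)] np[OF this(2)] have c23: "card (?f 2) < D" "card (?f 3) < 2 * D * D"
    using length_petals[OF r, of 2 "[l]"] length_petals[OF r, of 3 "[l]"] by (simp_all add: card_petalset)
  have "?f 1 \<subseteq> {{l}}" by (auto simp: card_Suc_eq)
  then have c1: "card (?f 1) \<le> 1" by (metis card.empty card_insert_if card_mono finite.simps empty_iff One_nat_def)
  have "length (filter (\<lambda>C. l \<in> set C) F) = card (set (filter (\<lambda>C. l \<in> set C) F))"
    by (rule distinct_card[symmetric]) (use d in simp)
  also have "\<dots> = card (set ` set (filter (\<lambda>C. l \<in> set C) F))"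
    by (rule card_image[symmetric]) (rule inj_on_subset[OF inj_on_set[OF s]], auto)
  also have "set ` set (filter (\<lambda>C. l \<in> set C) F) \<subseteq> ?f 1 \<union> ?f 2 \<union> ?f 3"
  proof
    fix X assume "X \<in> set ` set (filter (\<lambda>C. l \<in> set C) F)"
    then obtain C where C: "C \<in> set F" "l \<in> set C" "X = set C" by auto
    have "card X \<le> 3" "card X \<noteq> 0" using C s sorted_card[OF s C(1)] by (auto simp: sorted_clauses_def)
    then have "card X = 1 \<or> card X = 2 \<or> card X = 3" by linarith
    then show "X \<in> ?f 1 \<union> ?f 2 \<union> ?f 3" using C by (auto simp: family_def)
  qed
  then have "card (set ` set (filter (\<lambda>C. l \<in> set C) F)) \<le> card (?f 1 \<union> ?f 2 \<union> ?f 3)"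
    by (intro card_mono) (auto simp: family_def)
  also have "\<dots> \<le> card (?f 1) + card (?f 2) + card (?f 3)"
    by (metis (no_types, lifting) add_right_mono card_Un_le order_trans)
  finally show ?thesis using c1 c23 by simp
next
  case False
  then have "filter (\<lambda>C. l \<in> set C) F = []" using r by (auto simp: reduced_def sorted_clauses_def filter_empty_conv)
  then show ?thesis by simp
qed

section \<open>Directed Steiner Tree instances\<close>

text \<open>A vertex is described by its kind (0: root, 1: partial assignment, 2: group terminal,
  3: clause terminal, 4: padding), the index of its group and a list of literals.\<close>

type_synonym vertex = "nat \<times> nat \<times> nat list"

definition adjacent :: "vertex \<Rightarrow> vertex \<Rightarrow> bool" where
  "adjacent u v \<longleftrightarrow>
     fst u = 0 \<and> fst v = 1 \<or>
     fst u = 1 \<and> fst v = 2 \<and> fst (snd u) = fst (snd v) \<or>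
     fst u = 1 \<and> fst v = 3 \<and> (\<exists>l\<in>set (snd (snd u)). l \<in> set (snd (snd v)))"

definition is_terminal :: "vertex \<Rightarrow> bool" where
  "is_terminal v \<longleftrightarrow> fst v = 2 \<or> fst v = 3"

definition dst_of :: "vertex list \<Rightarrow> nat \<Rightarrow> nat dst_instance" where
  "dst_of V k = \<lparr>dst_graph = \<lparr>pverts = {..<length V},
       parcs = {(i, j). i < length V \<and> j < length V \<and> adjacent (V ! i) (V ! j)}\<rparr>,
     dst_root = 0, dst_terminals = {i. i < length V \<and> is_terminal (V ! i)}, dst_budget = k\<rparr>"

text \<open>Agrees with \<open>encode_dst\<close> of \<open>dst_of V k\<close>, but traverses
  \<open>V\<close> instead of indexing it, so that it lies within the calculus.\<close>

definition encode_vertices :: "vertex list \<Rightarrow> nat \<Rightarrow> nat list" where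
  "encode_vertices V k = [length V, k, 0] @ map (\<lambda>v. if is_terminal v then 1 else 0) V @
     concat (map (\<lambda>u. map (\<lambda>v. if adjacent u v then 1 else 0) V) V)"

lemma dst_of_simps [simp]:
  "pverts (dst_graph (dst_of V k)) = {..<length V}"
  "parcs (dst_graph (dst_of V k)) = {(i, j). i < length V \<and> j < length V \<and> adjacent (V ! i) (V ! j)}"
  "dst_root (dst_of V k) = 0" "dst_terminals (dst_of V k) = {i. i < length V \<and> is_terminal (V ! i)}"
  "dst_budget (dst_of V k) = k" "dst_order (dst_of V k) = length V"
  by (simp_all add: dst_of_def dst_order_def)

lemma encode_dst_of: "encode_dst (dst_of V k) = encode_vertices V k"
proof -
  have e: "map f V = map (\<lambda>i. f (V ! i)) [0..<length V]" for f :: "vertex \<Rightarrow> 'z"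
    by (rule nth_equalityI) auto
  show ?thesis unfolding encode_dst_def encode_vertices_def e
    by (auto simp: of_bool_def intro!: arg_cong[where f = concat] map_cong)
qed

lemma not_adjacent_refl: "\<not> adjacent u u"
  by (auto simp: adjacent_def)

lemma pair_digraph_dst_of: "pair_digraph (dst_graph (dst_of V k))"
proof
  have "parcs (dst_graph (dst_of V k)) \<subseteq> {..<length V} \<times> {..<length V}" by auto
  then show "finite (parcs (dst_graph (dst_of V k)))" by (rule finite_subset) simp
qed (auto simp: not_adjacent_refl)

lemma dst_of_inputs:
  assumes "V \<noteq> []" "fst (V ! 0) = 0" shows "dst_of V k \<in> dst_inputs"
  using assms pair_digraph_dst_of by (auto simp: dst_inputs_def is_terminal_def)

lemma dst_of_acyclic: "acyclic_digraph (with_proj (dst_graph (dst_of V k)) \<restriction> dst_terminals (dst_of V k))"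
proof -
  let ?G = "with_proj (dst_graph (dst_of V k)) \<restriction> dst_terminals (dst_of V k)"
  have no: "arcs ?G = {}" by (auto simp: adjacent_def is_terminal_def)
  show ?thesis unfolding acyclic_digraph_def
  proof
    assume "\<exists>p. pre_digraph.cycle ?G p"
    then obtain p where "set p \<subseteq> arcs ?G" "p \<noteq> []"
      unfolding pre_digraph.cycle_def pre_digraph.awalk_def by blast
    then show False unfolding no by simp
  qed
qed

text \<open>Only the last arc of a path matters: a terminal can be entered only from a partial
  assignment, and the root reaches every partial assignment by one arc.\<close>

lemma dst_of_path:
  assumes V: "V \<noteq> []" "fst (V ! 0) = 0" and S: "S \<subseteq> {..<length V}"
    and t: "t < length V" "is_terminal (V ! t)"
  shows "(\<exists>p. pre_digraph.apath (with_proj (dst_graph (dst_of V k)) \<restriction> (S \<union> dst_terminals (dst_of V k) \<union> {0})) 0 p t)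
    \<longleftrightarrow> (\<exists>u\<in>S. fst (V ! u) = 1 \<and> adjacent (V ! u) (V ! t))" (is "?L \<longleftrightarrow> ?R")
proof
  let ?X = "S \<union> dst_terminals (dst_of V k) \<union> {0}"
  let ?G = "with_proj (dst_graph (dst_of V k)) \<restriction> ?X"
  have t0: "t \<noteq> 0"
  proof
    assume "t = 0"
    then show False using V t by (auto simp: is_terminal_def)
  qed
  {
    assume ?L
    then obtain p where p: "set p \<subseteq> arcs ?G" "pre_digraph.cas ?G 0 p t"
      unfolding pre_digraph.apath_def pre_digraph.awalk_def by blast
    have "\<exists>e\<in>set p. head ?G e = t" if "pre_digraph.cas ?G a p t" "a \<noteq> t" for a
      using that
    proof (induction p arbitrary: a)
      case (Cons e es)
      then show ?case by (cases "head ?G e = t") (auto simp: pre_digraph.cas.simps)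
    qed (simp add: pre_digraph.cas.simps)
    then obtain e where e: "e \<in> set p" "head ?G e = t" using p(2) t0 by blast
    obtain u where u: "e = (u, t)" using e(2) by (cases e) simp
    then have "u \<in> ?X" "adjacent (V ! u) (V ! t)" using p(1) e(1) by auto
    then show ?R using t V by (auto simp: adjacent_def is_terminal_def)
  }
  {
    assume ?R
    then obtain u where u: "u \<in> S" "fst (V ! u) = 1" "adjacent (V ! u) (V ! t)" by blast
    have "u \<noteq> 0" using u(2) V(2) by (metis zero_neq_one)
    moreover have "u \<noteq> t" using u(3) not_adjacent_refl by metis
    moreover have "adjacent (V ! 0) (V ! u)" using u V by (auto simp: adjacent_def)
    ultimately have "pre_digraph.apath ?G 0 [(0, u), (u, t)] t"
      unfolding pre_digraph.apath_def pre_digraph.awalk_def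
      using u V S t t0 by (auto simp: pre_digraph.cas.simps pre_digraph.awalk_verts.simps)
    then show ?L by blast
  }
qed

lemma dst_of_yes:
  assumes V: "V \<noteq> []" "fst (V ! 0) = 0"
  shows "dst_yes (dst_of V k) \<longleftrightarrow> (\<exists>S \<subseteq> {i. i < length V \<and> \<not> is_terminal (V ! i) \<and> i \<noteq> 0}. card S \<le> k \<and>
    (\<forall>t<length V. is_terminal (V ! t) \<longrightarrow> (\<exists>u\<in>S. fst (V ! u) = 1 \<and> adjacent (V ! u) (V ! t))))"
proof -
  have e: "pverts (dst_graph (dst_of V k)) - (dst_terminals (dst_of V k) \<union> {dst_root (dst_of V k)}) =
      {i. i < length V \<and> \<not> is_terminal (V ! i) \<and> i \<noteq> 0}" (is "_ = ?M") by auto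
  have p: "(\<forall>t\<in>dst_terminals (dst_of V k). \<exists>p. pre_digraph.apath (with_proj (dst_graph (dst_of V k)) \<restriction>
       (S \<union> dst_terminals (dst_of V k) \<union> {dst_root (dst_of V k)})) (dst_root (dst_of V k)) p t) \<longleftrightarrow>
     (\<forall>t<length V. is_terminal (V ! t) \<longrightarrow> (\<exists>u\<in>S. fst (V ! u) = 1 \<and> adjacent (V ! u) (V ! t)))" if "S \<subseteq> ?M" for S
  proof -
    have "S \<subseteq> {..<length V}" using that by auto
    from dst_of_path[OF V this, of _ k] show ?thesis unfolding dst_of_simps(3) by auto
  qed
  show ?thesis unfolding dst_yes_def e dst_of_simps(5)
    by (rule ex_cong1, rule conj_cong[OF refl], rule conj_cong[OF refl], rule p)
qed

text \<open>A subgraph with a vertex of kind 1 has degree at most \<open>d\<close> there; one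
  without such a vertex has no arcs, and every vertex of it has degree 0.\<close>

lemma dst_of_degeneracy:
  assumes "\<And>v. v \<in> set V \<Longrightarrow> fst v = 1 \<Longrightarrow> length (filter (\<lambda>w. adjacent v w \<or> adjacent w v) V) \<le> d"
  shows "degeneracy (with_proj (dst_graph (dst_of V k))) \<le> d"
  unfolding degeneracy_def
proof (rule Least_le, intro allI impI, elim conjE)
  let ?G = "with_proj (dst_graph (dst_of V k))"
  fix H assume H: "subgraph H (with_proj (mk_symmetric ?G))" "symmetric H" "verts H \<noteq> {}"
  have arcs: "arcs H \<subseteq> {(i, j). i < length V \<and> j < length V \<and> (adjacent (V ! i) (V ! j) \<or> adjacent (V ! j) (V ! i))}"
    and verts: "verts H \<subseteq> {..<length V}" and ends: "tail H = fst" "head H = snd" and wf: "wf_digraph H"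
    using H(1) by (auto simp: subgraph_def compatible_def parcs_mk_symmetric)
  show "\<exists>v\<in>verts H. out_degree H v \<le> d"
  proof (cases "\<exists>v\<in>verts H. fst (V ! v) = 1")
    case True
    then obtain v where v: "v \<in> verts H" "fst (V ! v) = 1" by blast
    let ?J = "{j. j < length V \<and> (adjacent (V ! v) (V ! j) \<or> adjacent (V ! j) (V ! v))}"
    have "out_arcs H v \<subseteq> (\<lambda>j. (v, j)) ` ?J" using arcs ends by (auto simp: out_arcs_def)
    then have "out_degree H v \<le> card ?J" unfolding out_degree_def by (rule surj_card_le[rotated]) simp
    also have "card ?J = length (filter (\<lambda>w. adjacent (V ! v) w \<or> adjacent w (V ! v)) V)"
      by (simp add: length_filter_conv_card)
    also have "\<dots> \<le> d" using assms[of "V ! v"] v verts by auto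
    finally show ?thesis using v by blast
  next
    case False
    have no: "arcs H = {}"
    proof (rule ccontr)
      assume "arcs H \<noteq> {}"
      then obtain i j where ij: "(i, j) \<in> arcs H" by auto
      have "i \<in> verts H" "j \<in> verts H"
        using wf_digraph.tail_in_verts[OF wf ij] wf_digraph.head_in_verts[OF wf ij] ends by auto
      then have "fst (V ! i) \<noteq> 1" "fst (V ! j) \<noteq> 1" using False by auto
      moreover have "adjacent (V ! i) (V ! j) \<or> adjacent (V ! j) (V ! i)" using arcs ij by auto
      ultimately show False by (auto simp: adjacent_def)
    qed
    obtain v where "v \<in> verts H" using H(3) by blast
    moreover have "out_degree H v = 0" for v using no by (simp add: out_degree_def out_arcs_def)
    ultimately show ?thesis by (metis le0)
  qed
qed

section \<open>From sparse formulas to Directed Steiner Tree\<close>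

definition literal_of :: "(nat \<Rightarrow> bool) \<Rightarrow> nat \<Rightarrow> nat" where
  "literal_of \<alpha> v = (if \<alpha> v then v + v else Suc (v + v))"

lemma literal_of_div [simp]: "literal_of \<alpha> v div 2 = v"
  by (auto simp: literal_of_def)

lemma lit_holds_literal_of: "lit_holds \<alpha> l \<longleftrightarrow> l = literal_of \<alpha> (l div 2)"
  unfolding lit_holds_def literal_of_def by (cases "\<alpha> (l div 2)"; simp; presburger)

text \<open>Doubling stops at \<open>cap\<close>, which keeps the length polynomial in the fuel for
  every argument. The truncated lists are meaningless, but they arise only where
  \<open>solve_leaf\<close> refuses to evaluate the instance.\<close>

definition assignments :: "nat \<Rightarrow> nat list \<Rightarrow> nat list list" where
  "assignments cap vs = foldr (\<lambda>v acc. if length acc + length acc \<le> cap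
     then map (\<lambda>A. (v + v) # A) acc @ map (\<lambda>A. Suc (v + v) # A) acc else acc) vs [[]]"

lemma assignments_Nil: "assignments cap [] = [[]]"
  by (simp add: assignments_def)

lemma assignments_Cons:
  "assignments cap (v # vs) = (if 2 * length (assignments cap vs) \<le> cap
     then map (\<lambda>A. (v + v) # A) (assignments cap vs) @ map (\<lambda>A. Suc (v + v) # A) (assignments cap vs)
     else assignments cap vs)"
  by (simp add: assignments_def mult_2)

lemma assignments:
  assumes "2 ^ length vs \<le> cap" "distinct vs"
  shows "length (assignments cap vs) = 2 ^ length vs \<and> set (assignments cap vs) = range (\<lambda>\<alpha>. map (literal_of \<alpha>) vs)"
  using assms
proof (induction vs)
  case Nil
  then show ?case by (auto simp: assignments_Nil)
next
  case (Cons v vs)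
  have IH: "length (assignments cap vs) = 2 ^ length vs" "set (assignments cap vs) = range (\<lambda>\<alpha>. map (literal_of \<alpha>) vs)"
    using Cons by auto
  have ext: "\<exists>\<beta>. map (literal_of \<beta>) (v # vs) = literal_of (\<lambda>_. b) v # map (literal_of \<alpha>) vs" for \<alpha> b
    using Cons.prems(2) by (intro exI[of _ "\<alpha>(v := b)"]) (auto simp: literal_of_def)
  have "set (assignments cap (v # vs)) = (\<Union>b\<in>{True, False}. (#) (literal_of (\<lambda>_. b) v) ` range (\<lambda>\<alpha>. map (literal_of \<alpha>) vs))"
    using Cons.prems IH by (auto simp: assignments_Cons literal_of_def)
  also have "\<dots> = range (\<lambda>\<alpha>. map (literal_of \<alpha>) (v # vs))"
  proof (intro set_eqI iffI)
    fix A assume "A \<in> (\<Union>b\<in>{True, False}. (#) (literal_of (\<lambda>_. b) v) ` range (\<lambda>\<alpha>. map (literal_of \<alpha>) vs))"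
    then obtain b \<alpha> where "A = literal_of (\<lambda>_. b) v # map (literal_of \<alpha>) vs" by auto
    then show "A \<in> range (\<lambda>\<alpha>. map (literal_of \<alpha>) (v # vs))" using ext[of b \<alpha>] by (metis rangeI)
  next
    fix A assume "A \<in> range (\<lambda>\<alpha>. map (literal_of \<alpha>) (v # vs))"
    then obtain \<alpha> where A: "A = map (literal_of \<alpha>) (v # vs)" by auto
    have "literal_of \<alpha> v = literal_of (\<lambda>_. \<alpha> v) v" by (simp add: literal_of_def)
    then show "A \<in> (\<Union>b\<in>{True, False}. (#) (literal_of (\<lambda>_. b) v) ` range (\<lambda>\<alpha>. map (literal_of \<alpha>) vs))"
      unfolding A by (cases "\<alpha> v") auto
  qed
  finally show ?case using Cons.prems IH by (simp add: assignments_Cons)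
qed

text \<open>Comparisons with block boundaries replace the condition \<open>v div s = g\<close>
  (\<open>in_var_group\<close>), because the machine does not divide.\<close>

definition var_group :: "nat \<Rightarrow> nat \<Rightarrow> nat \<Rightarrow> nat list" where
  "var_group n s g = filter (\<lambda>v. g * s \<le> v \<and> v < g * s + s) [0..<n]"

lemma distinct_var_group: "distinct (var_group n s g)"
  by (simp add: var_group_def)

lemma length_var_group: "length (var_group n s g) \<le> s"
proof -
  have "length (var_group n s g) = card (set (var_group n s g))" by (rule distinct_card[OF distinct_var_group, symmetric])
  also have "\<dots> \<le> card {g * s..<g * s + s}" by (rule card_mono) (auto simp: var_group_def)
  finally show ?thesis by simp
qed

lemma in_var_group: "v \<in> set (var_group n s g) \<longleftrightarrow> v < n \<and> s > 0 \<and> v div s = g"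
proof (cases "s = 0")
  case False
  then have "(g * s \<le> v \<and> v < g * s + s) = (v div s = g)"
    by (metis add.commute div_nat_eqI dividend_less_times_div mult.commute mult_Suc neq0_conv times_div_less_eq_dividend)
  then show ?thesis using False by (auto simp: var_group_def)
qed (auto simp: var_group_def)

definition vertices :: "nat \<Rightarrow> nat \<Rightarrow> nat \<Rightarrow> nat \<Rightarrow> formula \<Rightarrow> nat \<Rightarrow> vertex list" where
  "vertices cap n k s F pad = (0, 0, []) #
     concat (map (\<lambda>g. map (\<lambda>A. (1, g, A)) (assignments cap (var_group n s g))) [0..<k]) @
     map (\<lambda>g. (2, g, [])) [0..<k] @ map (\<lambda>C. (3, 0, C)) F @ map (\<lambda>_. (4, 0, [])) [0..<pad]"

lemma vertices_root: "vertices cap n k s F pad \<noteq> []" "fst (vertices cap n k s F pad ! 0) = 0"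
  by (simp_all add: vertices_def)

text \<open>Each of the \<open>k\<close> group terminals needs a chosen partial assignment of its
  own group, so a budget of \<open>k\<close> forces exactly one per group. Together they are a total
  assignment, since \<open>n \<le> k * s\<close> puts every variable into some group, and the clause
  terminals check that it satisfies every clause.\<close>

lemma vertices_correct:
  assumes cap: "2 ^ s \<le> cap" and nk: "n \<le> k * s" and F: "sorted_clauses (2 * n) F"
  shows "dst_yes (dst_of (vertices cap n k s F pad) k) \<longleftrightarrow> (\<exists>\<alpha>. models \<alpha> (family F))"
proof -
  define V where "V = vertices cap n k s F pad"
  note V0 = vertices_root[of cap n k s F pad, folded V_def]
  have "2 ^ length (var_group n s g) \<le> cap" for g
    by (rule order_trans[OF power_increasing[OF length_var_group] cap]) simp
  then have asg: "set (assignments cap (var_group n s g)) = range (\<lambda>\<alpha>. map (literal_of \<alpha>) (var_group n s g))" for g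
    using assignments[OF _ distinct_var_group] by blast
  have setV: "set V = {(0, 0, [])} \<union> {(1, g, map (literal_of \<alpha>) (var_group n s g)) | g \<alpha>. g < k} \<union>
      {(2, g, []) | g. g < k} \<union> {(3, 0, C) | C. C \<in> set F} \<union> {v. v = (4, 0, []) \<and> pad > 0}"
    unfolding V_def vertices_def by (auto simp: asg image_iff)
  have grp: "\<exists>g<k. v \<in> set (var_group n s g)" if "v < n" for v
  proof -
    have "s > 0" using that nk by (cases s) auto
    then have "v div s < k" using that nk by (simp add: less_mult_imp_div_less)
    then show ?thesis using that \<open>s > 0\<close> by (auto simp: in_var_group)
  qed
  show ?thesis unfolding V_def[symmetric] dst_of_yes[OF V0]
  proof
    assume "\<exists>S\<subseteq>{i. i < length V \<and> \<not> is_terminal (V ! i) \<and> i \<noteq> 0}. card S \<le> k \<and>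
      (\<forall>t<length V. is_terminal (V ! t) \<longrightarrow> (\<exists>u\<in>S. fst (V ! u) = 1 \<and> adjacent (V ! u) (V ! t)))"
    then obtain S where S: "S \<subseteq> {..<length V}" "card S \<le> k"
      and cov: "\<And>t. t < length V \<Longrightarrow> is_terminal (V ! t) \<Longrightarrow> \<exists>u\<in>S. fst (V ! u) = 1 \<and> adjacent (V ! u) (V ! t)"
      by blast
    have finS: "finite S" using S(1) finite_subset by blast
    have "\<exists>u\<in>S. fst (V ! u) = 1 \<and> fst (snd (V ! u)) = g" if g: "g < k" for g
    proof -
      have "(2, g, []) \<in> set V" using g setV by auto
      then obtain t where t: "t < length V" "V ! t = (2, g, [])" by (auto simp: in_set_conv_nth)
      from cov[of t] t obtain u where "u \<in> S" "fst (V ! u) = 1" "adjacent (V ! u) (2, g, [])" by (auto simp: is_terminal_def)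
      then show ?thesis by (auto simp: adjacent_def)
    qed
    then obtain \<sigma> where \<sigma>: "\<And>g. g < k \<Longrightarrow> \<sigma> g \<in> S \<and> fst (V ! \<sigma> g) = 1 \<and> fst (snd (V ! \<sigma> g)) = g" by metis
    \<comment> \<open>Vertices chosen for different groups differ, so they use up the budget and
      \<open>S\<close> contains nothing else.\<close>
    have "inj_on \<sigma> {..<k}" using \<sigma> by (metis inj_onI lessThan_iff)
    then have "card (\<sigma> ` {..<k}) = k" by (simp add: card_image)
    then have SS: "\<sigma> ` {..<k} = S" using \<sigma> S(2) finS by (intro card_seteq) auto
    \<comment> \<open>Every variable has a single group, so the chosen partial assignments glue
      together: \<open>v\<close> is true if its positive literal \<open>v + v\<close> occurs in the
      one chosen for its group.\<close>
    define \<alpha> where "\<alpha> v = (v + v \<in> set (snd (snd (V ! \<sigma> (v div s)))))" for v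
    have "\<exists>l\<in>set C. lit_holds \<alpha> l" if C: "C \<in> set F" for C
    proof -
      have "(3, 0, C) \<in> set V" using C setV by auto
      then obtain t where t: "t < length V" "V ! t = (3, 0, C)" by (auto simp: in_set_conv_nth)
      from cov[of t] t obtain u where u: "u \<in> S" "fst (V ! u) = 1" "adjacent (V ! u) (3, 0, C)" by (auto simp: is_terminal_def)
      then obtain g where g: "g < k" "u = \<sigma> g" using SS by auto
      obtain l where l: "l \<in> set (snd (snd (V ! u)))" "l \<in> set C" using u(2,3) by (auto simp: adjacent_def)
      have "V ! u \<in> set V" using u(1) S(1) by auto
      then obtain \<beta> g' where b: "V ! u = (1, g', map (literal_of \<beta>) (var_group n s g'))" using setV u(2) by auto
      then have g': "g' = g" using \<sigma>[OF g(1)] g(2) by simp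
      obtain v where v: "v \<in> set (var_group n s g)" "l = literal_of \<beta> v" using l(1) b g' by auto
      have vs: "v div s = g" using v(1) by (simp add: in_var_group)
      have "\<alpha> v = (v + v \<in> literal_of \<beta> ` set (var_group n s g))" unfolding \<alpha>_def vs g(2)[symmetric] b g' by simp
      also have "\<dots> = \<beta> v"
      proof
        assume "v + v \<in> literal_of \<beta> ` set (var_group n s g)"
        then obtain w where w: "v + v = literal_of \<beta> w" by auto
        show "\<beta> v"
        proof (cases "\<beta> w")
          case True
          then have "v = w" using w by (simp add: literal_of_def)
          then show ?thesis using True by simp
        next
          case False
          then have "v + v = Suc (w + w)" using w by (simp add: literal_of_def)
          then have False by presburger
          then show ?thesis ..
        qed
      next
        assume "\<beta> v"
        then have "v + v = literal_of \<beta> v" by (simp add: literal_of_def)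
        then show "v + v \<in> literal_of \<beta> ` set (var_group n s g)" using v(1) by blast
      qed
      finally have "l = literal_of \<alpha> v" using v(2) by (simp add: literal_of_def)
      then have "lit_holds \<alpha> l" by (simp add: lit_holds_literal_of)
      then show ?thesis using l(2) by blast
    qed
    then show "\<exists>\<alpha>. models \<alpha> (family F)" by (auto simp: models_def family_def)
  next
    assume "\<exists>\<alpha>. models \<alpha> (family F)"
    then obtain \<alpha> where \<alpha>: "\<And>C. C \<in> set F \<Longrightarrow> \<exists>l\<in>set C. lit_holds \<alpha> l" by (auto simp: models_def family_def)
    let ?v = "\<lambda>g. (1, g, map (literal_of \<alpha>) (var_group n s g)) :: vertex"
    have "\<exists>i<length V. V ! i = ?v g" if "g < k" for g
    proof -
      have "?v g \<in> set V" using that setV by auto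
      then show ?thesis by (auto simp: in_set_conv_nth)
    qed
    then obtain \<iota> where \<iota>: "\<And>g. g < k \<Longrightarrow> \<iota> g < length V \<and> V ! \<iota> g = ?v g" by metis
    let ?S = "\<iota> ` {..<k}"
    have "?S \<subseteq> {i. i < length V \<and> \<not> is_terminal (V ! i) \<and> i \<noteq> 0}"
    proof
      fix i assume "i \<in> ?S"
      then obtain g where g: "g < k" "i = \<iota> g" by auto
      then have "fst (V ! i) = 1" "i < length V" using \<iota>[OF g(1)] by auto
      moreover from this have "i \<noteq> 0" using V0(2) by (metis zero_neq_one)
      ultimately show "i \<in> {i. i < length V \<and> \<not> is_terminal (V ! i) \<and> i \<noteq> 0}" by (auto simp: is_terminal_def)
    qed
    moreover have "card ?S \<le> k" using card_image_le[of "{..<k}" \<iota>] by simp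
    moreover have "\<exists>u\<in>?S. fst (V ! u) = 1 \<and> adjacent (V ! u) (V ! t)" if t: "t < length V" "is_terminal (V ! t)" for t
    proof -
      have "V ! t \<in> set V" using t by simp
      then consider g where "g < k" "V ! t = (2, g, [])" | C where "C \<in> set F" "V ! t = (3, 0, C)"
        using t(2) setV by (auto simp: is_terminal_def)
      then show ?thesis
      proof cases
        case 1
        then show ?thesis using \<iota>[OF 1(1)] by (intro bexI[of _ "\<iota> g"]) (auto simp: adjacent_def)
      next
        case 2
        obtain l where l: "l \<in> set C" "lit_holds \<alpha> l" using \<alpha>[OF 2(1)] by blast
        have "l < 2 * n" using F 2(1) l(1) by (auto simp: sorted_clauses_def)
        then have "l div 2 < n" by (simp add: less_mult_imp_div_less)
        then obtain g where g: "g < k" "l div 2 \<in> set (var_group n s g)" using grp by blast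
        have "l \<in> literal_of \<alpha> ` set (var_group n s g)" using l(2) g(2) unfolding lit_holds_literal_of by blast
        then show ?thesis using \<iota>[OF g(1)] g(1) 2(2) l(1) by (intro bexI[of _ "\<iota> g"]) (auto simp: adjacent_def)
      qed
    qed
    ultimately show "\<exists>S\<subseteq>{i. i < length V \<and> \<not> is_terminal (V ! i) \<and> i \<noteq> 0}. card S \<le> k \<and>
      (\<forall>t<length V. is_terminal (V ! t) \<longrightarrow> (\<exists>u\<in>S. fst (V ! u) = 1 \<and> adjacent (V ! u) (V ! t)))" by blast
  qed
qed

lemma length_filter_Bex:
  assumes "\<And>l. length (filter (\<lambda>C. l \<in> set C) F) \<le> B"
  shows "length (filter (\<lambda>C. \<exists>l\<in>set A. l \<in> set C) F) \<le> length A * B"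
proof (induction A)
  case (Cons a A)
  have "length (filter (\<lambda>C. P C \<or> Q C) F) \<le> length (filter P F) + length (filter Q F)" for P Q
    by (induction F) auto
  from this[of "\<lambda>C. a \<in> set C" "\<lambda>C. \<exists>l\<in>set A. l \<in> set C"] show ?case
    using Cons assms[of a] by simp
qed simp

text \<open>A partial assignment is adjacent to the root, to its group terminal and, for each of its
  at most \<open>s\<close> literals, to at most \<open>B\<close> clauses.\<close>

lemma vertices_degeneracy:
  assumes cap: "2 ^ s \<le> cap" and occ: "\<And>l. length (filter (\<lambda>C. l \<in> set C) F) \<le> B"
  shows "degeneracy (with_proj (dst_graph (dst_of (vertices cap n k s F pad) k'))) \<le> 2 + s * B"
proof (rule dst_of_degeneracy)
  fix u assume u: "u \<in> set (vertices cap n k s F pad)" "fst u = 1"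
  then obtain g A where A: "u = (1, g, A)" "A \<in> set (assignments cap (var_group n s g))" by (auto simp: vertices_def)
  have "2 ^ length (var_group n s g) \<le> cap"
    by (rule order_trans[OF power_increasing[OF length_var_group] cap]) simp
  then have lA: "length A \<le> s" using assignments[OF _ distinct_var_group, of n s g cap] A(2) length_var_group[of n s g] by auto
  let ?P = "\<lambda>w. adjacent u w \<or> adjacent w u"
  have 1: "filter ?P (concat (map (\<lambda>g. map (\<lambda>A. (1, g, A)) (assignments cap (var_group n s g))) [0..<k])) = []"
    by (auto simp: filter_empty_conv adjacent_def A)
  have 2: "filter ?P (map (\<lambda>_. (4, 0, [])) [0..<pad]) = []"
    by (auto simp: filter_empty_conv adjacent_def A)
  have "filter ?P (map (\<lambda>g. (2, g, [])) [0..<k]) = map (\<lambda>g. (2, g, [])) (filter (\<lambda>g'. g' = g) [0..<k])"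
    unfolding filter_map o_def by (rule arg_cong[where f = "map _"], rule filter_cong) (auto simp: adjacent_def A)
  moreover have "length (filter (\<lambda>g'. g' = g) [0..<k]) = card (set (filter (\<lambda>g'. g' = g) [0..<k]))"
    by (rule distinct_card[symmetric]) simp
  moreover have "\<dots> \<le> card {g}" by (rule card_mono) auto
  ultimately have 3: "length (filter ?P (map (\<lambda>g. (2, g, [])) [0..<k])) \<le> 1" by simp
  have "filter ?P (map (\<lambda>C. (3, 0, C)) F) = map (\<lambda>C. (3, 0, C)) (filter (\<lambda>C. \<exists>l\<in>set A. l \<in> set C) F)"
    unfolding filter_map o_def by (rule arg_cong[where f = "map _"], rule filter_cong) (auto simp: adjacent_def A)
  then have "length (filter ?P (map (\<lambda>C. (3, 0, C)) F)) \<le> length A * B" using length_filter_Bex[OF occ, of A] by simp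
  also have "\<dots> \<le> s * B" using lA by simp
  finally have 4: "length (filter ?P (map (\<lambda>C. (3, 0, C)) F)) \<le> s * B" .
  have "length (filter ?P [(0, 0, [])]) \<le> 1" by simp
  then show "length (filter ?P (vertices cap n k s F pad)) \<le> 2 + s * B"
    unfolding vertices_def using 1 2 3 4 by simp
qed

lemma length_vertices:
  assumes cap: "2 ^ s \<le> cap"
  shows "length (vertices cap n k s F pad) \<le> 1 + k * 2 ^ s + k + length F + pad"
    and "pad \<le> length (vertices cap n k s F pad)"
proof -
  have "length (assignments cap (var_group n s g)) \<le> 2 ^ s" for g
  proof -
    have "2 ^ length (var_group n s g) \<le> (2 :: nat) ^ s" by (rule power_increasing[OF length_var_group]) simp
    then show ?thesis using assignments[OF order_trans[OF _ cap] distinct_var_group] by simp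
  qed
  then have "(\<Sum>g\<leftarrow>[0..<k]. length (assignments cap (var_group n s g))) \<le> (\<Sum>g\<leftarrow>[0..<k]. 2 ^ s)"
    by (rule sum_list_mono)
  then show "length (vertices cap n k s F pad) \<le> 1 + k * 2 ^ s + k + length F + pad"
    by (simp add: vertices_def length_concat o_def sum_list_triv)
qed (simp add: vertices_def)

section \<open>The algorithm for 3-SAT\<close>

text \<open>The ceiling of \<open>n / k\<close>, obtained by counting instead of dividing.\<close>

definition group_size :: "nat \<Rightarrow> nat \<Rightarrow> nat" where
  "group_size n k = length (filter (\<lambda>j. k * j < n) [0..<n])"

lemma group_size: assumes "k > 0" shows "group_size n k = (n + k - 1) div k"
proof -
  have "set (filter (\<lambda>j. k * j < n) [0..<n]) = {..<(n + k - 1) div k}"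
  proof (intro set_eqI)
    fix j
    have "j < (n + k - 1) div k \<longleftrightarrow> Suc j * k \<le> n + k - 1"
      using assms by (simp add: Suc_le_eq[symmetric] less_eq_div_iff_mult_less_eq)
    also have "\<dots> \<longleftrightarrow> k * j < n" using assms by (auto simp: mult.commute)
    finally have e: "j < (n + k - 1) div k \<longleftrightarrow> k * j < n" .
    have "j \<le> k * j" using assms by simp
    then have "k * j < n \<Longrightarrow> j < n" by (rule le_less_trans)
    then show "j \<in> set (filter (\<lambda>j. k * j < n) [0..<n]) \<longleftrightarrow> j \<in> {..<(n + k - 1) div k}" using e by auto
  qed
  then have "card (set (filter (\<lambda>j. k * j < n) [0..<n])) = (n + k - 1) div k" by simp
  moreover have "length (filter (\<lambda>j. k * j < n) [0..<n]) = card (set (filter (\<lambda>j. k * j < n) [0..<n]))"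
    by (rule distinct_card[symmetric]) simp
  ultimately show ?thesis by (simp add: group_size_def)
qed

lemma group_size_bounds:
  assumes "k > 0" shows "n \<le> k * group_size n k" "real (group_size n k) \<le> real n / real k + 1"
proof -
  let ?d = "(n + k - 1) div k"
  have a: "?d * k + (n + k - 1) mod k = n + k - 1" by (rule div_mult_mod_eq)
  have "(n + k - 1) mod k < k" using assms by simp
  then have "n \<le> ?d * k" using a assms by linarith
  then show "n \<le> k * group_size n k" unfolding group_size[OF assms] by (simp only: mult.commute)
  have "?d * k \<le> n + k" using a by linarith
  then have "real (?d * k) \<le> real (n + k)" by (rule of_nat_mono)
  then show "real (group_size n k) \<le> real n / real k + 1"
    unfolding group_size[OF assms] using assms by (simp add: field_simps)
qed

text \<open>With the cap \<open>Suc i\<close>, the result is at most \<open>i\<close> iff the true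
  power is, and then it is exact. Whether an exponential quantity fits into the fuel is thus decided
  without computing it.\<close>

definition capped_power :: "nat \<Rightarrow> nat \<Rightarrow> nat" where
  "capped_power e cap = ((\<lambda>x. min (x + x) cap) ^^ e) 1"

lemma capped_power: "cap > 0 \<Longrightarrow> capped_power e cap = min (2 ^ e) cap"
  unfolding capped_power_def by (induction e) auto

text \<open>\<open>M\<close> times the degeneracy bound of \<open>vertices_degeneracy\<close>, with
  the occurrence bound of \<open>leaf_occurrences\<close> for \<open>B\<close>. Padding to the order
  \<open>2 ^ leaf_exponent\<close> lifts \<open>c\<close> log N to at least that degeneracy, because
  \<open>1 \<le> c * M\<close>.\<close>

definition leaf_exponent :: "nat \<Rightarrow> nat \<Rightarrow> nat \<Rightarrow> nat \<Rightarrow> nat" where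
  "leaf_exponent M D k n = M * (2 + group_size n k * (1 + D + 2 * D * D))"

definition leaf_vertices :: "nat \<Rightarrow> nat \<Rightarrow> nat \<Rightarrow> nat \<Rightarrow> nat \<Rightarrow> formula \<Rightarrow> vertex list" where
  "leaf_vertices M i D k n F =
     vertices i n k (group_size n k) F (capped_power (leaf_exponent M D k n) (Suc i))"

definition solve_leaf :: "program \<Rightarrow> nat \<Rightarrow> nat \<Rightarrow> nat \<Rightarrow> nat \<Rightarrow> nat \<Rightarrow> formula \<Rightarrow> nat" where
  "solve_leaf p M i D k n F = (if capped_power (leaf_exponent M D k n) (Suc i) \<le> i
     then sim_result p i (encode_vertices (leaf_vertices M i D k n F) k) else 0)"

text \<open>The state is a stack of formulas, the disjunction of which remains to be decided, and a flag:
  0 while searching, 1 if the fuel did not suffice, 2 if a satisfiable formula was found.\<close>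

definition work_step :: "program \<Rightarrow> nat \<Rightarrow> nat \<Rightarrow> nat \<Rightarrow> nat \<Rightarrow> nat \<Rightarrow> formula list \<times> nat \<Rightarrow> formula list \<times> nat" where
  "work_step p M i D k n st = (if snd st \<noteq> 0 then st else case fst st of [] \<Rightarrow> st | F # Fs \<Rightarrow>
     (case applicable D (2 * n) F of
        [] \<Rightarrow> (Fs, if solve_leaf p M i D k n F = 0 then 1 else if solve_leaf p M i D k n F = 1 then 0 else 2)
      | r # rs \<Rightarrow> (reduce (fst (snd r) # F) # reduce (petals (fst r) (fst (snd r)) F @ F) # Fs, 0)))"

definition work :: "program \<Rightarrow> nat \<Rightarrow> nat \<Rightarrow> nat \<Rightarrow> nat \<Rightarrow> nat \<Rightarrow> formula \<Rightarrow> formula list \<times> nat" where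
  "work p M i D k n G = (work_step p M i D k n ^^ i) ([normal_form (2 * n) G], 0)"

definition attempt :: "program \<Rightarrow> nat \<Rightarrow> nat \<Rightarrow> nat \<Rightarrow> nat \<Rightarrow> nat \<Rightarrow> formula \<Rightarrow> nat" where
  "attempt p M i D k n G = (if snd (work p M i D k n G) = 2 then 2
     else if snd (work p M i D k n G) = 0 then (case fst (work p M i D k n G) of [] \<Rightarrow> 1 | _ # _ \<Rightarrow> 0) else 0)"

text \<open>The state holds the number of literals still to be read, the current clause and the
  finished clauses; when that number is 0, the next entry is a clause length. Prepending reverses
  the clauses and their order, which does not affect satisfiability.\<close>

definition parse_step :: "nat \<times> nat list \<times> formula \<Rightarrow> nat \<Rightarrow> nat \<times> nat list \<times> formula" where
  "parse_step st y = (if fst st = 0 then (if y = 0 then (0, [], [] # snd (snd st)) else (y, [], snd (snd st)))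
     else if fst st = 1 then (0, [], (y # fst (snd st)) # snd (snd st))
     else (fst st - 1, y # fst (snd st), snd (snd st)))"

definition parse_clauses :: "nat list \<Rightarrow> formula" where
  "parse_clauses ys = snd (snd (foldl parse_step (0, [], []) ys))"

text \<open>Only squares are tried as thresholds: \<open>growth_ineq\<close> balances the two
  decrements for \<open>D = E * E\<close>.\<close>

definition attempts :: "program \<Rightarrow> nat \<Rightarrow> nat \<Rightarrow> nat \<Rightarrow> formula \<Rightarrow> nat list" where
  "attempts p M i n G = concat (map (\<lambda>E. map (\<lambda>k. attempt p M i (Suc E * Suc E) (Suc k) n G) [0..<i]) [0..<i])"

definition sat_search :: "program \<Rightarrow> nat \<Rightarrow> nat \<times> nat list \<Rightarrow> nat" where
  "sat_search p M x = (case snd x of [] \<Rightarrow> 0 | n # ys \<Rightarrow> (case ys of [] \<Rightarrow> 0 | _ # zs \<Rightarrow>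
     (if \<exists>r\<in>set (attempts p M (fst x) n (parse_clauses zs)). r = 2 then 2
      else if \<exists>r\<in>set (attempts p M (fst x) n (parse_clauses zs)). r = 1 then 1 else 0)))"

section \<open>The algorithm takes polynomial time in its fuel\<close>

lemmas PT_intros = PT_id PT_pair PT_Cons PT_Nil PT_nat PT_bool PT_if PT_conj PT_disj PT_not PT_le PT_less PT_eq
  PT_add PT_sub PT_mult PT_Suc PT_upt PT_map PT_filter PT_concat PT_append PT_length PT_all PT_ex PT_mem
  PT_fst PT_snd PT_min PT_case_list

lemma PT_comp3:
  assumes "PT (\<lambda>p. h (fst p) (fst (snd p)) (snd (snd p)))" "PT a" "PT b" "PT c"
  shows "PT (\<lambda>x. h (a x) (b x) (c x))"
  using PT_comp[OF assms(1) PT_pair[OF assms(2) PT_pair[OF assms(3,4)]]] by simp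

lemma PT_comp5:
  assumes "PT (\<lambda>p. h (fst p) (fst (snd p)) (fst (snd (snd p))) (fst (snd (snd (snd p)))) (snd (snd (snd (snd p)))))"
    "PT a" "PT b" "PT c" "PT d" "PT e"
  shows "PT (\<lambda>x. h (a x) (b x) (c x) (d x) (e x))"
  using PT_comp[OF assms(1) PT_pair[OF assms(2) PT_pair[OF assms(3) PT_pair[OF assms(4) PT_pair[OF assms(5,6)]]]]] by simp

lemma PT_group_size: "PT a \<Longrightarrow> PT b \<Longrightarrow> PT (\<lambda>x. group_size (a x) (b x))"
  by (rule PT_comp2, unfold group_size_def) (intro PT_intros | assumption)+

lemma PT_capped_power: assumes "PT a" "PT b" shows "PT (\<lambda>x. capped_power (a x) (b x))"
proof (rule PT_comp2[OF _ assms])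
  show "PT (\<lambda>p. capped_power (fst p) (snd p))"
    unfolding capped_power_def
  proof (rule PT_iter[where q = "\<lambda>x. x + 1"])
    have b: "((\<lambda>x. min (x + x) b) ^^ j) 1 \<le> b + 1" for j b :: nat by (cases j) auto
    fix p :: "nat \<times> nat" and j
    have "snd p \<le> psize p" by (simp add: psize_prod_def psize_nat_def)
    then show "psize (((\<lambda>x. min (x + x) (snd p)) ^^ j) 1) \<le> psize p + 1"
      using b[where j = j and b = "snd p"] unfolding psize_nat_def by linarith
  qed (intro PT_intros polyb_intros)+
qed

lemma PT_leaf_exponent: "PT a \<Longrightarrow> PT b \<Longrightarrow> PT c \<Longrightarrow> PT (\<lambda>x. leaf_exponent M (a x) (b x) (c x))"
  unfolding leaf_exponent_def by (intro PT_intros PT_group_size)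

lemma PT_var_group: "PT a \<Longrightarrow> PT b \<Longrightarrow> PT c \<Longrightarrow> PT (\<lambda>x. var_group (a x) (b x) (c x))"
  by (rule PT_comp3, unfold var_group_def) (intro PT_intros | assumption)+

lemma assignments_size:
  "length (assignments cap vs) \<le> cap + 1 \<and> (\<forall>A\<in>set (assignments cap vs). psize A \<le> 2 * psize vs)"
proof (induction vs)
  case (Cons v vs)
  then show ?case by (auto simp: assignments_Cons psize_nat_def)
qed (auto simp: assignments_Nil)

lemma PT_assignments: assumes "PT a" "PT b" shows "PT (\<lambda>x. assignments (a x) (b x))"
proof (rule PT_comp2[OF _ assms])
  show "PT (\<lambda>p. assignments (fst p) (snd p))"
    unfolding assignments_def
  proof (rule PT_foldr[where q = "\<lambda>x. (x + 1) * (2 * x + 1)"])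
    fix p :: "nat \<times> nat list" and j
    let ?l = "assignments (fst p) (drop j (snd p))"
    have ds: "psize (drop j (snd p)) \<le> psize p" using psize_drop[of j "snd p"] by (simp add: psize_prod_def)
    have "psize ?l \<le> length ?l * (2 * psize p + 1)"
      using assignments_size[of "fst p" "drop j (snd p)"] ds by (intro psize_list_le) fastforce
    also have "\<dots> \<le> (psize p + 1) * (2 * psize p + 1)"
    proof (rule mult_right_mono)
      have "length ?l \<le> fst p + 1" using assignments_size[of "fst p" "drop j (snd p)"] by simp
      then show "length ?l \<le> psize p + 1" by (simp add: psize_prod_def psize_nat_def)
    qed simp
    finally show "psize (foldr (\<lambda>v acc. if length acc + length acc \<le> fst p
      then map (\<lambda>A. (v + v) # A) acc @ map (\<lambda>A. Suc (v + v) # A) acc else acc) (drop j (snd p)) [[]]) \<le> (psize p + 1) * (2 * psize p + 1)"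
      unfolding assignments_def .
  qed (intro PT_intros polyb_intros)+
qed

lemma PT_leaf_vertices:
  "PT a \<Longrightarrow> PT b \<Longrightarrow> PT c \<Longrightarrow> PT d \<Longrightarrow> PT e \<Longrightarrow> PT (\<lambda>x. leaf_vertices M (a x) (b x) (c x) (d x) (e x))"
  by (rule PT_comp5, unfold leaf_vertices_def vertices_def)
    (intro PT_intros PT_assignments PT_var_group PT_group_size PT_capped_power PT_leaf_exponent | assumption)+

lemma PT_adjacent: "PT a \<Longrightarrow> PT b \<Longrightarrow> PT (\<lambda>x. adjacent (a x) (b x))"
  by (rule PT_comp2, unfold adjacent_def) (intro PT_intros | assumption)+

lemma PT_encode_vertices: "PT a \<Longrightarrow> PT b \<Longrightarrow> PT (\<lambda>x. encode_vertices (a x) (b x))"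
  by (rule PT_comp2, unfold encode_vertices_def is_terminal_def) (intro PT_intros PT_adjacent | assumption)+

lemma PT_solve_leaf:
  "PT a \<Longrightarrow> PT b \<Longrightarrow> PT c \<Longrightarrow> PT d \<Longrightarrow> PT e \<Longrightarrow> PT (\<lambda>x. solve_leaf p M (a x) (b x) (c x) (d x) (e x))"
  unfolding solve_leaf_def
  by (intro PT_intros PT_sim_result PT_encode_vertices PT_leaf_vertices PT_capped_power PT_leaf_exponent)

lemma PT_reduce: "PT a \<Longrightarrow> PT (\<lambda>x. reduce (a x))"
  by (rule PT_comp, unfold reduce_def) (intro PT_intros PT_remdups | assumption)+

lemma PT_petals: "PT a \<Longrightarrow> PT b \<Longrightarrow> PT c \<Longrightarrow> PT (\<lambda>x. petals (a x) (b x) (c x))"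
  by (rule PT_comp3, unfold petals_def) (intro PT_intros | assumption)+

lemma PT_applicable: "PT a \<Longrightarrow> PT b \<Longrightarrow> PT c \<Longrightarrow> PT (\<lambda>x. applicable (a x) (b x) (c x))"
  by (rule PT_comp3, unfold applicable_def candidates_def) (intro PT_intros PT_petals | assumption)+

lemma PT_normal_form: "PT a \<Longrightarrow> PT b \<Longrightarrow> PT (\<lambda>x. normal_form (a x) (b x))"
  by (rule PT_comp2, unfold normal_form_def) (intro PT_intros PT_reduce | assumption)+

lemma PT_work_step:
  "PT (\<lambda>q. work_step p M (fst (fst q)) (fst (snd (fst q))) (fst (snd (snd (fst q)))) (fst (snd (snd (snd (fst q))))) (snd q))"
  unfolding work_step_def by (intro PT_intros PT_solve_leaf PT_applicable PT_reduce PT_petals)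

section \<open>Size bounds for the stack of formulas\<close>

lemma length_reduced: "reduced N F \<Longrightarrow> length F \<le> (N + 1) ^ 3"
proof -
  assume r: "reduced N F"
  have "length F = card (set F)" using r by (simp add: reduced_def distinct_card)
  also have "\<dots> \<le> card {xs. set xs \<subseteq> {..<N} \<and> length xs \<le> 3}"
    using r by (intro card_mono finite_lists_length_le) (auto simp: reduced_def sorted_clauses_def)
  also have "\<dots> = (\<Sum>i\<le>3. N ^ i)" by (subst card_lists_length_le) auto
  also have "\<dots> \<le> (N + 1) ^ 3" by (simp add: eval_nat_numeral algebra_simps)
  finally show ?thesis .
qed

text \<open>The bound involves \<open>N\<close> only and not the history of the branching: clauses
  are not repeated, and there are polynomially many with at most 3 literals.\<close>

lemma psize_reduced: "reduced N F \<Longrightarrow> psize F \<le> (N + 1) ^ 3 * (3 * (N + 1) + 1)"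
proof -
  assume r: "reduced N F"
  have "psize C \<le> 3 * (N + 1)" if C: "C \<in> set F" for C
  proof -
    have "psize C \<le> length C * (N + 1)"
      using r C by (intro psize_list_le) (force simp: reduced_def sorted_clauses_def psize_nat_def)
    also have "\<dots> \<le> 3 * (N + 1)" using r C by (intro mult_right_mono) (auto simp: reduced_def sorted_clauses_def)
    finally show ?thesis .
  qed
  then have "psize F \<le> length F * (3 * (N + 1) + 1)" by (rule psize_list_le)
  also have "\<dots> \<le> (N + 1) ^ 3 * (3 * (N + 1) + 1)" using length_reduced[OF r] by (rule mult_right_mono) simp
  finally show ?thesis .
qed

lemma reduced_children:
  assumes "reduced N F" "applicable D N F = r # rs"
  shows "reduced N (reduce (fst (snd r) # F))" "reduced N (reduce (petals (fst r) (fst (snd r)) F @ F))"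
proof -
  have s: "sorted_clauses N F" using assms by (simp add: reduced_def)
  have "r \<in> set (applicable D N F)" using assms(2) by simp
  then have "r \<in> set (candidates D N)" by (simp add: applicable_def)
  then have "sorted_clauses N (fst (snd r) # F)"
    using candidate_shape[of "fst r" "fst (snd r)" "snd (snd r)" D N] s by (auto simp: sorted_clauses_def)
  then show "reduced N (reduce (fst (snd r) # F))" by (rule reduced_reduce)
  have "sorted_clauses N (petals (fst r) (fst (snd r)) F @ F)"
    using sorted_clauses_petals[OF s] s by (auto simp: sorted_clauses_def)
  then show "reduced N (reduce (petals (fst r) (fst (snd r)) F @ F))" by (rule reduced_reduce)
qed

lemma work_step_reduced:
  assumes "\<forall>F\<in>set (fst st). reduced (2 * n) F"
  shows "\<forall>F\<in>set (fst (work_step p M i D k n st)). reduced (2 * n) F"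
    and "length (fst (work_step p M i D k n st)) \<le> Suc (length (fst st))"
    and "snd st \<le> 2 \<Longrightarrow> snd (work_step p M i D k n st) \<le> 2"
  using assms unfolding work_step_def
  by (auto split: list.splits dest: reduced_children[of _ _ _ "(a, b, c)" for a b c, unfolded fst_conv snd_conv])

lemma work_iter_reduced:
  "\<forall>F\<in>set (fst ((work_step p M i D k n ^^ j) ([normal_form (2 * n) G], 0))). reduced (2 * n) F"
  "length (fst ((work_step p M i D k n ^^ j) ([normal_form (2 * n) G], 0))) \<le> Suc j"
  "snd ((work_step p M i D k n ^^ j) ([normal_form (2 * n) G], 0)) \<le> 2"
proof (induction j)
  case (Suc j)
  {
    case 1 then show ?case using work_step_reduced(1)[OF Suc(1)] by simp
  next
    case 2 then show ?case using work_step_reduced(2)[OF Suc(1), of p M i D k] Suc(2) by simp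
  next
    case 3 then show ?case using work_step_reduced(3)[OF Suc(1) Suc(3)] by simp
  }
qed (auto simp: reduced_normal_form)

text \<open>A round lengthens the stack by at most one formula, so after at most \<open>i\<close>
  rounds it consists of at most \<open>i + 1\<close> reduced formulas, however many leaves the full
  branching tree has.\<close>

lemma PT_work:
  assumes "PT a" "PT b" "PT c" "PT d" "PT e"
  shows "PT (\<lambda>x. work p M (a x) (b x) (c x) (d x) (e x))"
proof (rule PT_comp5[OF _ assms])
  let ?B = "\<lambda>x :: nat. (2 * x + 1) ^ 3 * (3 * (2 * x + 1) + 1)"
  show "PT (\<lambda>q. work p M (fst q) (fst (snd q)) (fst (snd (snd q))) (fst (snd (snd (snd q)))) (snd (snd (snd (snd q)))))"
    unfolding work_def
  proof (rule PT_iter[where q = "\<lambda>x. (x + 1) * (?B x + 1) + 3", OF _ _ PT_work_step])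
    fix q :: "nat \<times> nat \<times> nat \<times> nat \<times> formula" and j
    assume j: "j \<le> fst q"
    obtain i D k n G where q: "q = (i, D, k, n, G)" by (metis prod.exhaust)
    let ?st = "(work_step p M i D k n ^^ j) ([normal_form (2 * n) G], 0)"
    have "psize (fst ?st) \<le> length (fst ?st) * (?B n + 1)"
      by (rule psize_list_le) (use work_iter_reduced(1) psize_reduced in blast)
    also have "\<dots> \<le> (psize q + 1) * (?B (psize q) + 1)"
    proof (rule mult_mono)
      show "length (fst ?st) \<le> psize q + 1"
        using work_iter_reduced(2)[where p = p and M = M and i = i and D = D and k = k and n = n and j = j and G = G] j
        by (simp add: q psize_Pair psize_nat_def)
      have "n \<le> psize q" by (simp add: q psize_Pair psize_nat_def)
      then show "?B n + 1 \<le> ?B (psize q) + 1" by (intro add_right_mono mult_mono power_mono) auto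
    qed auto
    finally have "psize ?st \<le> (psize q + 1) * (?B (psize q) + 1) + 3"
      using work_iter_reduced(3)[where p = p and M = M and i = i and D = D and k = k and n = n and j = j and G = G]
      unfolding psize_prod_def[of ?st] psize_nat_def by simp
    then show "psize ((work_step p M (fst q) (fst (snd q)) (fst (snd (snd q))) (fst (snd (snd (snd q)))) ^^ j)
      ([normal_form (2 * fst (snd (snd (snd q)))) (snd (snd (snd (snd q))))], 0)) \<le> (psize q + 1) * (?B (psize q) + 1) + 3"
      by (simp add: q)
  qed (intro PT_intros PT_normal_form polyb_intros)+
qed

lemma PT_attempt:
  "PT a \<Longrightarrow> PT b \<Longrightarrow> PT c \<Longrightarrow> PT d \<Longrightarrow> PT e \<Longrightarrow> PT (\<lambda>x. attempt p M (a x) (b x) (c x) (d x) (e x))"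
  unfolding attempt_def by (intro PT_intros PT_work)

lemma PT_parse_clauses: assumes "PT a" shows "PT (\<lambda>x. parse_clauses (a x))"
proof (rule PT_comp[OF _ assms])
  have step: "psize (parse_step st y) \<le> psize st + psize y + 1" for st y
    unfolding parse_step_def by (auto simp: psize_prod_def psize_nat_def)
  have "psize (foldl parse_step st ys) \<le> psize st + psize ys" for st ys
  proof (induction ys arbitrary: st)
    case (Cons y ys)
    show ?case using Cons[of "parse_step st y"] step[of st y] by simp
  qed simp
  note sz = this
  show "PT parse_clauses" unfolding parse_clauses_def
  proof (intro PT_snd, rule PT_foldl[where q = "\<lambda>x. x + 2"])
    show "PT (\<lambda>p :: nat list \<times> (nat \<times> nat list \<times> formula) \<times> nat. parse_step (fst (snd p)) (snd (snd p)))"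
      unfolding parse_step_def by (intro PT_intros)
    show "psize (foldl parse_step (0, [], []) (take j ys)) \<le> psize ys + 2" for ys j
      using sz[of "(0, [], [])" "take j ys"] psize_take[of j ys] by (simp add: psize_Pair psize_nat_def)
  qed (intro PT_intros polyb_intros)+
qed

lemma PT_attempts:
  "PT a \<Longrightarrow> PT b \<Longrightarrow> PT c \<Longrightarrow> PT (\<lambda>x. attempts p M (a x) (b x) (c x))"
  by (rule PT_comp3, unfold attempts_def) (intro PT_intros PT_attempt | assumption)+

lemma PT_sat_search: "PT (sat_search p M)"
  unfolding sat_search_def by (intro PT_intros PT_attempts PT_parse_clauses)

section \<open>Correctness of the algorithm\<close>

lemma models_cons: "models \<alpha> (family (C # F)) \<longleftrightarrow> models \<alpha> (insert (set C) (family F))"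
  and models_append: "models \<alpha> (family (F @ G)) \<longleftrightarrow> models \<alpha> (family F \<union> family G)"
  by (simp_all add: family_def image_Un)

definition sat :: "formula \<Rightarrow> bool" where
  "sat F \<longleftrightarrow> (\<exists>\<alpha>. models \<alpha> (family F))"

lemma sat_children:
  assumes "reduced N F" "applicable D N F = r # rs"
  shows "sat F \<longleftrightarrow> sat (reduce (fst (snd r) # F)) \<or> sat (reduce (petals (fst r) (fst (snd r)) F @ F))"
proof -
  have s: "sorted_clauses N F" using assms by (simp add: reduced_def)
  have "r \<in> set (applicable D N F)" using assms(2) by simp
  then have "r \<in> set (candidates D N)" by (simp add: applicable_def)
  then have s1: "sorted_clauses N (fst (snd r) # F)"
    using candidate_shape[of "fst r" "fst (snd r)" "snd (snd r)" D N] s by (auto simp: sorted_clauses_def)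
  have s2: "sorted_clauses N (petals (fst r) (fst (snd r)) F @ F)"
    using sorted_clauses_petals[OF s] s by (auto simp: sorted_clauses_def)
  show ?thesis
    unfolding sat_def models_reduce[OF s1] models_reduce[OF s2] models_cons models_append family_petals[OF s]
    using models_branch by blast
qed

lemma potential_children:
  assumes r: "reduced N F" and D: "D > 0" and a: "applicable D N F = r # rs"
  shows "potential D N (family (reduce (fst (snd r) # F))) + 1 \<le> potential D N (family F)"
    and "potential D N (family (reduce (petals (fst r) (fst (snd r)) F @ F))) + 2 * D * D \<le> potential D N (family F)"
proof -
  obtain c H t where r': "r = (c, H, t)" by (metis prod.exhaust)
  have s: "sorted_clauses N F" using r by (simp add: reduced_def)
  have ac: "antichain (family F)" using applicable_antichain[OF r D] a by simp
  have ok: "rule_ok D (family F) c (set H)" using applicable_rule_ok[OF r D] a r' by simp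
  have e: "family (H # F) = insert (set H) (family F)" "family (petals c H F @ F) = petalset c (set H) (family F) \<union> family F"
    by (simp_all add: family_petals[OF s, symmetric]) (simp_all add: family_def image_Un)
  note pb = potential_branch[OF sorted_clauses_below[OF s] ac D ok]
  show "potential D N (family (reduce (fst (snd r) # F))) + 1 \<le> potential D N (family F)"
    unfolding family_reduce r' fst_conv snd_conv e by (rule pb)
  show "potential D N (family (reduce (petals (fst r) (fst (snd r)) F @ F))) + 2 * D * D \<le> potential D N (family F)"
    unfolding family_reduce r' fst_conv snd_conv e by (rule pb)
qed

section \<open>Counting the nodes of the branching tree\<close>

lemma cube_le_four_power: "E > 0 \<Longrightarrow> 2 * E ^ 3 \<le> (4 :: nat) ^ E"
proof (induction E rule: nat_induct_non_zero)
  case (Suc E)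
  show ?case
  proof (cases "E = 1")
    case False
    then have "2 \<le> E" using Suc by simp
    then have "3 * E ^ 2 + 3 * E + 1 \<le> 3 * E ^ 3"
    proof -
      have "2 * E ^ 2 \<le> E ^ 3" "2 * E \<le> E ^ 2" using \<open>2 \<le> E\<close> by (simp_all add: power2_eq_square power3_eq_cube)
      moreover have "2 \<le> E" by fact
      ultimately show ?thesis by linarith
    qed
    then have "(Suc E) ^ 3 \<le> 4 * E ^ 3" by (simp add: power3_eq_cube power2_eq_square algebra_simps)
    then show ?thesis using Suc by simp
  qed (simp add: eval_nat_numeral)
qed simp

text \<open>The number of nodes of a branching tree with potential decrements 1 and \<open>2 E\<^sup>4\<close> grows
  like \<open>(1 + 1 / E\<^sup>3)\<close> to the power of the potential.\<close>

definition growth :: "nat \<Rightarrow> real" where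
  "growth E = 1 + 1 / real E ^ 3"

text \<open>By Bernoulli, \<open>growth E ^ (E ^ 3)\<close> is at least 2, so the exponent 2 E^4,
  which is E^3 times 2 E, yields at least \<open>4 ^ E\<close> and hence 2 E^3. Giving up one
  factor, which is at most 2, leaves E^3. The second term is therefore at most the fraction 1/E^3 of
  \<open>growth E ^ (x - 1)\<close>, precisely the margin between the powers \<open>x - 1\<close>
  and \<open>x\<close>.\<close>

lemma growth_ineq:
  assumes E: "E > 0" and a: "a + 1 \<le> x" and b: "b + 2 * (E * E) * (E * E) \<le> x"
  shows "growth E ^ a + growth E ^ b \<le> growth E ^ x"
proof -
  let ?g = "growth E" and ?K = "2 * (E * E) * (E * E)"
  have g1: "1 \<le> ?g" "?g \<le> 2" using E by (auto simp: growth_def)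
  have "1 + real (E ^ 3) * (1 / real E ^ 3) \<le> (1 + 1 / real E ^ 3) ^ (E ^ 3)"
    by (rule Bernoulli_inequality) (smt (verit) zero_le_divide_1_iff zero_le_power of_nat_0_le_iff)
  then have "2 \<le> ?g ^ (E ^ 3)" using E by (simp add: growth_def)
  then have "2 ^ (2 * E) \<le> (?g ^ (E ^ 3)) ^ (2 * E)" by (intro power_mono) auto
  then have "4 ^ E \<le> ?g ^ (E ^ 3 * (2 * E))" by (simp add: power_mult)
  also have "E ^ 3 * (2 * E) = ?K" by (simp add: power3_eq_cube)
  finally have K: "4 ^ E \<le> ?g ^ ?K" .
  have Kpos: "?K > 0" using E by simp
  have "real (2 * E ^ 3) \<le> real (4 ^ E)" using cube_le_four_power[OF E] by (rule of_nat_mono)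
  then have "2 * real E ^ 3 \<le> ?g ^ ?K" using K by simp
  also have "?g ^ ?K = ?g * ?g ^ (?K - 1)" using Kpos by (metis Suc_diff_1 power_Suc)
  also have "\<dots> \<le> 2 * ?g ^ (?K - 1)" using g1 by (intro mult_right_mono) auto
  finally have E3: "real E ^ 3 \<le> ?g ^ (?K - 1)" by simp
  have x: "x = (x - ?K) + ?K" "x - 1 = (x - ?K) + (?K - 1)" "x = Suc (x - 1)" using b Kpos a by auto
  have "?g ^ a \<le> ?g ^ (x - 1)" "?g ^ b \<le> ?g ^ (x - ?K)" using a b g1 by (auto intro!: power_increasing)
  moreover have "?g ^ (x - ?K) \<le> ?g ^ (x - 1) * (1 / real E ^ 3)"
  proof -
    have "?g ^ (x - 1) = ?g ^ (x - ?K) * ?g ^ (?K - 1)" by (subst x(2)) (simp add: power_add)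
    also have "\<dots> \<ge> ?g ^ (x - ?K) * real E ^ 3" using E3 g1 by (intro mult_left_mono) auto
    finally show ?thesis using E by (simp add: field_simps)
  qed
  moreover have "?g ^ x = ?g ^ (x - 1) + ?g ^ (x - 1) * (1 / real E ^ 3)"
    by (subst x(3)) (simp add: growth_def algebra_simps)
  ultimately show ?thesis by linarith
qed

text \<open>The power of \<open>growth E\<close> bounds the number of leaves below a formula, and a
  binary tree with L leaves has 2 L - 1 nodes. The 1 subtracted per formula makes a branching, which
  replaces one formula by two, lower the weight by a full 1.\<close>

definition weight :: "nat \<Rightarrow> nat \<Rightarrow> formula list \<Rightarrow> real" where
  "weight E N Fs = (\<Sum>F\<leftarrow>Fs. 2 * growth E ^ potential (E * E) N (family F) - 1)"

lemma weight_nonneg: "0 \<le> weight E N Fs"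
proof -
  have g: "1 \<le> growth E ^ x" for x by (rule one_le_power) (simp add: growth_def)
  have "0 \<le> 2 * growth E ^ x - 1" for x using g[of x] by linarith
  then show ?thesis unfolding weight_def by (intro sum_list_nonneg) auto
qed

lemma weight_branch:
  assumes r: "reduced N F" and E: "E > 0" and a: "applicable (E * E) N F = r # rs"
  shows "weight E N (reduce (fst (snd r) # F) # reduce (petals (fst r) (fst (snd r)) F @ F) # Fs) + 1 \<le> weight E N (F # Fs)"
proof -
  have "E * E > 0" using E by simp
  note p = potential_children[OF r this a]
  show ?thesis using growth_ineq[OF E p] by (simp add: weight_def)
qed

lemma weight_pop: "weight E N Fs + 1 \<le> weight E N (F # Fs)"
proof -
  have g: "1 \<le> growth E ^ x" for x by (rule one_le_power) (simp add: growth_def)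
  have "1 \<le> 2 * growth E ^ x - 1" for x using g[of x] by linarith
  then show ?thesis by (simp add: weight_def)
qed

text \<open>At most \<open>2 * n\<close> literals, worth 4 E^2 each, bound the potential by 8 E^2 n.
  As the growth rate is at most exp(1/E^3), the exponent is 8 n/E, whose rate vanishes as
  \<open>E\<close> grows.\<close>

lemma weight_start:
  assumes "E > 0" shows "weight E (2 * n) [F] \<le> 2 * exp (8 * real n / real E)"
proof -
  have "card ({..<2 * n} - units (family F)) \<le> card {..<2 * n}" by (intro card_mono) auto
  then have "4 * (E * E) * card ({..<2 * n} - units (family F)) \<le> 4 * (E * E) * (2 * n)" by (intro mult_left_mono) auto
  then have p: "potential (E * E) (2 * n) (family F) \<le> 8 * (E * E) * n" unfolding potential_def by linarith
  have "growth E ^ potential (E * E) (2 * n) (family F) \<le> growth E ^ (8 * (E * E) * n)"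
    by (rule power_increasing[OF p]) (simp add: growth_def)
  also have "\<dots> \<le> exp (1 / real E ^ 3) ^ (8 * (E * E) * n)"
    unfolding growth_def by (intro power_mono exp_ge_add_one_self) (simp add: add_nonneg_nonneg)
  also have "\<dots> = exp (real (8 * (E * E) * n) * (1 / real E ^ 3))" by (rule exp_of_nat_mult[symmetric])
  also have "real (8 * (E * E) * n) * (1 / real E ^ 3) = 8 * real n / real E"
    using assms by (simp add: power3_eq_cube field_simps)
  finally show ?thesis by (simp add: weight_def)
qed

section \<open>Soundness and completeness of the search, given a fast program\<close>

locale dst_solver =
  fixes c :: real and p :: program and f h :: "nat \<Rightarrow> real" and M :: nat
  assumes c: "c > 0" and M: "1 \<le> M" "1 \<le> c * real M"
    and solves: "solves_in_time p encode_dst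
        {I \<in> dst_inputs. real (degeneracy (with_proj (dst_graph I))) \<le> c * log 2 (real (dst_order I)) \<and>
           acyclic_digraph (with_proj (dst_graph I) \<restriction> dst_terminals I)}
        dst_yes (\<lambda>I. f (dst_budget I) * real (dst_order I) powr h (dst_budget I))"
begin

context
  fixes i D k n :: nat and F :: formula
  assumes red: "reduced (2 * n) F" and leaf: "applicable D (2 * n) F = []" and k: "k > 0"
begin

text \<open>Once \<open>2 ^ leaf_exponent\<close> fits into the fuel, no cap is active: the padding
  is complete and, the group size being at most the exponent, so are the lists of partial
  assignments. The instance then satisfies the promise, and the given program must answer correctly
  on it.\<close>

lemma leaf_answers:
  assumes i: "2 ^ leaf_exponent M D k n \<le> i"
  shows "capped_power (leaf_exponent M D k n) (Suc i) = 2 ^ leaf_exponent M D k n"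
    and "answers_within p (encode_vertices (leaf_vertices M i D k n F) k)
      (f k * real (length (leaf_vertices M i D k n F)) powr h k) (sat F)"
    and "length (leaf_vertices M i D k n F) \<le> (2 * k + 3) * (2 * n + 1) ^ 3 * 2 ^ leaf_exponent M D k n"
    and "length (leaf_vertices M i D k n F) \<ge> 1"
proof -
  let ?e = "leaf_exponent M D k n" and ?s = "group_size n k" and ?B = "1 + D + 2 * D * D"
  let ?V = "leaf_vertices M i D k n F"
  show pad: "capped_power ?e (Suc i) = 2 ^ ?e" using i by (simp add: capped_power)
  have V: "?V = vertices i n k ?s F (2 ^ ?e)" by (simp add: leaf_vertices_def pad)
  have "?s * 1 \<le> ?s * ?B" by (intro mult_left_mono) auto
  then have "?s \<le> 1 * (2 + ?s * ?B)" by simp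
  also have "\<dots> \<le> ?e" unfolding leaf_exponent_def using M(1) by (rule mult_right_mono) simp
  finally have se: "?s \<le> ?e" .
  have s_le: "2 ^ ?s \<le> (2 :: nat) ^ ?e" by (rule power_increasing[OF se]) simp
  then have cap: "2 ^ ?s \<le> i" using i by (rule order_trans)
  have yes: "dst_yes (dst_of ?V k) \<longleftrightarrow> sat F"
    unfolding V sat_def
    by (rule vertices_correct[OF cap group_size_bounds(1)[OF k]]) (use red in \<open>simp add: reduced_def\<close>)
  have dg: "degeneracy (with_proj (dst_graph (dst_of ?V k))) \<le> 2 + ?s * ?B"
    unfolding V by (rule vertices_degeneracy[OF cap]) (rule leaf_occurrences[OF red leaf])
  have len: "2 ^ ?e \<le> length ?V" "length ?V \<le> 1 + k * 2 ^ ?s + k + length F + 2 ^ ?e"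
    unfolding V using length_vertices[OF cap] by auto
  \<comment> \<open>The effect of the padding: \<open>1 \<le> c * M\<close> turns the degeneracy
    bound into at most \<open>c\<close> times the logarithm of \<open>2 ^ ?e\<close>, and the order
    is at least that power.\<close>
  have "real (2 + ?s * ?B) * 1 \<le> real (2 + ?s * ?B) * (c * real M)" using M(2) by (intro mult_left_mono) auto
  also have "\<dots> = c * real ?e" by (simp add: leaf_exponent_def algebra_simps)
  also have "real ?e = log 2 (real (2 ^ ?e))" by (simp add: log_nat_power)
  also have "c * log 2 (real (2 ^ ?e)) \<le> c * log 2 (real (length ?V))"
    using c len(1) by (intro mult_left_mono log_mono) (auto simp del: of_nat_power)
  finally have "real (2 + ?s * ?B) \<le> c * log 2 (real (length ?V))" by (simp only: mult_1_right)
  then have "real (degeneracy (with_proj (dst_graph (dst_of ?V k)))) \<le> c * log 2 (real (length ?V))"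
    by (rule order_trans[OF of_nat_mono[OF dg]])
  moreover have "dst_of ?V k \<in> dst_inputs" unfolding V by (rule dst_of_inputs[OF vertices_root])
  ultimately have "dst_of ?V k \<in> {I \<in> dst_inputs. real (degeneracy (with_proj (dst_graph I))) \<le> c * log 2 (real (dst_order I)) \<and>
           acyclic_digraph (with_proj (dst_graph I) \<restriction> dst_terminals I)}"
    using dst_of_acyclic by auto
  from solves[unfolded solves_in_time_def, rule_format, OF this]
  show "answers_within p (encode_vertices ?V k) (f k * real (length ?V) powr h k) (sat F)"
    unfolding encode_dst_of yes by simp
  have one: "1 \<le> (2 :: nat) ^ ?e" by simp
  let ?X = "(2 * n + 1) ^ 3 * 2 ^ ?e"
  have X: "1 \<le> ?X" "2 ^ ?e \<le> ?X" "(2 * n + 1) ^ 3 \<le> ?X" by auto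
  have "k * 2 ^ ?s \<le> k * ?X" using s_le X(2) by (intro mult_left_mono) linarith+
  moreover have "k * 1 \<le> k * ?X" using X(1) by (intro mult_left_mono) auto
  ultimately have "length ?V \<le> ?X + k * ?X + k * ?X + ?X + ?X"
    using len(2) X length_reduced[OF red] by linarith
  then show "length ?V \<le> (2 * k + 3) * (2 * n + 1) ^ 3 * 2 ^ ?e" by (simp add: algebra_simps)
  show "length ?V \<ge> 1" using len(1) one by linarith
qed

text \<open>Outside the promise the program may answer anything. The guard in
  \<open>solve_leaf\<close> admits only instances inside it, so an answer is right even when the
  fuel is far below the time bound.\<close>

lemma solve_leaf_sound:
  assumes "solve_leaf p M i D k n F \<noteq> 0"
  shows "solve_leaf p M i D k n F = (if sat F then 2 else 1)"
proof -
  have "capped_power (leaf_exponent M D k n) (Suc i) \<le> i" using assms by (auto simp: solve_leaf_def split: if_splits)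
  then have "2 ^ leaf_exponent M D k n \<le> i" by (simp add: capped_power split: if_splits)
  from sim_result_answers(1)[OF leaf_answers(2)[OF this], of i] show ?thesis
    using assms by (auto simp: solve_leaf_def split: if_splits)
qed

text \<open>\<open>f\<close> and \<open>h\<close> may be negative; the absolute value and the
  maximum with 0 make the time bound monotone in the order of the instance, of which only an upper
  bound is known.\<close>

lemma solve_leaf_complete:
  assumes i: "2 ^ leaf_exponent M D k n \<le> i"
    and t: "\<bar>f k\<bar> * real ((2 * k + 3) * (2 * n + 1) ^ 3 * 2 ^ leaf_exponent M D k n) powr max (h k) 0 \<le> real i"
  shows "solve_leaf p M i D k n F \<noteq> 0"
proof -
  let ?N = "length (leaf_vertices M i D k n F)"
  have "f k * real ?N powr h k \<le> \<bar>f k\<bar> * real ?N powr h k" by (intro mult_right_mono) auto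
  also have "real ?N powr h k \<le> real ?N powr max (h k) 0"
    using leaf_answers(4)[OF i] by (intro powr_mono) auto
  also have "\<dots> \<le> real ((2 * k + 3) * (2 * n + 1) ^ 3 * 2 ^ leaf_exponent M D k n) powr max (h k) 0"
    using leaf_answers(3)[OF i] by (intro powr_mono2) (auto simp del: of_nat_mult of_nat_power)
  finally have "f k * real ?N powr h k \<le> real i" using t by (simp add: mult_left_mono)
  from sim_result_answers(2)[OF leaf_answers(2)[OF i] this] show ?thesis
    using leaf_answers(1)[OF i] i by (simp add: solve_leaf_def)
qed

end

text \<open>\<open>b\<close> stands for the satisfiability of the original formula. Giving up with
  flag 1 asserts nothing, so the invariant holds for every fuel.\<close>

lemma work_step_sound:
  assumes k: "k > 0" and red: "\<forall>F\<in>set (fst st). reduced (2 * n) F"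
    and inv: "snd st = 2 \<longrightarrow> b" "snd st = 0 \<longrightarrow> (b \<longleftrightarrow> (\<exists>F\<in>set (fst st). sat F))"
  shows "snd (work_step p M i D k n st) = 2 \<longrightarrow> b"
    and "snd (work_step p M i D k n st) = 0 \<longrightarrow> (b \<longleftrightarrow> (\<exists>F\<in>set (fst (work_step p M i D k n st)). sat F))"
proof -
  let ?st = "work_step p M i D k n st"
  have "(snd ?st = 2 \<longrightarrow> b) \<and> (snd ?st = 0 \<longrightarrow> (b \<longleftrightarrow> (\<exists>F\<in>set (fst ?st). sat F)))"
  proof (cases "snd st = 0 \<and> fst st \<noteq> []")
    case False
    then have "?st = st" by (auto simp: work_step_def split: list.splits)
    then show ?thesis using inv by simp
  next
    case True
    then obtain F Fs where F: "fst st = F # Fs" by (cases "fst st") auto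
    have rF: "reduced (2 * n) F" using red F by simp
    have b: "b \<longleftrightarrow> sat F \<or> (\<exists>F\<in>set Fs. sat F)" using inv(2) True F by simp
    show ?thesis
    proof (cases "applicable D (2 * n) F")
      case Nil
      have "?st = (Fs, if solve_leaf p M i D k n F = 0 then 1 else if solve_leaf p M i D k n F = 1 then 0 else 2)"
        using True F Nil by (simp add: work_step_def)
      then show ?thesis using solve_leaf_sound[OF rF Nil k, of i] b by (auto split: if_splits)
    next
      case (Cons r rs)
      have "?st = (reduce (fst (snd r) # F) # reduce (petals (fst r) (fst (snd r)) F @ F) # Fs, 0)"
        using True F Cons by (simp add: work_step_def)
      then show ?thesis using b sat_children[OF rF Cons] by simp
    qed
  qed
  then show "snd ?st = 2 \<longrightarrow> b" "snd ?st = 0 \<longrightarrow> (b \<longleftrightarrow> (\<exists>F\<in>set (fst ?st). sat F))" by auto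
qed

lemma attempt_sound:
  assumes k: "k > 0" and G: "\<forall>C\<in>set G. length C \<le> 3 \<and> set C \<subseteq> {..<2 * n}" and a: "attempt p M i D k n G \<noteq> 0"
  shows "attempt p M i D k n G = (if sat G then 2 else 1)"
proof -
  let ?st = "\<lambda>j. (work_step p M i D k n ^^ j) ([normal_form (2 * n) G], 0)"
  have "(snd (?st j) = 2 \<longrightarrow> sat G) \<and> (snd (?st j) = 0 \<longrightarrow> (sat G \<longleftrightarrow> (\<exists>F\<in>set (fst (?st j)). sat F)))" for j
  proof (induction j)
    case 0
    show ?case using models_normal_form[OF G] by (simp add: sat_def)
  next
    case (Suc j)
    have red: "\<forall>F\<in>set (fst (?st j)). reduced (2 * n) F" by (rule work_iter_reduced(1))
    show ?case using work_step_sound[OF k red, where b = "sat G" and i = i and D = D] Suc by simp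
  qed
  from this[of i] show ?thesis using a unfolding attempt_def work_def by (auto split: if_splits list.splits)
qed

text \<open>Each round with flag 0 and a nonempty stack lowers the weight by at least 1, and the
  initial weight is at most \<open>i\<close>, so \<open>i\<close> rounds finish the tree. The other
  two bounds on \<open>i\<close> ensure that no leaf runs out of fuel.\<close>

lemma attempt_complete:
  assumes E: "E > 0" and k: "k > 0" and i: "2 ^ leaf_exponent M (E * E) k n \<le> i"
    and t: "\<bar>f k\<bar> * real ((2 * k + 3) * (2 * n + 1) ^ 3 * 2 ^ leaf_exponent M (E * E) k n) powr max (h k) 0 \<le> real i"
    and w: "2 * exp (8 * real n / real E) \<le> real i"
  shows "attempt p M i (E * E) k n G \<noteq> 0"
proof -
  let ?st = "\<lambda>j. (work_step p M i (E * E) k n ^^ j) ([normal_form (2 * n) G], 0)"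
  let ?W = "weight E (2 * n) [normal_form (2 * n) G]"
  have inv: "snd (?st j) \<noteq> 1 \<and> (snd (?st j) \<noteq> 0 \<or> fst (?st j) = [] \<or> weight E (2 * n) (fst (?st j)) + real j \<le> ?W)" for j
  proof (induction j)
    case (Suc j)
    define s where "s = ?st j"
    have s': "?st (Suc j) = work_step p M i (E * E) k n s" by (simp add: s_def)
    have red: "\<forall>F\<in>set (fst s). reduced (2 * n) F" unfolding s_def by (rule work_iter_reduced(1))
    show ?case
    proof (cases "snd s = 0 \<and> fst s \<noteq> []")
      case False
      then have "work_step p M i (E * E) k n s = s" by (auto simp: work_step_def split: list.splits)
      then show ?thesis unfolding s' using Suc[folded s_def] False by auto
    next
      case True
      then obtain F Fs where F: "fst s = F # Fs" by (cases "fst s") auto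
      have rF: "reduced (2 * n) F" using red F by simp
      have le: "weight E (2 * n) (F # Fs) + real j \<le> ?W" using Suc[folded s_def] True F by auto
      show ?thesis
      proof (cases "applicable (E * E) (2 * n) F")
        case Nil
        have e: "work_step p M i (E * E) k n s = (Fs, if solve_leaf p M i (E * E) k n F = 0 then 1 else if solve_leaf p M i (E * E) k n F = 1 then 0 else 2)"
          using True F Nil by (simp add: work_step_def)
        have "solve_leaf p M i (E * E) k n F \<noteq> 0" by (rule solve_leaf_complete[OF rF Nil k i t])
        then show ?thesis unfolding s' e using weight_pop[of E "2 * n" Fs F] le by simp
      next
        case (Cons r rs)
        have e: "work_step p M i (E * E) k n s = (reduce (fst (snd r) # F) # reduce (petals (fst r) (fst (snd r)) F @ F) # Fs, 0)"
          using True F Cons by (simp add: work_step_def)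
        show ?thesis unfolding s' e using weight_branch[OF rF E Cons, of Fs] le by simp
      qed
    qed
  qed simp
  have "snd (?st i) \<noteq> 0 \<or> fst (?st i) = []"
  proof (rule ccontr)
    assume n: "\<not> (snd (?st i) \<noteq> 0 \<or> fst (?st i) = [])"
    then obtain F Fs where F: "fst (?st i) = F # Fs" by (cases "fst (?st i)") auto
    \<comment> \<open>A nonempty stack has weight at least 1, but after \<open>i\<close> rounds
      nothing is left of the initial weight.\<close>
    have "weight E (2 * n) (F # Fs) + real i \<le> ?W" using inv[of i] n F by auto
    moreover have "?W \<le> real i" using weight_start[OF E, of n] w by (rule order_trans)
    ultimately show False using weight_pop[of E "2 * n" Fs F] weight_nonneg[of E "2 * n" Fs] by linarith
  qed
  moreover have "snd (?st i) \<le> 2" by (rule work_iter_reduced(3))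
  moreover have "snd (?st i) \<noteq> 1" using inv[of i] by blast
  ultimately show ?thesis unfolding attempt_def work_def by auto
qed

end

section \<open>Parsing the encoded formula\<close>

lemma parse_step_clause:
  "xs \<noteq> [] \<Longrightarrow> foldl parse_step (length xs, cur, cls) xs = (0, [], (rev xs @ cur) # cls)"
proof (induction xs arbitrary: cur)
  case (Cons x xs)
  show ?case
  proof (cases "xs = []")
    case False
    then have "foldl parse_step (length (x # xs), cur, cls) (x # xs) = foldl parse_step (length xs, x # cur, cls) xs"
      by (simp add: parse_step_def)
    also have "\<dots> = (0, [], (rev xs @ x # cur) # cls)" by (rule Cons.IH[OF False])
    finally show ?thesis by simp
  qed (simp add: parse_step_def)
qed simp

lemma parse_clauses_encode:
  "parse_clauses (concat (map (\<lambda>C. length C # map encode_literal C) F)) = rev (map (\<lambda>C. rev (map encode_literal C)) F)"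
proof -
  have "foldl parse_step (0, [], cls) (concat (map (\<lambda>C. length C # map encode_literal C) F)) =
      (0, [], rev (map (\<lambda>C. rev (map encode_literal C)) F) @ cls)" for cls
  proof (induction F arbitrary: cls)
    case (Cons C F)
    have "foldl parse_step (0, [], cls) (length C # map encode_literal C) = (0, [], rev (map encode_literal C) # cls)"
    proof (cases C)
      case (Cons l ls)
      have "foldl parse_step (0, [], cls) (length C # map encode_literal C) =
          foldl parse_step (length (map encode_literal C), [], cls) (map encode_literal C)"
        using Cons by (simp add: parse_step_def)
      also have "\<dots> = (0, [], (rev (map encode_literal C) @ []) # cls)"
        by (rule parse_step_clause) (simp add: Cons)
      finally show ?thesis by simp
    qed (simp add: parse_step_def)
    then show ?case using Cons.IH by simp
  qed simp
  then show ?thesis by (simp add: parse_clauses_def)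
qed

lemma lit_holds_encode: "lit_holds \<alpha> (encode_literal l) \<longleftrightarrow> lit_true \<alpha> l"
  by (cases l) (auto simp: lit_holds_def)

lemma encode_literal_less: "var l < n \<Longrightarrow> encode_literal l < 2 * n"
  by (cases l) auto

context dst_solver begin

text \<open>All conclusive attempts agree with the truth and hence with each other. One suitable
  pair \<open>E\<close>, \<open>k\<close> among those tried therefore suffices, and unsuitable pairs
  do no harm.\<close>

lemma sat_search_encode:
  assumes I: "(n, F) \<in> three_cnf"
  shows "sat_search p M (i, encode_sat (n, F)) > 0 \<Longrightarrow> (sat_search p M (i, encode_sat (n, F)) > 1 \<longleftrightarrow> satisfiable (n, F))"
    and "E > 0 \<Longrightarrow> E \<le> i \<Longrightarrow> k > 0 \<Longrightarrow> k \<le> i \<Longrightarrow> 2 ^ leaf_exponent M (E * E) k n \<le> i \<Longrightarrow>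
      \<bar>f k\<bar> * real ((2 * k + 3) * (2 * n + 1) ^ 3 * 2 ^ leaf_exponent M (E * E) k n) powr max (h k) 0 \<le> real i \<Longrightarrow>
      2 * exp (8 * real n / real E) \<le> real i \<Longrightarrow> sat_search p M (i, encode_sat (n, F)) > 0"
proof -
  define G where "G = rev (map (\<lambda>C. rev (map encode_literal C)) F)"
  have G: "\<forall>C\<in>set G. length C \<le> 3 \<and> set C \<subseteq> {..<2 * n}"
    using I unfolding G_def three_cnf_def by (auto simp: encode_literal_less)
  have sat: "sat G \<longleftrightarrow> satisfiable (n, F)"
    unfolding sat_def satisfiable_def models_def family_def G_def by (simp add: lit_holds_encode)
  have s: "sat_search p M (i, encode_sat (n, F)) = (if \<exists>r\<in>set (attempts p M i n G). r = 2 then 2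
      else if \<exists>r\<in>set (attempts p M i n G). r = 1 then 1 else 0)"
    by (simp add: sat_search_def encode_sat_def parse_clauses_encode G_def)
  have sound: "r = 2 \<and> sat G \<or> r = 1 \<and> \<not> sat G" if ra: "r \<in> set (attempts p M i n G)" "r \<noteq> 0" for r
  proof -
    obtain E k where r: "r = attempt p M i (Suc E * Suc E) (Suc k) n G"
      using ra(1) unfolding attempts_def by auto
    have "r = (if sat G then 2 else 1)" unfolding r by (rule attempt_sound[OF _ G]) (use ra(2) r in auto)
    then show ?thesis by (cases "sat G") auto
  qed
  show "sat_search p M (i, encode_sat (n, F)) > 1 \<longleftrightarrow> satisfiable (n, F)" if "sat_search p M (i, encode_sat (n, F)) > 0"
    using that sound[of 2] sound[of 1] unfolding s sat by (auto split: if_splits)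
  assume a: "E > 0" "E \<le> i" "k > 0" "k \<le> i" "2 ^ leaf_exponent M (E * E) k n \<le> i"
      "\<bar>f k\<bar> * real ((2 * k + 3) * (2 * n + 1) ^ 3 * 2 ^ leaf_exponent M (E * E) k n) powr max (h k) 0 \<le> real i"
      "2 * exp (8 * real n / real E) \<le> real i"
  let ?r = "attempt p M i (E * E) k n G"
  have "?r \<noteq> 0" by (rule attempt_complete[OF a(1,3,5-7)])
  moreover have "?r \<in> set (attempts p M i n G)"
  proof -
    obtain E' k' where ek: "E = Suc E'" "k = Suc k'" using a(1,3) gr0_implies_Suc by blast
    then have m: "E' \<in> set [0..<i]" "k' \<in> set [0..<i]" using a(2,4) by auto
    let ?l = "\<lambda>E. map (\<lambda>k. attempt p M i (Suc E * Suc E) (Suc k) n G) [0..<i]"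
    have "?r \<in> set (?l E')" unfolding set_map ek by (rule image_eqI[OF refl m(2)])
    moreover have "?l E' \<in> set (map ?l [0..<i])" using m(1) by (simp only: set_map) (rule image_eqI[OF refl])
    ultimately show ?thesis unfolding attempts_def set_concat by (rule UN_I[rotated])
  qed
  ultimately have r: "?r \<in> set (attempts p M i n G)" "?r = 2 \<or> ?r = 1" using sound[of ?r] by blast+
  then have "(\<exists>r\<in>set (attempts p M i n G). r = 2) \<or> (\<exists>r\<in>set (attempts p M i n G). r = 1)" by blast
  then show "sat_search p M (i, encode_sat (n, F)) > 0" unfolding s by auto
qed

end

section \<open>Running time\<close>

definition sat_input_bound :: "nat \<Rightarrow> nat" where
  "sat_input_bound n = (2 * n + 1) ^ 3 * (6 * n + 8) + n + 2"

lemma encode_sat_size: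
  assumes I: "(n, F) \<in> three_cnf"
  shows "psize (encode_sat (n, F)) \<le> sat_input_bound n"
proof -
  let ?L = "Pos ` {..<n} \<union> Neg ` {..<n}"
  have "card ?L \<le> card (Pos ` {..<n}) + card (Neg ` {..<n})" by (rule card_Un_le)
  also have "\<dots> \<le> 2 * n" using card_image_le[of "{..<n}" Pos] card_image_le[of "{..<n}" Neg] by simp
  finally have cL: "card ?L \<le> 2 * n" .
  have F: "set F \<subseteq> {C. set C \<subseteq> ?L \<and> length C \<le> 3}"
  proof
    fix C assume C: "C \<in> set F"
    have "l \<in> ?L" if "l \<in> set C" for l
    proof -
      have "var l < n" using I C that by (auto simp: three_cnf_def)
      then show ?thesis by (cases l) auto
    qed
    then show "C \<in> {C. set C \<subseteq> ?L \<and> length C \<le> 3}" using I C by (auto simp: three_cnf_def)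
  qed
  have "length F = card (set F)" using I by (simp add: three_cnf_def distinct_card)
  also have "\<dots> \<le> card {C. set C \<subseteq> ?L \<and> length C \<le> 3}"
    by (rule card_mono[OF finite_lists_length_le F]) simp
  also have "\<dots> = (\<Sum>i\<le>3. card ?L ^ i)" by (rule card_lists_length_le) simp
  also have "\<dots> \<le> (\<Sum>i\<le>3. (2 * n) ^ i)" using cL by (intro sum_mono power_mono) auto
  also have "\<dots> \<le> (2 * n + 1) ^ 3" by (simp add: eval_nat_numeral algebra_simps)
  finally have m: "length F \<le> (2 * n + 1) ^ 3" .
  have clauses: "psize (concat (map (\<lambda>C. length C # map encode_literal C) G)) \<le> length G * (6 * n + 7)"
    if "\<forall>C\<in>set G. length C \<le> 3 \<and> (\<forall>l\<in>set C. var l < n)" for G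
    using that
  proof (induction G)
    case (Cons C G)
    have "psize (map encode_literal C) \<le> length (map encode_literal C) * (2 * n + 1)"
    proof (rule psize_list_le)
      fix y assume "y \<in> set (map encode_literal C)"
      then obtain l where "l \<in> set C" "y = encode_literal l" by auto
      then show "psize y \<le> 2 * n" using Cons.prems encode_literal_less[of l n] by (simp add: psize_nat_def)
    qed
    also have "\<dots> \<le> 3 * (2 * n + 1)" using Cons.prems by (intro mult_right_mono) auto
    finally have "psize (map encode_literal C) \<le> 6 * n + 3" by simp
    moreover have "length C \<le> 3" using Cons.prems by simp
    moreover have "psize (concat (map (\<lambda>C. length C # map encode_literal C) G)) \<le> length G * (6 * n + 7)"
      using Cons by simp
    ultimately show ?case by (simp add: psize_append psize_nat_def)
  qed simp
  have "psize (concat (map (\<lambda>C. length C # map encode_literal C) F)) \<le> length F * (6 * n + 7)"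
    by (rule clauses) (use I in \<open>auto simp: three_cnf_def\<close>)
  then have "psize (encode_sat (n, F)) \<le> length F * (6 * n + 8) + n + 2"
    by (simp add: encode_sat_def psize_nat_def algebra_simps)
  moreover have "length F * (6 * n + 8) \<le> (2 * n + 1) ^ 3 * (6 * n + 8)" using m by (rule mult_right_mono) simp
  ultimately show ?thesis unfolding sat_input_bound_def by linarith
qed

text \<open>Constants and polynomial factors are absorbed by doubling the rate from
  \<open>\<epsilon>\<close> to \<open>2 * \<epsilon>\<close>.\<close>

lemma eventually_subexponential:
  fixes K b \<epsilon> :: real
  assumes "\<epsilon> > 0"
  shows "eventually (\<lambda>n :: nat. K * ((2 * real n + 1) powr b * 2 powr (\<epsilon> * real n)) \<le> 2 powr (2 * \<epsilon> * real n)) sequentially"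
proof -
  have "(\<lambda>n :: nat. (2 * real n + 1) powr b * 2 powr (- \<epsilon> * real n)) \<longlonglongrightarrow> 0"
    using assms by real_asymp
  then have "eventually (\<lambda>n :: nat. (2 * real n + 1) powr b * 2 powr (- \<epsilon> * real n) < 1 / (\<bar>K\<bar> + 1)) sequentially"
    by (rule order_tendstoD) simp
  then show ?thesis
  proof eventually_elim
    case (elim n)
    let ?Y = "(2 * real n + 1) powr b * 2 powr (- \<epsilon> * real n)"
    have "K * ?Y \<le> (\<bar>K\<bar> + 1) * ?Y" by (intro mult_right_mono) auto
    also have "\<dots> \<le> 1" using elim by (simp add: field_simps)
    finally have "K * ?Y * 2 powr (2 * \<epsilon> * real n) \<le> 1 * 2 powr (2 * \<epsilon> * real n)" by (intro mult_right_mono) auto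
    also have "K * ?Y * 2 powr (2 * \<epsilon> * real n) = K * ((2 * real n + 1) powr b * (2 powr (- \<epsilon> * real n) * 2 powr (2 * \<epsilon> * real n)))"
      by simp
    also have "2 powr (- \<epsilon> * real n) * 2 powr (2 * \<epsilon> * real n) = 2 powr (\<epsilon> * real n)"
      by (simp add: powr_add[symmetric])
    finally show ?case by simp
  qed
qed

context dst_solver begin

text \<open>A sum of nonnegative terms is at least each of them, so fuel of this size meets all
  lower bounds on \<open>i\<close> in \<open>sat_search_encode\<close> at once.\<close>

definition fuel :: "nat \<Rightarrow> nat \<Rightarrow> nat \<Rightarrow> real" where
  "fuel E k n = real E + real k + 2 ^ leaf_exponent M (E * E) k n +
     \<bar>f k\<bar> * real ((2 * k + 3) * (2 * n + 1) ^ 3 * 2 ^ leaf_exponent M (E * E) k n) powr max (h k) 0 +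
     2 * exp (8 * real n / real E)"

lemma sat_search_fuel:
  assumes "E > 0" "k > 0"
  obtains i where "real i \<le> fuel E k n + 1" "\<And>F. (n, F) \<in> three_cnf \<Longrightarrow> sat_search p M (i, encode_sat (n, F)) > 0"
proof -
  let ?t = "\<bar>f k\<bar> * real ((2 * k + 3) * (2 * n + 1) ^ 3 * 2 ^ leaf_exponent M (E * E) k n) powr max (h k) 0"
  have t: "0 \<le> ?t" by (intro mult_nonneg_nonneg) auto
  have x: "0 \<le> exp (8 * real n / real E)" "0 \<le> (2 :: real) ^ leaf_exponent M (E * E) k n" by auto
  define i where "i = nat \<lceil>fuel E k n\<rceil>"
  have nonneg: "0 \<le> fuel E k n" unfolding fuel_def using t x by linarith
  have i: "fuel E k n \<le> real i" "real i \<le> fuel E k n + 1" unfolding i_def using nonneg by linarith+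
  have "real E \<le> real i" "real k \<le> real i" "(2 :: real) ^ leaf_exponent M (E * E) k n \<le> real i" "?t \<le> real i"
    "2 * exp (8 * real n / real E) \<le> real i"
    using i(1) t x unfolding fuel_def by linarith+
  moreover from this(3) have "2 ^ leaf_exponent M (E * E) k n \<le> i"
    by (metis of_nat_le_iff of_nat_numeral of_nat_power)
  ultimately have "sat_search p M (i, encode_sat (n, F)) > 0" if "(n, F) \<in> three_cnf" for F
    using sat_search_encode(2)[OF that assms(1) _ assms(2)] by simp
  then show ?thesis using that[OF i(2)] by blast
qed

text \<open>Separates a part that is constant in \<open>n\<close> from the rate in \<open>n\<close>,
  which for fixed \<open>D\<close> tends to 0 as \<open>k\<close> grows.\<close>

lemma leaf_exponent_le:
  assumes "k > 0"
  shows "real (leaf_exponent M D k n) \<le> real M * (3 + real D + 2 * real D * real D) + real M * (1 + real D + 2 * real D * real D) / real k * real n"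
proof -
  let ?B = "1 + real D + 2 * real D * real D"
  have B: "0 \<le> ?B" by simp
  have alg: "real M * (2 + (real n / real k + 1) * B) = real M * (2 + B) + real M * B / real k * real n" for B :: real
    using assms by (simp add: field_simps)
  have "real (leaf_exponent M D k n) = real M * (2 + real (group_size n k) * ?B)"
    by (simp add: leaf_exponent_def algebra_simps)
  also have "\<dots> \<le> real M * (2 + (real n / real k + 1) * ?B)"
    using group_size_bounds(2)[OF assms] B by (intro mult_left_mono add_left_mono mult_right_mono) auto
  also have "\<dots> = real M * (2 + ?B) + real M * ?B / real k * real n" by (rule alg)
  also have "2 + ?B = 3 + real D + 2 * real D * real D" by simp
  finally show ?thesis .
qed

text \<open>As \<open>log 2 (real k)\<close> is at least 1 for \<open>k \<ge> 2\<close>, the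
  hypothesis makes h(k)/k tend to 0. \<open>K\<close> is fixed beforehand, so both quotients are
  small for all large \<open>k\<close>. Dividing \<open>\<delta>\<close> by \<open>K + 1\<close>
  also covers \<open>K = 0\<close>.\<close>

lemma budget_exists:
  assumes h: "h \<in> o(\<lambda>k. real k / log 2 (real k))" and "K \<ge> 0" "\<delta> > 0"
  shows "\<exists>k>0. K / real k \<le> \<delta> \<and> K * max (h k) 0 / real k \<le> \<delta>"
proof -
  have "eventually (\<lambda>k. norm (h k) \<le> \<delta> / (K + 1) * norm (real k / log 2 (real k))) sequentially"
    using assms by (intro landau_o.smallD[OF h]) auto
  moreover have "eventually (\<lambda>k. k \<ge> 2 + nat \<lceil>K / \<delta>\<rceil>) sequentially" by (rule eventually_ge_at_top)
  ultimately have "eventually (\<lambda>k. k > 0 \<and> K / real k \<le> \<delta> \<and> K * max (h k) 0 / real k \<le> \<delta>) sequentially"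
  proof eventually_elim
    case (elim k)
    have k: "k \<ge> 2" "real k \<ge> K / \<delta>" using elim(2) by (auto, linarith)
    have "log 2 2 \<le> log 2 (real k)" using k(1) by (intro log_mono) auto
    then have l: "1 \<le> log 2 (real k)" by simp
    have "norm (real k / log 2 (real k)) = real k / log 2 (real k)" using l by simp
    also have "\<dots> \<le> real k / 1" using l by (intro divide_left_mono) auto
    finally have nk: "norm (real k / log 2 (real k)) \<le> real k" by simp
    have "h k \<le> norm (h k)" by simp
    also have "\<dots> \<le> \<delta> / (K + 1) * norm (real k / log 2 (real k))" by (rule elim(1))
    also have "\<dots> \<le> \<delta> / (K + 1) * real k" using nk assms by (intro mult_left_mono) auto
    finally have "max (h k) 0 \<le> \<delta> / (K + 1) * real k" using assms by simp
    then have "K * max (h k) 0 \<le> K * (\<delta> / (K + 1) * real k)" using assms by (intro mult_left_mono) auto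
    also have "\<dots> = (K / (K + 1)) * (\<delta> * real k)" by simp
    also have "\<dots> \<le> 1 * (\<delta> * real k)" using assms by (intro mult_right_mono) auto
    finally have "K * max (h k) 0 / real k \<le> \<delta>" using k by (simp add: field_simps)
    moreover have "K / real k \<le> \<delta>" using k assms by (simp add: field_simps)
    ultimately show ?case using k by simp
  qed
  from eventually_happens'[OF sequentially_bot this] show ?thesis by blast
qed

text \<open>The choices build on one another: \<open>E\<close> controls the number of leaves,
  \<open>E\<close> determines \<open>K\<close>, and \<open>k\<close> then controls the order of the
  leaf instances and the time spent on them. None depends on \<open>n\<close>, so \<open>f k\<close>
  is part of the constant \<open>C\<close>.\<close>

lemma fuel_subexponential:
  assumes h: "h \<in> o(\<lambda>k. real k / log 2 (real k))" and \<epsilon>: "\<epsilon> > 0"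
  shows "\<exists>E>0. \<exists>k>0. eventually (\<lambda>n. fuel E k n + 1 \<le> 2 powr (2 * \<epsilon> * real n)) sequentially"
proof -
  \<comment> \<open>Large enough for \<open>exp (8 * n / E) \<le> 2 powr (\<epsilon> * n)\<close>;
    the factor \<open>ln 2\<close> accounts for the change of base, and the final 1 makes
    \<open>E\<close> positive.\<close>
  define E where "E = nat \<lceil>8 / (\<epsilon> * ln 2)\<rceil> + 1"
  have E: "E > 0" "8 / (\<epsilon> * ln 2) \<le> real E" unfolding E_def by (auto, linarith)
  define D where "D = E * E"
  define A where "A = real M * (3 + real D + 2 * real D * real D)"
  define K where "K = real M * (1 + real D + 2 * real D * real D)"
  have AK: "A \<ge> 0" "K \<ge> 0" by (auto simp: A_def K_def)
  obtain k where k: "k > 0" "K / real k \<le> \<epsilon>" "K * max (h k) 0 / real k \<le> \<epsilon>"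
    using budget_exists[OF h AK(2) \<epsilon>] by blast
  define g where "g = max (h k) 0"
  have g: "g \<ge> 0" by (simp add: g_def)
  define Y where "Y = (\<lambda>n :: nat. (2 * real n + 1) powr (3 * g) * 2 powr (\<epsilon> * real n))"
  have P1: "1 \<le> (2 * real n + 1) powr (3 * g)" for n using g by (intro ge_one_powr_ge_zero) auto
  have P2: "1 \<le> 2 powr (\<epsilon> * real n)" for n using \<epsilon> by (intro ge_one_powr_ge_zero) auto
  have Y1: "1 \<le> Y n" for n unfolding Y_def using mult_mono[OF P1[of n] P2[of n]] by simp
  have Y2: "2 powr (\<epsilon> * real n) \<le> Y n" for n
    unfolding Y_def using mult_right_mono[OF P1[of n], of "2 powr (\<epsilon> * real n)"] by simp
  have e: "real (leaf_exponent M D k n) \<le> A + K / real k * real n" for n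
    unfolding A_def K_def by (rule leaf_exponent_le[OF k(1)])
  have T1: "2 ^ leaf_exponent M D k n \<le> 2 powr A * Y n" for n
  proof -
    have "real (leaf_exponent M D k n) \<le> A + \<epsilon> * real n"
      using e[of n] mult_right_mono[OF k(2), of "real n"] by linarith
    then have "2 powr real (leaf_exponent M D k n) \<le> 2 powr (A + \<epsilon> * real n)" by (intro powr_mono) auto
    also have "\<dots> = 2 powr A * 2 powr (\<epsilon> * real n)" by (rule powr_add)
    also have "\<dots> \<le> 2 powr A * Y n" using Y2[of n] by (intro mult_left_mono) auto
    finally show ?thesis by (simp add: powr_realpow)
  qed
  have T2: "real ((2 * k + 3) * (2 * n + 1) ^ 3 * 2 ^ leaf_exponent M D k n) powr g \<le> (2 * real k + 3) powr g * 2 powr (A * g) * Y n" for n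
  proof -
    let ?e = "leaf_exponent M D k n"
    have "real ((2 * k + 3) * (2 * n + 1) ^ 3 * 2 ^ ?e) powr g =
        (2 * real k + 3) powr g * ((2 * real n + 1) ^ 3) powr g * (2 ^ ?e) powr g"
      by (simp add: powr_mult ac_simps)
    also have "((2 * real n + 1) ^ 3) powr g = (2 * real n + 1) powr (3 * g)"
      by (subst powr_powr[symmetric]) (simp add: powr_numeral)
    also have "(2 ^ ?e) powr g = 2 powr (real ?e * g)"
      by (subst powr_powr[symmetric], subst powr_realpow) simp_all
    also have "(2 * real k + 3) powr g * (2 * real n + 1) powr (3 * g) * 2 powr (real ?e * g) \<le>
        (2 * real k + 3) powr g * (2 * real n + 1) powr (3 * g) * (2 powr (A * g) * 2 powr (\<epsilon> * real n))"
    proof (rule mult_left_mono)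
      have "real ?e * g \<le> (A + K / real k * real n) * g" using e[of n] g by (rule mult_right_mono)
      also have "\<dots> = A * g + K * g / real k * real n" by (simp add: algebra_simps)
      also have "\<dots> \<le> A * g + \<epsilon> * real n"
        using k(3) unfolding g_def[symmetric] by (intro add_left_mono mult_right_mono) auto
      finally have "2 powr (real ?e * g) \<le> 2 powr (A * g + \<epsilon> * real n)" by (intro powr_mono) auto
      then show "2 powr (real ?e * g) \<le> 2 powr (A * g) * 2 powr (\<epsilon> * real n)" by (simp add: powr_add)
    qed simp
    finally show ?thesis by (simp add: Y_def ac_simps)
  qed
  have T3: "exp (8 * real n / real E) \<le> Y n" for n
  proof -
    have "8 / real E \<le> \<epsilon> * ln 2" using E \<epsilon> by (simp add: field_simps)
    then have "8 / real E * real n \<le> \<epsilon> * ln 2 * real n" by (rule mult_right_mono) simp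
    then have "exp (8 * real n / real E) \<le> exp (\<epsilon> * real n * ln 2)" by (simp add: ac_simps)
    also have "\<dots> = 2 powr (\<epsilon> * real n)" by (simp add: powr_def)
    finally show ?thesis using Y2[of n] by linarith
  qed
  define C where "C = real E + real k + 2 powr A + \<bar>f k\<bar> * ((2 * real k + 3) powr g * 2 powr (A * g)) + 2 + 1"
  have "fuel E k n + 1 \<le> C * Y n" for n
  proof -
    have "\<bar>f k\<bar> * real ((2 * k + 3) * (2 * n + 1) ^ 3 * 2 ^ leaf_exponent M D k n) powr g \<le>
        \<bar>f k\<bar> * ((2 * real k + 3) powr g * 2 powr (A * g) * Y n)" by (rule mult_left_mono[OF T2]) simp
    moreover have "real E \<le> real E * Y n" "real k \<le> real k * Y n"
      using Y1[of n] mult_left_mono[OF Y1[of n], of "real E"] mult_left_mono[OF Y1[of n], of "real k"] by auto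
    ultimately have "fuel E k n + 1 \<le> real E * Y n + real k * Y n + 2 powr A * Y n +
        \<bar>f k\<bar> * ((2 * real k + 3) powr g * 2 powr (A * g) * Y n) + 2 * Y n + Y n"
      using T1[of n] T3[of n] Y1[of n] unfolding fuel_def D_def[symmetric] g_def[symmetric] by linarith
    also have "\<dots> = C * Y n" by (simp add: C_def algebra_simps)
    finally show ?thesis .
  qed
  moreover have "eventually (\<lambda>n. C * Y n \<le> 2 powr (2 * \<epsilon> * real n)) sequentially"
    unfolding Y_def by (rule eventually_subexponential[OF \<epsilon>])
  ultimately have "eventually (\<lambda>n. fuel E k n + 1 \<le> 2 powr (2 * \<epsilon> * real n)) sequentially"
    by (auto elim!: eventually_mono intro: order_trans)
  then show ?thesis using E(1) k(1) by blast
qed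

text \<open>\<open>ETH\<close> concerns one program and one \<open>g\<close>, whereas
  \<open>E\<close> and \<open>k\<close> depend on the desired rate. The search makes the program
  independent of them. For \<open>g\<close> the logarithm of the least time bound valid for all
  formulas on \<open>n\<close> variables is taken; each fixed choice of \<open>E\<close> and
  \<open>k\<close> bounds it from above.\<close>

theorem not_ETH:
  assumes h: "h \<in> o(\<lambda>k. real k / log 2 (real k))"
  shows "\<not> ETH"
proof -
  obtain P q where q: "polyb q" and P: "\<And>xs i. sat_search p M (i, xs) \<noteq> 0 \<Longrightarrow> (\<forall>j<i. sat_search p M (j, xs) = 0) \<Longrightarrow>
      answers_within P xs (real (q (i + psize xs))) (sat_search p M (i, xs) > 1)"
    using PT_search[OF PT_sat_search[of p M]] by blast
  obtain C where C: "\<And>x. q x \<le> (x + 2) ^ C" using polyb_le_power[OF q] by blast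
  define good where "good = (\<lambda>n t :: nat. \<forall>F. (n, F) \<in> three_cnf \<longrightarrow>
      answers_within P (encode_sat (n, F)) (real t) (satisfiable (n, F)))"
  have mono: "answers_within P xs t b \<Longrightarrow> t \<le> u \<Longrightarrow> answers_within P xs u b" for xs t u b
    unfolding answers_within_def by (meson order_trans)
  have good_fuel: "\<exists>t. good n t \<and> real t \<le> (fuel E k n + 1 + real (sat_input_bound n) + 2) ^ C" if Ek: "E > 0" "k > 0" for E k n
  proof -
    obtain i where i: "real i \<le> fuel E k n + 1" "\<And>F. (n, F) \<in> three_cnf \<Longrightarrow> sat_search p M (i, encode_sat (n, F)) > 0"
      using sat_search_fuel[OF Ek, of n] by blast
    have "good n (q (i + sat_input_bound n))" unfolding good_def
    proof (intro allI impI)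
      fix F assume F: "(n, F) \<in> three_cnf"
      let ?xs = "encode_sat (n, F)"
      define j where "j = (LEAST j. sat_search p M (j, ?xs) \<noteq> 0)"
      have j: "sat_search p M (j, ?xs) \<noteq> 0" "j \<le> i"
        unfolding j_def using i(2)[OF F] by (auto intro: LeastI Least_le)
      have "\<forall>j'<j. sat_search p M (j', ?xs) = 0" unfolding j_def using not_less_Least by blast
      from P[OF j(1) this] have "answers_within P ?xs (real (q (j + psize ?xs))) (satisfiable (n, F))"
        using sat_search_encode(1)[OF F, of j] j(1) by simp
      moreover have "q (j + psize ?xs) \<le> q (i + sat_input_bound n)"
        using j(2) encode_sat_size[OF F] by (intro polyb_mono[OF q]) simp
      ultimately show "answers_within P ?xs (real (q (i + sat_input_bound n))) (satisfiable (n, F))"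
        using mono by simp
    qed
    moreover have "real (q (i + sat_input_bound n)) \<le> (fuel E k n + 1 + real (sat_input_bound n) + 2) ^ C"
    proof -
      have "real (q (i + sat_input_bound n)) \<le> real ((i + sat_input_bound n + 2) ^ C)" using C by (rule of_nat_mono)
      also have "\<dots> = (real i + real (sat_input_bound n) + 2) ^ C" by (simp add: ac_simps)
      also have "\<dots> \<le> (fuel E k n + 1 + real (sat_input_bound n) + 2) ^ C" using i(1) by (intro power_mono) auto
      finally show ?thesis .
    qed
    ultimately show ?thesis by blast
  qed
  define T where "T = (\<lambda>n. LEAST t. good n t)"
  \<comment> \<open>That some bound exists follows from any parameters, here
    \<open>E = k = 1\<close>.\<close>
  have goodT: "good n (T n)" for n unfolding T_def using good_fuel[of 1 1 n] by (auto intro: LeastI)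
  \<comment> \<open>The maximum with 1 keeps the logarithm nonnegative.\<close>
  define g where "g = (\<lambda>n. log 2 (real (max 1 (T n))))"
  have "solves_in_time P encode_sat three_cnf satisfiable (\<lambda>I. 2 powr g (fst I))"
    unfolding solves_in_time_def
  proof
    fix I assume I: "I \<in> three_cnf"
    obtain n F where nF: "I = (n, F)" by (cases I)
    have "2 powr g n = real (max 1 (T n))" by (simp add: g_def)
    then have "real (T n) \<le> 2 powr g n" by simp
    moreover have "answers_within P (encode_sat I) (real (T n)) (satisfiable I)"
      using goodT[of n] I by (auto simp: good_def nF)
    ultimately show "answers_within P (encode_sat I) (2 powr g (fst I)) (satisfiable I)"
      using mono by (simp add: nF)
  qed
  moreover have "g \<in> o(\<lambda>n. real n)"
  proof (rule landau_o.smallI)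
    fix \<delta> :: real assume \<delta>: "\<delta> > 0"
    \<comment> \<open>Fuel and input size together are at most twice
      \<open>2 powr (2 * \<epsilon> * n)\<close>. In the power \<open>C\<close> this rate is at most
      \<open>\<delta> / 2\<close>; the other half of \<open>\<delta>\<close> absorbs the constant
      \<open>2 ^ C\<close>.\<close>
    define \<epsilon> where "\<epsilon> = \<delta> / (4 * (real C + 1))"
    have \<epsilon>: "\<epsilon> > 0" using \<delta> by (simp add: \<epsilon>_def)
    obtain E k where Ek: "E > 0" "k > 0" and ev: "eventually (\<lambda>n. fuel E k n + 1 \<le> 2 powr (2 * \<epsilon> * real n)) sequentially"
      using fuel_subexponential[OF h \<epsilon>] by blast
    have ev2: "eventually (\<lambda>n. real (sat_input_bound n) + 2 \<le> 2 powr (2 * \<epsilon> * real n)) sequentially"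
      unfolding sat_input_bound_def using \<epsilon> by real_asymp
    have ev3: "eventually (\<lambda>n. 2 ^ C \<le> 2 powr (\<delta> / 2 * real n)) sequentially" using \<delta> by real_asymp
    from ev ev2 ev3 show "eventually (\<lambda>n. norm (g n) \<le> \<delta> * norm (real n)) sequentially"
    proof eventually_elim
      case (elim n)
      obtain t where t: "good n t" "real t \<le> (fuel E k n + 1 + real (sat_input_bound n) + 2) ^ C"
        using good_fuel[OF Ek] by blast
      have f0: "0 \<le> fuel E k n" unfolding fuel_def by (intro add_nonneg_nonneg mult_nonneg_nonneg) auto
      have "T n \<le> t" unfolding T_def using t(1) by (rule Least_le)
      then have "real (T n) \<le> real t" by simp
      also have "\<dots> \<le> (fuel E k n + 1 + real (sat_input_bound n) + 2) ^ C" by (rule t(2))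
      also have "\<dots> \<le> (2 * 2 powr (2 * \<epsilon> * real n)) ^ C" using elim f0 by (intro power_mono) auto
      also have "\<dots> = 2 ^ C * 2 powr (real C * (2 * \<epsilon> * real n))"
        by (simp only: power_mult_distrib) (simp add: powr_power ac_simps)
      also have "\<dots> \<le> 2 powr (\<delta> / 2 * real n) * 2 powr (\<delta> / 2 * real n)"
      proof (rule mult_mono[OF elim(3)])
        have "real C * (2 * \<epsilon>) = (real C / (real C + 1)) * (\<delta> / 2)" by (simp add: \<epsilon>_def field_simps)
        also have "\<dots> \<le> 1 * (\<delta> / 2)" using \<delta> by (intro mult_right_mono) auto
        finally have "real C * (2 * \<epsilon>) * real n \<le> \<delta> / 2 * real n" by (intro mult_right_mono) auto
        then show "2 powr (real C * (2 * \<epsilon> * real n)) \<le> 2 powr (\<delta> / 2 * real n)" by (intro powr_mono) (auto simp: ac_simps)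
      qed auto
      also have "\<dots> = 2 powr (\<delta> * real n)" by (simp add: powr_add[symmetric])
      finally have "real (T n) \<le> 2 powr (\<delta> * real n)" .
      moreover have "1 \<le> 2 powr (\<delta> * real n)" using \<delta> by (intro ge_one_powr_ge_zero) auto
      ultimately have "real (max 1 (T n)) \<le> 2 powr (\<delta> * real n)" by (simp add: max_def)
      then have "g n \<le> log 2 (2 powr (\<delta> * real n))" unfolding g_def by (intro log_mono) auto
      then have "g n \<le> \<delta> * real n" by simp
      moreover have "0 \<le> g n" by (simp add: g_def)
      ultimately show ?case by simp
    qed
  qed
  ultimately show ?thesis unfolding ETH_def by blast
qed

end

theorem theorem7:
  fixes c :: real
  assumes "c > 0" and "ETH"
  shows
    "\<not> dst_fast_solvable_on
        {I \<in> dst_inputs. real (degeneracy (with_proj (dst_graph I))) \<le> c * log 2 (real (dst_order I))} \<and>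
     \<not> dst_fast_solvable_on
        {I \<in> dst_inputs. real (degeneracy (with_proj (dst_graph I))) \<le> c * log 2 (real (dst_order I)) \<and>
           acyclic_digraph (with_proj (dst_graph I) \<restriction> dst_terminals I)}"
proof -
  let ?X = "{I \<in> dst_inputs. real (degeneracy (with_proj (dst_graph I))) \<le> c * log 2 (real (dst_order I))}"
  let ?Y = "{I \<in> dst_inputs. real (degeneracy (with_proj (dst_graph I))) \<le> c * log 2 (real (dst_order I)) \<and>
           acyclic_digraph (with_proj (dst_graph I) \<restriction> dst_terminals I)}"
  have Y: "\<not> dst_fast_solvable_on ?Y"
  proof
    assume "dst_fast_solvable_on ?Y"
    then obtain p f h where h: "h \<in> o(\<lambda>k. real k / log 2 (real k))"
      and s: "solves_in_time p encode_dst ?Y dst_yes (\<lambda>I. f (dst_budget I) * real (dst_order I) powr h (dst_budget I))"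
      unfolding dst_fast_solvable_on_def by blast
    define M where "M = nat \<lceil>1 / c\<rceil> + 1"
    have "1 / c \<le> real M" unfolding M_def by linarith
    then have "1 \<le> c * real M" using assms(1) by (simp add: field_simps)
    then interpret dst_solver c p f h M using assms(1) s by unfold_locales (auto simp: M_def)
    show False using not_ETH[OF h] assms(2) by blast
  qed
  \<comment> \<open>A program for the larger class also solves the smaller one, so hardness under
    the acyclicity promise yields the first claim.\<close>
  moreover have "dst_fast_solvable_on ?Y" if "dst_fast_solvable_on ?X"
    using that unfolding dst_fast_solvable_on_def solves_in_time_def by blast
  ultimately show ?thesis by blast
qed

end
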